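(* Let $a,b,c,\alpha,W>0$, and let $(H_\tau)_{\tau\in\mathbb{R}}$ be the exponentially attenuated Ornstein-Uhlenbeck channel with parameters $a,b,c$ (defined in the context). Let $\hat H_f=\int_{-\infty}^{\infty}e^{-j2\pi f\tau}H_\tau\,d\tau$. Put $\beta_1=\dfrac{2\pi^2}{\alpha c(a+b)}$ and $\beta_2=\dfrac{(a+b)^2}{4\pi^2}$. Then the ergodic capacity $$C=E\left[\int_{-W/2}^{W/2}\log_2\bigl(1+\alpha|\hat H_f|^2\bigr)\,df\right]$$ is given by $$C=\frac{W}{\ln 2}\sum_{n=0}^{\infty}\frac{1}{n+1}\sum_{k=0}^{n}\frac{1}{2k+1}\,L_k^{\frac12}\bigl(\beta_1W^2/4\bigr)\,L_{n-k}^{-\frac12}(\beta_1\beta_2).$$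
   Context: Exponentially attenuated Ornstein-Uhlenbeck channel: $H_\tau=X_\tau+jY_\tau$ ($j$ the imaginary unit), where $(X_\tau)_{\tau\in\mathbb{R}}$, $(Y_\tau)_{\tau\in\mathbb{R}}$ are independent real Gaussian processes with zero mean and common covariance function $$R(\tau,\tau')=c\,e^{-a|\tau-\tau'|}\,b\,e^{-b(\tau+\tau')}\,\mathbf 1_{[0,\infty)}(\tau)\,\mathbf 1_{[0,\infty)}(\tau'),\qquad \tau,\tau'\in\mathbb{R}.$$ Equivalently, $X_\tau=\tilde X_\tau g(\tau)$ and $Y_\tau=\tilde Y_\tau g(\tau)$ with $\tilde X,\tilde Y$ independent stationary Ornstein-Uhlenbeck processes with covariance $e^{-a|\tau-\tau'|}$ and $g(\tau)=\sqrt{bc}\,e^{-b\tau}\mathbf 1_{[0,\infty)}(\tau)$. Integrals of random processes are stochastic Riemann integrals, i.e. mean-square limits of Riemann sums (with a further mean-square limit for infinite integration bounds). $L_k^\mu$ denotes the generalized Laguerre polynomial of degree $k$ with parameter $\mu$, $L_k^\mu(x)=\sum_{i=0}^k(-1)^i\binom{k+\mu}{k-i}\frac{x^i}{i!}$. *)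

theory Defs
  imports "HOL-Probability.Probability"
begin

section \<open>Mean-square limits and stochastic Riemann integrals\<close>

text \<open>
  The squared distance is a Lebesgue integral with values in the extended nonnegative reals, so
  that a difference which is not square-integrable has distance infinity (the Bochner integral
  would return 0).
\<close>

definition ms_tendsto ::
  "'w measure \<Rightarrow> ('i \<Rightarrow> 'w \<Rightarrow> 'b::{second_countable_topology, banach}) \<Rightarrow> ('w \<Rightarrow> 'b) \<Rightarrow> 'i filter \<Rightarrow> bool"
  where "ms_tendsto M S I F \<longleftrightarrow>
    (\<forall>\<^sub>F i in F. S i \<in> borel_measurable M) \<and> I \<in> borel_measurable M \<and>
    ((\<lambda>i. \<integral>\<^sup>+\<omega>. ennreal ((norm (S i \<omega> - I \<omega>))\<^sup>2) \<partial>M) \<longlongrightarrow> 0) F"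

text \<open>
  The Riemann (not Henstock-Kurzweil) filter: tagged divisions of the interval whose mesh tends
  to 0, i.e. which are fine for a gauge of constant radius.
\<close>

definition riemann_filter :: "real \<Rightarrow> real \<Rightarrow> (real \<times> real set) set filter"
  where "riemann_filter A B =
    (INF \<delta>\<in>{0<..}. principal {p. p tagged_division_of {A..B} \<and> (\<lambda>x. ball x \<delta>) fine p})"

definition has_ms_integral ::
  "'w measure \<Rightarrow> (real \<Rightarrow> 'w \<Rightarrow> 'b::{second_countable_topology, banach}) \<Rightarrow> real \<Rightarrow> real \<Rightarrow> ('w \<Rightarrow> 'b) \<Rightarrow> bool"
  where "has_ms_integral M Z A B I \<longleftrightarrow>
    ms_tendsto M (\<lambda>p \<omega>. \<Sum>(t, K)\<in>p. measure lborel K *\<^sub>R Z t \<omega>) I (riemann_filter A B)"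

definition has_ms_integral_line ::
  "'w measure \<Rightarrow> (real \<Rightarrow> 'w \<Rightarrow> 'b::{second_countable_topology, banach}) \<Rightarrow> ('w \<Rightarrow> 'b) \<Rightarrow> bool"
  where "has_ms_integral_line M Z J \<longleftrightarrow>
    (\<exists>I. (\<forall>A B. A \<le> B \<longrightarrow> has_ms_integral M Z A B (I A B)) \<and>
         ms_tendsto M (\<lambda>(A, B). I A B) J (at_bot \<times>\<^sub>F at_top))"

text \<open>
  Mean-square integrals are unique up to almost sure equality; the following select a version.
\<close>

definition ms_integral ::
  "'w measure \<Rightarrow> (real \<Rightarrow> 'w \<Rightarrow> 'b::{second_countable_topology, banach}) \<Rightarrow> real \<Rightarrow> real \<Rightarrow> 'w \<Rightarrow> 'b"
  where "ms_integral M Z A B = (SOME I. has_ms_integral M Z A B I)"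

definition ms_integral_line ::
  "'w measure \<Rightarrow> (real \<Rightarrow> 'w \<Rightarrow> 'b::{second_countable_topology, banach}) \<Rightarrow> 'w \<Rightarrow> 'b"
  where "ms_integral_line M Z = (SOME J. has_ms_integral_line M Z J)"


section \<open>The channel\<close>

text \<open>Normal random variables, the degenerate (almost surely constant) ones included.\<close>

definition gaussian_rv :: "'w measure \<Rightarrow> ('w \<Rightarrow> real) \<Rightarrow> bool"
  where "gaussian_rv M Z \<longleftrightarrow>
    (\<exists>m \<sigma>. \<sigma> > 0 \<and> distributed M lborel Z (normal_density m \<sigma>)) \<or>
    (Z \<in> borel_measurable M \<and> (\<exists>m. AE \<omega> in M. Z \<omega> = m))"

text \<open>
  All finite-dimensional distributions are multivariate normal (possibly degenerate), i.e. all
  finite linear combinations are normal.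
\<close>

definition gaussian_process :: "'w measure \<Rightarrow> (real \<Rightarrow> 'w \<Rightarrow> real) \<Rightarrow> bool"
  where "gaussian_process M Z \<longleftrightarrow>
    (\<forall>T w. finite T \<longrightarrow> gaussian_rv M (\<lambda>\<omega>. \<Sum>t\<in>T. w t * Z t \<omega>))"

definition attenuated_OU_cov :: "real \<Rightarrow> real \<Rightarrow> real \<Rightarrow> real \<Rightarrow> real \<Rightarrow> real"
  where "attenuated_OU_cov a b c s t =
    c * exp (- a * \<bar>s - t\<bar>) * b * exp (- b * (s + t)) * indicator {0..} s * indicator {0..} t"

text \<open>For centred processes the covariance of the values at two times is the mean of the product.\<close>

definition attenuated_OU_process ::
  "'w measure \<Rightarrow> real \<Rightarrow> real \<Rightarrow> real \<Rightarrow> (real \<Rightarrow> 'w \<Rightarrow> real) \<Rightarrow> bool"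
  where "attenuated_OU_process M a b c Z \<longleftrightarrow>
    gaussian_process M Z \<and>
    (\<forall>t. (\<integral>\<omega>. Z t \<omega> \<partial>M) = 0) \<and>
    (\<forall>s t. (\<integral>\<omega>. Z s \<omega> * Z t \<omega> \<partial>M) = attenuated_OU_cov a b c s t)"

text \<open>
  Independence of two processes is independence of the corresponding random elements of the space
  of all paths with its product sigma-algebra.
\<close>

definition attenuated_OU_channel ::
  "'w measure \<Rightarrow> real \<Rightarrow> real \<Rightarrow> real \<Rightarrow> (real \<Rightarrow> 'w \<Rightarrow> complex) \<Rightarrow> bool"
  where "attenuated_OU_channel M a b c H \<longleftrightarrow>
    (\<exists>X Y. attenuated_OU_process M a b c X \<and> attenuated_OU_process M a b c Y \<and>
       prob_space.indep_var M
         (PiM UNIV (\<lambda>_. borel)) (\<lambda>\<omega> t. X t \<omega>) (PiM UNIV (\<lambda>_. borel)) (\<lambda>\<omega> t. Y t \<omega>) \<and>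
       (\<forall>t \<omega>. H t \<omega> = complex_of_real (X t \<omega>) + \<i> * complex_of_real (Y t \<omega>)))"


section \<open>Transfer function and ergodic capacity\<close>

definition fourier_integrand :: "(real \<Rightarrow> 'w \<Rightarrow> complex) \<Rightarrow> real \<Rightarrow> real \<Rightarrow> 'w \<Rightarrow> complex"
  where "fourier_integrand H f t \<omega> = exp (- \<i> * complex_of_real (2 * pi * f * t)) * H t \<omega>"

definition transfer_function ::
  "'w measure \<Rightarrow> (real \<Rightarrow> 'w \<Rightarrow> complex) \<Rightarrow> real \<Rightarrow> 'w \<Rightarrow> complex"
  where "transfer_function M H f = ms_integral_line M (fourier_integrand H f)"

definition capacity_integrand ::
  "'w measure \<Rightarrow> real \<Rightarrow> (real \<Rightarrow> 'w \<Rightarrow> complex) \<Rightarrow> real \<Rightarrow> 'w \<Rightarrow> real"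
  where "capacity_integrand M \<alpha> H f \<omega> = log 2 (1 + \<alpha> * (cmod (transfer_function M H f \<omega>))\<^sup>2)"

definition ergodic_capacity ::
  "'w measure \<Rightarrow> real \<Rightarrow> real \<Rightarrow> (real \<Rightarrow> 'w \<Rightarrow> complex) \<Rightarrow> real"
  where "ergodic_capacity M \<alpha> W H =
    (\<integral>\<omega>. ms_integral M (capacity_integrand M \<alpha> H) (- W / 2) (W / 2) \<omega> \<partial>M)"


section \<open>Generalized Laguerre polynomials\<close>

definition laguerre :: "nat \<Rightarrow> real \<Rightarrow> real \<Rightarrow> real"
  where "laguerre k \<mu> x =
    (\<Sum>i\<le>k. (-1) ^ i * ((real k + \<mu>) gchoose (k - i)) * x ^ i / fact i)"

end

theory Submission
  imports Defs
begin

text \<open>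
  The transfer function at the frequency \<open>f\<close> is a mean-square limit of linear combinations of the two
  Gaussian processes, hence a circularly symmetric complex Gaussian variable \<open>S\<close> with
  \<open>E |S|\<^sup>2 = 2 c (a + b) / ((a + b)\<^sup>2 + 4 \<pi>\<^sup>2 f\<^sup>2)\<close>. With \<open>x = 1 / (\<alpha> E |S|\<^sup>2) = \<beta>\<^sub>1 (\<beta>\<^sub>2 + f\<^sup>2)\<close>, the Laplace
  transform of \<open>|S|\<^sup>2\<close> and a Frullani integral give
  \<open>E ln (1 + \<alpha> |S|\<^sup>2) = \<integral>\<^sub>0\<^sup>\<infinity> e\<^sup>-\<^sup>s / (x + s) ds\<close>, which is \<open>\<Sum>\<^sub>n L\<^sub>n(x) / (n + 1)\<close> by the generating function
  of the Laguerre polynomials. Integrating over \<open>f\<close> termwise, the addition theorem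
  \<open>L\<^sub>n(x + y) = \<Sum>\<^sub>k L\<^sub>k\<^sup>-\<^sup>1\<^sup>/\<^sup>2(x) L\<^sub>n\<^sub>-\<^sub>k\<^sup>-\<^sup>1\<^sup>/\<^sup>2(y)\<close> separates the variables. The series converges
  only slowly; its partial sums are bounded uniformly in \<open>x\<close> on compact sets because the differences
  \<open>L\<^sub>n - L\<^sub>n\<^sub>-\<^sub>1\<close> are square summable, by an energy estimate for the recurrence in \<open>n\<close>.
\<close>

section \<open>Laguerre polynomials\<close>

text \<open>Instead, expectations are computed along Riemann sums, carried over by L2 convergence
  and identified with the gauge integral of a deterministic function. The integrals exist by
  mean-square continuity away from a single jump; in the frequency this is a Lipschitz estimate.
  Circular symmetry is expressed by the characteristic function because that form survives
  mean-square limits. The energy estimate by itself only bounds \<open>L_n(x)\<close> for fixed x >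
  0, which leaves terms of size 1/n. Summation by parts through the recurrence replaces
  \<open>L_n\<close> by the differences, which can be paired with 1/(n+1) because both are square
  summable. Abel's limit theorem bridges the gap between the generating function, valid for t < 1,
  and the series at t = 1.\<close>

lemma laguerre_zero_param:
  "laguerre n 0 x = (\<Sum>i\<le>n. real (n choose i) * (- x) ^ i / fact i)"
  unfolding laguerre_def
proof (rule sum.cong[OF refl])
  fix i assume "i \<in> {..n}"
  then have "n choose (n - i) = n choose i" by (simp add: binomial_symmetric[symmetric])
  then have "(real n + 0) gchoose (n - i) = real (n choose i)"
    by (simp add: binomial_gbinomial[symmetric])
  moreover have "(- x) ^ i = (- 1) ^ i * x ^ i" by (rule power_minus)
  ultimately show "(- 1) ^ i * (real n + 0 gchoose (n - i)) * x ^ i / fact i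
      = real (n choose i) * (- x) ^ i / fact i"
    by (simp add: mult_ac)
qed

lemma laguerre_0 [simp]: "laguerre 0 \<mu> x = 1"
  by (simp add: laguerre_def)

text \<open>For n > 0 this is the Laguerre polynomial with parameter -1, that is -(x/n) times the
  one of degree n-1 with parameter 1. At \<open>n = 0\<close> truncated subtraction makes it 0, the
  value from which the later telescoping sums start.\<close>

definition laguerre_diff :: "nat \<Rightarrow> real \<Rightarrow> real"
  where "laguerre_diff n x = laguerre n 0 x - laguerre (n - 1) 0 x"

lemma laguerre_diff_0 [simp]: "laguerre_diff 0 x = 0"
  by (simp add: laguerre_diff_def)

lemma laguerre_zero_param_extend:
  assumes "n \<le> m"
  shows "laguerre n 0 x = (\<Sum>i\<le>m. real (n choose i) * (- x) ^ i / fact i)"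
  unfolding laguerre_zero_param
  by (rule sum.mono_neutral_left) (use assms in \<open>auto simp: binomial_eq_0\<close>)

text \<open>By Pascal's rule and absorption, n (C(n,i) - C(n-1,i)) = n C(n-1,i-1) = i C(n,i). The
  range up to a free \<open>m\<close> lets two consecutive degrees be subtracted term by
  term.\<close>

lemma times_laguerre_diff:
  assumes "n \<le> m"
  shows "real n * laguerre_diff n x = (\<Sum>i\<le>m. real i * real (n choose i) * (- x) ^ i / fact i)"
proof (cases n)
  case 0
  have "real i * real (0 choose i) = 0" for i by (cases i) auto
  then show ?thesis using 0 by (simp add: sum.neutral)
next
  case (Suc k)
  have *: "real (Suc k) * (real (Suc k choose i) - real (k choose i)) = real i * real (Suc k choose i)" for i
  proof (cases i)
    case (Suc j)
    have "Suc k * (k choose j) = Suc j * (Suc k choose Suc j)"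
      by (metis Suc_times_binomial_eq mult.commute)
    then have "real (Suc k) * real (k choose j) = real (Suc j) * real (Suc k choose Suc j)"
      by (metis of_nat_mult)
    then show ?thesis using Suc by simp
  qed simp
  have "laguerre_diff n x = (\<Sum>i\<le>m. (real (Suc k choose i) - real (k choose i)) * ((- x) ^ i / fact i))"
    unfolding laguerre_diff_def Suc
    using laguerre_zero_param_extend[of "Suc k" m x] laguerre_zero_param_extend[of k m x] assms Suc
    by (simp add: sum_subtractf algebra_simps)
  then have "real n * laguerre_diff n x =
      (\<Sum>i\<le>m. (real (Suc k) * (real (Suc k choose i) - real (k choose i))) * ((- x) ^ i / fact i))"
    by (simp add: sum_distrib_left Suc mult.assoc)
  then show ?thesis unfolding * using Suc by simp
qed

text \<open>This is the three-term recurrence (n+1) L_{n+1} = (2n+1-x) L_n - n L_{n-1} written for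
  differences. In the coefficients, i (C(n+1,i) - C(n,i)) = i C(n,i-1), and the factor i cancels
  against i!, which shifts the series by one power of -x.\<close>

lemma laguerre_diff_rec:
  "real (Suc n) * laguerre_diff (Suc n) x = real n * laguerre_diff n x - x * laguerre n 0 x"
proof -
  have 1: "real i * real (Suc n choose i) * (- x) ^ i / fact i
      - real i * real (n choose i) * (- x) ^ i / fact i
      = (case i of 0 \<Rightarrow> 0 | Suc j \<Rightarrow> - x * (real (n choose j) * (- x) ^ j / fact j))" for i
  proof (cases i)
    case (Suc j)
    have A: "real (Suc j) * C * X / fact (Suc j) = C * X / fact j" for C X :: real
      by (simp del: of_nat_Suc)
    show ?thesis
      unfolding Suc A binomial_Suc_Suc of_nat_add by (simp add: field_simps)
  qed simp
  have "real (Suc n) * laguerre_diff (Suc n) x - real n * laguerre_diff n x =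
     (\<Sum>i\<le>Suc n. (case i of 0 \<Rightarrow> 0 | Suc j \<Rightarrow> - x * (real (n choose j) * (- x) ^ j / fact j)))"
    unfolding times_laguerre_diff[OF le_refl, of "Suc n"]
      times_laguerre_diff[of n "Suc n", OF le_SucI[OF le_refl]] sum_subtractf[symmetric] 1 ..
  also have "\<dots> = - x * laguerre n 0 x"
    unfolding sum.atMost_Suc_shift laguerre_zero_param by (simp add: sum_distrib_left)
  finally show ?thesis by simp
qed

lemma continuous_on_laguerre [continuous_intros]:
  assumes "continuous_on S f"
  shows "continuous_on S (\<lambda>x. laguerre n \<mu> (f x))"
  unfolding laguerre_def by (intro continuous_intros assms) auto

lemma continuous_on_laguerre_diff [continuous_intros]:
  assumes "continuous_on S f"
  shows "continuous_on S (\<lambda>x. laguerre_diff n (f x))"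
  unfolding laguerre_diff_def by (intro continuous_intros assms)

section \<open>Energy estimate and square summability of the differences\<close>

text \<open>
  The recurrences for the differences and for the values themselves are a symplectic Euler scheme for \<open>L' = p/n\<close>,
  \<open>p' = - x L\<close>, where \<open>p\<^sub>n = n (L\<^sub>n - L\<^sub>n\<^sub>-\<^sub>1)\<close>; the energy \<open>x L\<^sup>2 + p\<^sup>2/n\<close> of the
  differential equation decreases at the rate \<open>p\<^sup>2/n\<^sup>2\<close>. The following quantity is the
  corresponding energy of the scheme.
\<close>

definition laguerre_energy :: "nat \<Rightarrow> real \<Rightarrow> real"
  where "laguerre_energy n x = x * (laguerre n 0 x)\<^sup>2
     + real n * laguerre_diff n x * (real (Suc n) * laguerre_diff (Suc n) x) / real n"

lemma continuous_on_laguerre_energy [continuous_intros]: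
  assumes "n > 0"
  shows "continuous_on S (\<lambda>x. laguerre_energy n x)"
  unfolding laguerre_energy_def using assms by (intro continuous_intros) auto

text \<open>Expressed by the data of step \<open>n\<close>, the energy of step \<open>n + 1\<close>
  differs from that of step \<open>n\<close> only in the denominator of the product term. This exact
  identity is the reason for the mixed product of two consecutive momenta in place of a
  square.\<close>

lemma laguerre_energy_Suc:
  assumes "n > 0"
  shows "laguerre_energy (Suc n) x = x * (laguerre n 0 x)\<^sup>2
     + real n * laguerre_diff n x * (real (Suc n) * laguerre_diff (Suc n) x) / real (Suc n)"
proof -
  define q where "q = laguerre_diff (Suc n) x"
  define L where "L = laguerre n 0 x"
  define N where "N = real (Suc n)"
  have N: "N > 0" by (simp add: N_def)
  have L': "laguerre (Suc n) 0 x = L + q" by (simp add: q_def L_def laguerre_diff_def)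
  have r1: "real (Suc (Suc n)) * laguerre_diff (Suc (Suc n)) x = N * q - x * (L + q)"
    unfolding laguerre_diff_rec[of "Suc n"] L' by (simp add: N_def q_def)
  have r2: "real n * laguerre_diff n x = N * q + x * L"
    using laguerre_diff_rec[of n x] by (simp add: N_def q_def L_def)
  show ?thesis
    unfolding laguerre_energy_def r1 r2 L' q_def[symmetric] L_def[symmetric] N_def[symmetric]
    using N by (simp add: field_simps power2_eq_square)
qed

text \<open>With \<open>s\<close> the sum of the two momenta their product is (s^2 - x^2 L^2)/4. The
  s^2 part makes the energy decrease; the other part has the wrong sign, but relative to the energy
  it is at most x/(2n(n+1)) = x/(2n) - x/(2(n+1)), so the exponential weight absorbs it. The
  condition n >= x/2 keeps the energy above (x/2) L^2.\<close>

lemma laguerre_energy_decay: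
  fixes x :: real
  assumes x: "x > 0" and n: "real n \<ge> x / 2" "n > 0"
  defines "s \<equiv> real n * laguerre_diff n x + real (Suc n) * laguerre_diff (Suc n) x"
  shows "x / 2 * (laguerre n 0 x)\<^sup>2 \<le> laguerre_energy n x"
    and "laguerre_energy (Suc n) x * exp (x / (2 * real (Suc n))) + s\<^sup>2 / (4 * real n * real (Suc n))
       \<le> laguerre_energy n x * exp (x / (2 * real n))"
proof -
  define P where "P = real n * laguerre_diff n x"
  define P' where "P' = real (Suc n) * laguerre_diff (Suc n) x"
  define L where "L = laguerre n 0 x"
  define Q where "Q = laguerre_energy n x"
  define Q' where "Q' = laguerre_energy (Suc n) x"
  define N where "N = real n"
  have N: "N > 0" "N \<ge> x / 2" and N': "real (Suc n) = N + 1" using n by (auto simp: N_def)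
  have P': "P' = P - x * L" unfolding P_def P'_def L_def by (rule laguerre_diff_rec)
  have s: "s = P + P'" by (simp add: s_def P_def P'_def)
  have PP: "P * P' = (s\<^sup>2 - x\<^sup>2 * L\<^sup>2) / 4" unfolding s P' by (simp add: field_simps power2_eq_square)
  have Q: "Q = x * L\<^sup>2 + P * P' / N"
    unfolding Q_def laguerre_energy_def L_def P_def P'_def N_def by simp
  have Q': "Q' = x * L\<^sup>2 + P * P' / (N + 1)"
    unfolding Q'_def laguerre_energy_Suc[OF n(2)] L_def P_def P'_def N_def by (simp add: add.commute)
  have "Q - x / 2 * L\<^sup>2 = x * L\<^sup>2 * (2 * N - x) / (4 * N) + s\<^sup>2 / (4 * N)"
    unfolding Q PP using N by (simp add: field_simps power2_eq_square)
  also have "\<dots> \<ge> 0" using N x by auto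
  finally have Qge: "x / 2 * L\<^sup>2 \<le> Q" by simp
  then show "x / 2 * (laguerre n 0 x)\<^sup>2 \<le> laguerre_energy n x" unfolding L_def Q_def .
  have Q0: "Q \<ge> 0" using order_trans[OF _ Qge, of 0] x by simp
  define D where "D = s\<^sup>2 / (4 * N * (N + 1))"
  have D0: "D \<ge> 0" unfolding D_def using N by simp
  have "Q' + D = Q + x\<^sup>2 * L\<^sup>2 / (4 * N * (N + 1))"
  proof -
    have "(u - v) / 4 / (N + 1) + u / (4 * N * (N + 1)) = (u - v) / 4 / N + v / (4 * N * (N + 1))" for u v :: real
      using N by (simp add: divide_simps) (simp add: algebra_simps)
    then show ?thesis unfolding Q Q' PP D_def by simp
  qed
  also have "x\<^sup>2 * L\<^sup>2 / (4 * N * (N + 1)) = (x / 2 * L\<^sup>2) * (x / (2 * N * (N + 1)))"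
    using N by (simp add: field_simps power2_eq_square)
  also have "\<dots> \<le> Q * (x / (2 * N * (N + 1)))"
    using N x by (intro mult_right_mono Qge) auto
  finally have 1: "Q' + D \<le> Q * (1 + x / (2 * N * (N + 1)))" by (simp add: algebra_simps)
  define E where "E = exp (x / (2 * (N + 1)))"
  have E1: "E \<ge> 1" unfolding E_def using x N by simp
  have "Q' * E + D \<le> Q' * E + D * E" using D0 E1 by (simp add: mult_left_le mult_le_cancel_left1)
  also have "\<dots> = (Q' + D) * E" by (simp add: algebra_simps)
  also have "\<dots> \<le> Q * (1 + x / (2 * N * (N + 1))) * E"
    using 1 E1 by (intro mult_right_mono) auto
  also have "\<dots> \<le> Q * exp (x / (2 * N * (N + 1))) * E"
    using E1 Q0 by (intro mult_right_mono mult_left_mono exp_ge_add_one_self) auto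
  also have "\<dots> = Q * exp (x / (2 * N * (N + 1)) + x / (2 * (N + 1)))"
    by (simp add: E_def exp_add mult.assoc)
  also have "x / (2 * N * (N + 1)) + x / (2 * (N + 1)) = x / (2 * N)"
    using N by (simp add: divide_simps, (simp add: algebra_simps)?)
  finally show "laguerre_energy (Suc n) x * exp (x / (2 * real (Suc n))) + s\<^sup>2 / (4 * real n * real (Suc n))
       \<le> laguerre_energy n x * exp (x / (2 * real n))"
    unfolding Q_def Q'_def N' E_def D_def N_def[symmetric] .
qed

text \<open>The decay telescopes to a bound \<open>T\<close> for the sum of the losses
  s^2/(4n(n+1)). Since the momentum is (s + x L)/2 and x L^2 is controlled by the energy, each
  squared difference is at most 4 losses plus x T times a telescoping term; this is the origin of
  the factor 4 + 2x.\<close>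

lemma sum_laguerre_diff_sq_tail:
  fixes x :: real
  assumes x: "x > 0" and n: "real m \<ge> x / 2" "m > 0"
  defines "T \<equiv> laguerre_energy m x * exp (x / (2 * real m))"
  shows "(\<Sum>k<K. (laguerre_diff (m + k) x)\<^sup>2) \<le> (4 + 2 * x) * T"
proof -
  define s where "s n = real n * laguerre_diff n x + real (Suc n) * laguerre_diff (Suc n) x" for n
  define D where "D n = (s n)\<^sup>2 / (4 * real n * real (Suc n))" for n
  define t where "t n = laguerre_energy n x * exp (x / (2 * real n))" for n
  have step: "t (Suc (m + k)) + D (m + k) \<le> t (m + k)"
    and low: "x / 2 * (laguerre (m + k) 0 x)\<^sup>2 \<le> t (m + k)" and t0: "t (m + k) \<ge> 0" for k
  proof -
    have mk: "real (m + k) \<ge> x / 2" "m + k > 0" using n by auto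
    show "t (Suc (m + k)) + D (m + k) \<le> t (m + k)"
      using laguerre_energy_decay(2)[OF x mk] unfolding t_def D_def s_def .
    have 1: "x / 2 * (laguerre (m + k) 0 x)\<^sup>2 \<le> laguerre_energy (m + k) x"
      using laguerre_energy_decay(1)[OF x mk] .
    have 2: "laguerre_energy (m + k) x \<ge> 0" using order_trans[OF _ 1, of 0] x by simp
    have "exp (x / (2 * real (m + k))) \<ge> 1" using x by simp
    then have "laguerre_energy (m + k) x \<le> t (m + k)"
      unfolding t_def using 2 by (simp add: mult_le_cancel_left1)
    then show "x / 2 * (laguerre (m + k) 0 x)\<^sup>2 \<le> t (m + k)" "t (m + k) \<ge> 0" using 1 2 by auto
  qed
  have tel: "t (m + k) + (\<Sum>j<k. D (m + j)) \<le> T" for k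
  proof (induction k)
    case 0 then show ?case by (simp add: t_def T_def)
  next
    case (Suc k) then show ?case using step[of k] by simp
  qed
  have D0: "D n \<ge> 0" for n unfolding D_def by simp
  have tT: "t (m + k) \<le> T" for k using tel[of k] sum_nonneg[of "{..<k}" "\<lambda>j. D (m + j)"] D0 by auto
  have T0: "T \<ge> 0" using tT[of 0] t0[of 0] by simp
  have sq: "(laguerre_diff (m + k) x)\<^sup>2 \<le> 4 * D (m + k) + x * T * (2 * (1 / real (m + k) - 1 / real (m + Suc k)))" for k
  proof -
    define N where "N = real (m + k)"
    have N: "N \<ge> 1" and N': "real (Suc (m + k)) = N + 1" using n by (auto simp: N_def)
    define P where "P = N * laguerre_diff (m + k) x"
    define L where "L = laguerre (m + k) 0 x"
    have "s (m + k) = 2 * P - x * L"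
      unfolding s_def laguerre_diff_rec P_def N_def L_def by simp
    then have P: "P = (s (m + k) + x * L) / 2" by simp
    have "P\<^sup>2 \<le> ((s (m + k))\<^sup>2 + (x * L)\<^sup>2) / 2"
      unfolding P using sum_squares_bound[of "s (m + k)" "x * L"]
      by (simp add: power2_eq_square field_simps)
    also have "(x * L)\<^sup>2 = 2 * x * (x / 2 * L\<^sup>2)" by (simp add: power2_eq_square)
    also have "\<dots> \<le> 2 * x * T"
      using x low[of k] tT[of k] unfolding L_def by (intro mult_left_mono) auto
    finally have "P\<^sup>2 \<le> (s (m + k))\<^sup>2 / 2 + x * T" by (simp add: add_divide_distrib)
    then have "P\<^sup>2 / N\<^sup>2 \<le> ((s (m + k))\<^sup>2 / 2 + x * T) / N\<^sup>2" by (intro divide_right_mono) auto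
    \<comment> \<open>For N >= 1 one has 1/N^2 <= 2/(N(N+1)), and the right-hand side
      telescopes.\<close>
    also have "\<dots> \<le> ((s (m + k))\<^sup>2 / 2 + x * T) * (2 / (N * (N + 1)))"
    proof -
      have "2 / (N * (N + 1)) - 1 / N\<^sup>2 = (N - 1) / (N\<^sup>2 * (N + 1))"
        using N by (simp add: divide_simps power2_eq_square)
      also have "\<dots> \<ge> 0" using N by simp
      finally have "1 / N\<^sup>2 \<le> 2 / (N * (N + 1))" by simp
      then have "((s (m + k))\<^sup>2 / 2 + x * T) * (1 / N\<^sup>2) \<le> ((s (m + k))\<^sup>2 / 2 + x * T) * (2 / (N * (N + 1)))"
        using T0 x by (intro mult_left_mono) auto
      then show ?thesis by simp
    qed
    also have "\<dots> = 4 * D (m + k) + x * T * (2 * (1 / N - 1 / (N + 1)))"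
      unfolding D_def N' N_def[symmetric] using N by (simp add: divide_simps, (simp add: algebra_simps)?)
    finally show ?thesis
      unfolding P_def using N by (simp add: power_mult_distrib N_def add.commute)
  qed
  have "(\<Sum>k<K. (laguerre_diff (m + k) x)\<^sup>2) \<le>
     (\<Sum>k<K. 4 * D (m + k) + x * T * (2 * (1 / real (m + k) - 1 / real (m + Suc k))))"
    by (intro sum_mono sq)
  also have "\<dots> = 4 * (\<Sum>k<K. D (m + k)) + x * T * (2 * (\<Sum>k<K. (1 / real (m + k) - 1 / real (m + Suc k))))"
    by (simp add: sum.distrib sum_distrib_left)
  also have "(\<Sum>k<K. (1 / real (m + k) - 1 / real (m + Suc k))) = 1 / real m - 1 / real (m + K)"
    by (subst sum_lessThan_telescope') simp
  also have "4 * (\<Sum>k<K. D (m + k)) + x * T * (2 * (1 / real m - 1 / real (m + K))) \<le> 4 * T + x * T * (2 * 1)"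
  proof (intro add_mono mult_left_mono)
    show "(\<Sum>k<K. D (m + k)) \<le> T" using tel[of K] t0[of K] by simp
    have "1 / real m \<le> 1" "1 / real (m + K) \<ge> 0" using n by auto
    then show "1 / real m - 1 / real (m + K) \<le> 1" by linarith
  qed (use x T0 in auto)
  finally show ?thesis by (simp add: algebra_simps)
qed

text \<open>One starting index \<open>m\<close> beyond \<open>x1\<close> satisfies the condition of
  the tail estimate for all x in the interval. For this fixed \<open>m\<close> the head of the sum
  and the bound for its tail are continuous in x, hence bounded on the compact interval.\<close>

lemma sum_laguerre_diff_sq_bounded:
  fixes x0 x1 :: real
  assumes x0: "x0 > 0"
  shows "\<exists>K. \<forall>x\<in>{x0..x1}. \<forall>N. (\<Sum>n<N. (laguerre_diff n x)\<^sup>2) \<le> K"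
proof -
  define m where "m = nat \<lceil>x1\<rceil> + 1"
  have m: "m > 0" and mx: "real m \<ge> x / 2" if "x \<in> {x0..x1}" for x
    using that x0 unfolding m_def by (auto, linarith)
  define B where "B x = (\<Sum>n<m. (laguerre_diff n x)\<^sup>2)
      + (4 + 2 * x) * (laguerre_energy m x * exp (x / (2 * real m)))" for x
  have "continuous_on {x0..x1} B"
    unfolding B_def by (intro continuous_intros) (auto simp: m_def)
  then have "bounded (B ` {x0..x1})"
    by (intro compact_imp_bounded compact_continuous_image) auto
  then obtain K where K: "\<forall>x\<in>{x0..x1}. \<bar>B x\<bar> \<le> K"
    unfolding bounded_iff by auto
  have "(\<Sum>n<N. (laguerre_diff n x)\<^sup>2) \<le> K" if x: "x \<in> {x0..x1}" for x N
  proof -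
    have xp: "x > 0" using x x0 by auto
    have "(\<Sum>n<N. (laguerre_diff n x)\<^sup>2) \<le> (\<Sum>n<m + N. (laguerre_diff n x)\<^sup>2)"
      by (intro sum_mono2) auto
    also have "\<dots> = (\<Sum>n<m. (laguerre_diff n x)\<^sup>2) + (\<Sum>n=m..<m + N. (laguerre_diff n x)\<^sup>2)"
      by (metis le_add1 lessThan_atLeast0 sum.atLeastLessThan_concat zero_le)
    also have "(\<Sum>n=m..<m + N. (laguerre_diff n x)\<^sup>2) = (\<Sum>k<N. (laguerre_diff (m + k) x)\<^sup>2)"
      using sum.shift_bounds_nat_ivl[of "\<lambda>n. (laguerre_diff n x)\<^sup>2" 0 m N]
      by (simp add: lessThan_atLeast0 add.commute)
    also have "(\<Sum>n<m. (laguerre_diff n x)\<^sup>2) + \<dots> \<le> B x"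
      unfolding B_def by (intro add_left_mono sum_laguerre_diff_sq_tail xp mx[OF x]) (simp add: m_def)
    finally show ?thesis using bspec[OF K x] by linarith
  qed
  then show ?thesis by blast
qed

text \<open>Summation by parts: writing d_n for the difference, the recurrence reads x L_n/(n+1) =
  d_n - d_{n+1} - d_n/(n+1), and the first two terms telescope.\<close>

lemma sum_laguerre_over_Suc:
  "x * (\<Sum>n<N. laguerre n 0 x / (real n + 1)) =
     - laguerre_diff N x - (\<Sum>n<N. laguerre_diff n x / (real n + 1))"
proof (induction N)
  case (Suc N)
  have "x * laguerre N 0 x = real N * laguerre_diff N x - (real N + 1) * laguerre_diff (Suc N) x"
    using laguerre_diff_rec[of N x] by (simp add: add.commute)
  then have "x * (laguerre N 0 x / (real N + 1)) = laguerre_diff N x - laguerre_diff N x / (real N + 1) - laguerre_diff (Suc N) x"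
    by (simp add: field_simps)
  then show ?case using Suc by (simp add: distrib_left)
qed simp

lemma sum_inverse_Suc_sq_le: "(\<Sum>n<N. 1 / (real n + 1)\<^sup>2) \<le> 2"
proof -
  have *: "(\<Sum>n<Suc N. 1 / (real n + 1)\<^sup>2) \<le> 2 - 1 / (real N + 1)" for N
  proof (induction N)
    case (Suc N)
    have "1 / (real N + 2)\<^sup>2 \<le> 1 / (real N + 1) - 1 / (real N + 2)"
      by (simp add: divide_simps power2_eq_square)
    then show ?case using Suc by (simp add: add.commute)
  qed simp
  have "(\<Sum>n<N. 1 / (real n + 1)\<^sup>2) \<le> (\<Sum>n<Suc N. 1 / (real n + 1)\<^sup>2)" by simp
  also have "\<dots> \<le> 2 - 1 / (real N + 1)" by (rule *)
  also have "\<dots> \<le> 2" by simp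
  finally show ?thesis .
qed

text \<open>A single difference is at most sqrt K, and the remaining sum is bounded through 2uv <=
  u^2 + v^2. Dividing by x confines the estimate to intervals away from 0. The bound serves as the
  dominating constant when the series is integrated over the frequency.\<close>

lemma sum_laguerre_over_Suc_bounded:
  fixes x0 x1 :: real
  assumes x0: "x0 > 0"
  shows "\<exists>B. \<forall>x\<in>{x0..x1}. \<forall>N. \<bar>\<Sum>n<N. laguerre n 0 x / (real n + 1)\<bar> \<le> B"
proof -
  obtain K where K: "\<And>x N. x \<in> {x0..x1} \<Longrightarrow> (\<Sum>n<N. (laguerre_diff n x)\<^sup>2) \<le> K"
    using sum_laguerre_diff_sq_bounded[OF x0, of x1] by blast
  have "\<bar>\<Sum>n<N. laguerre n 0 x / (real n + 1)\<bar> \<le> (sqrt K + (K + 2) / 2) / x0" if x: "x \<in> {x0..x1}" for x N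
  proof -
    have xp: "x > 0" using x x0 by auto
    have K0: "K \<ge> 0" using K[OF x, of 0] by simp
    have "(laguerre_diff N x)\<^sup>2 \<le> (\<Sum>n<Suc N. (laguerre_diff n x)\<^sup>2)" by (simp add: sum_nonneg)
    also have "\<dots> \<le> K" by (rule K[OF x])
    finally have 1: "\<bar>laguerre_diff N x\<bar> \<le> sqrt K" by (simp add: real_le_rsqrt)
    have "\<bar>\<Sum>n<N. laguerre_diff n x / (real n + 1)\<bar> \<le> (\<Sum>n<N. ((laguerre_diff n x)\<^sup>2 + 1 / (real n + 1)\<^sup>2) / 2)"
    proof (intro order_trans[OF sum_abs] sum_mono)
      fix n
      have "2 * \<bar>laguerre_diff n x\<bar> * (1 / (real n + 1)) \<le> \<bar>laguerre_diff n x\<bar>\<^sup>2 + (1 / (real n + 1))\<^sup>2"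
        by (rule sum_squares_bound)
      then show "\<bar>laguerre_diff n x / (real n + 1)\<bar> \<le> ((laguerre_diff n x)\<^sup>2 + 1 / (real n + 1)\<^sup>2) / 2"
        by (simp add: abs_divide power_divide mult.commute)
    qed
    also have "\<dots> = ((\<Sum>n<N. (laguerre_diff n x)\<^sup>2) + (\<Sum>n<N. 1 / (real n + 1)\<^sup>2)) / 2"
      by (simp add: sum.distrib sum_divide_distrib[symmetric])
    also have "\<dots> \<le> (K + 2) / 2"
      using K[OF x, of N] sum_inverse_Suc_sq_le[of N] by simp
    finally have 2: "\<bar>\<Sum>n<N. laguerre_diff n x / (real n + 1)\<bar> \<le> (K + 2) / 2" .
    have "\<bar>x * (\<Sum>n<N. laguerre n 0 x / (real n + 1))\<bar> \<le> sqrt K + (K + 2) / 2"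
      unfolding sum_laguerre_over_Suc using 1 2 by linarith
    then have "x * \<bar>\<Sum>n<N. laguerre n 0 x / (real n + 1)\<bar> \<le> sqrt K + (K + 2) / 2"
      using xp by (simp add: abs_mult)
    then have "\<bar>\<Sum>n<N. laguerre n 0 x / (real n + 1)\<bar> \<le> (sqrt K + (K + 2) / 2) / x"
      using xp by (simp add: field_simps)
    also have "\<dots> \<le> (sqrt K + (K + 2) / 2) / x0"
      using x x0 K0 by (intro divide_left_mono) auto
    finally show ?thesis .
  qed
  then show ?thesis by blast
qed

lemma summable_laguerre_over_Suc:
  assumes x: "x > 0"
  shows "summable (\<lambda>n. laguerre n 0 x / (real n + 1))"
proof -
  obtain K where K: "\<And>N. (\<Sum>n<N. (laguerre_diff n x)\<^sup>2) \<le> K"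
    using sum_laguerre_diff_sq_bounded[OF x, of x] by auto
  have s2: "summable (\<lambda>n. (laguerre_diff n x)\<^sup>2)"
    by (rule summableI_nonneg_bounded[OF _ K]) auto
  then have "(\<lambda>n. (laguerre_diff n x)\<^sup>2) \<longlonglongrightarrow> 0" by (rule summable_LIMSEQ_zero)
  then have d0: "(\<lambda>n. laguerre_diff n x) \<longlonglongrightarrow> 0" by simp
  have si: "summable (\<lambda>n. 1 / (real n + 1)\<^sup>2)"
    by (rule summableI_nonneg_bounded[OF _ sum_inverse_Suc_sq_le]) auto
  have "summable (\<lambda>n. laguerre_diff n x / (real n + 1))"
  proof (rule summable_comparison_test'[OF summable_divide[OF summable_add[OF s2 si], of 2]])
    fix n
    have "2 * \<bar>laguerre_diff n x\<bar> * (1 / (real n + 1)) \<le> \<bar>laguerre_diff n x\<bar>\<^sup>2 + (1 / (real n + 1))\<^sup>2"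
      by (rule sum_squares_bound)
    then show "norm (laguerre_diff n x / (real n + 1)) \<le> ((laguerre_diff n x)\<^sup>2 + 1 / (real n + 1)\<^sup>2) / 2"
      by (simp add: abs_divide power_divide mult.commute)
  qed
  then have "convergent (\<lambda>N. \<Sum>n<N. laguerre_diff n x / (real n + 1))"
    by (simp add: summable_iff_convergent)
  then obtain l where "(\<lambda>N. \<Sum>n<N. laguerre_diff n x / (real n + 1)) \<longlonglongrightarrow> l"
    by (auto simp: convergent_def)
  with d0 have "(\<lambda>N. (- laguerre_diff N x - (\<Sum>n<N. laguerre_diff n x / (real n + 1))) / x) \<longlonglongrightarrow> (- 0 - l) / x"
    using x by (intro tendsto_intros) auto
  then have "(\<lambda>N. \<Sum>n<N. laguerre n 0 x / (real n + 1)) \<longlonglongrightarrow> (- 0 - l) / x"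
    unfolding sum_laguerre_over_Suc[symmetric] using x by simp
  then show ?thesis unfolding summable_def sums_def by blast
qed

section \<open>Abel summation and the generating function\<close>

lemma Abel_sums_at_left:
  fixes a :: "nat \<Rightarrow> real"
  assumes "a sums s"
  shows "((\<lambda>t. \<Sum>n. a n * t ^ n) \<longlongrightarrow> s) (at_left 1)"
proof -
  define A where "A N = (\<Sum>n<Suc N. a n)" for N
  have A: "A \<longlonglongrightarrow> s" using assms unfolding A_def sums_def by (rule LIMSEQ_Suc)
  have sm: "summable (\<lambda>n. a n * 1 ^ n)" using assms by (simp add: sums_iff)
  have "bounded (range (\<lambda>n. A n - s))"
    using A by (intro convergent_imp_bounded[of _ 0]) (simp add: LIM_zero)
  then obtain C where C: "\<And>n. \<bar>A n - s\<bar> \<le> C" unfolding bounded_iff by auto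
  \<comment> \<open>Summation by parts turns the power series into an average of the partial sums
    with weights (1-t) t^n of total mass 1. As t tends to 1 the mass of any finite set of indices
    vanishes, so only partial sums close to \<open>s\<close> count.\<close>
  have eq: "(\<lambda>n. (A n - s) * t ^ n * (1 - t)) sums ((\<Sum>n. a n * t ^ n) - s)" if t: "0 < t" "t < 1" for t
  proof -
    have sA: "summable (\<lambda>n. (A n - s) * t ^ n)"
    proof (rule summable_comparison_test'[of "\<lambda>n. C * t ^ n" 0])
      show "summable (\<lambda>n. C * t ^ n)" using t by (intro summable_mult summable_geometric) auto
      show "norm ((A n - s) * t ^ n) \<le> C * t ^ n" for n
        using t C[of n] by (simp add: abs_mult mult_right_mono)
    qed
    define F where "F = (\<Sum>n. (A n - s) * t ^ n)"
    have F: "(\<lambda>n. (A n - s) * t ^ n) sums F" using sA unfolding F_def by (rule summable_sums)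
    have F0: "(\<lambda>n. (A (Suc n) - s) * t ^ Suc n) sums (F - (A 0 - s))"
      using F sums_Suc_iff[of "\<lambda>n. (A n - s) * t ^ n" "F - (A 0 - s)"] by simp
    have "(\<lambda>n. (A (Suc n) - s) * t ^ Suc n - t * ((A n - s) * t ^ n)) sums (F - (A 0 - s) - t * F)"
      by (intro sums_diff F0 sums_mult F)
    also have "(\<lambda>n. (A (Suc n) - s) * t ^ Suc n - t * ((A n - s) * t ^ n)) = (\<lambda>n. a (Suc n) * t ^ Suc n)"
      by (simp add: A_def algebra_simps fun_eq_iff)
    finally have "(\<lambda>n. a n * t ^ n) sums (F - (A 0 - s) - t * F + a 0 * t ^ 0)"
      by (subst (asm) sums_Suc_iff)
    then have "(\<Sum>n. a n * t ^ n) = (1 - t) * F + s"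
      by (simp add: A_def sums_iff algebra_simps)
    then show ?thesis using sums_mult2[OF F, of "1 - t"] by (simp add: mult.commute)
  qed
  show ?thesis
  proof (rule tendstoI)
    fix e :: real assume e: "e > 0"
    obtain N where N: "\<And>n. n \<ge> N \<Longrightarrow> \<bar>A n - s\<bar> < e / 2"
      using LIMSEQ_D[OF A, of "e / 2"] e by auto
    define B where "B = (\<Sum>n<N. \<bar>A n - s\<bar>)"
    have "((\<lambda>t. (1 - t) * B) \<longlongrightarrow> (1 - 1) * B) (at_left 1)" by (intro tendsto_intros)
    then have "\<forall>\<^sub>F t in at_left 1. (1 - t) * B < e / 2"
      using e by (intro order_tendstoD(2)) auto
    moreover have "\<forall>\<^sub>F t in at_left (1::real). t > 0 \<and> t < 1"
      by (intro eventually_at_leftI[of 0]) auto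
    ultimately show "\<forall>\<^sub>F t in at_left 1. dist (\<Sum>n. a n * t ^ n) s < e"
    proof eventually_elim
      case (elim t)
      have g: "(\<lambda>n. e / 2 * t ^ n * (1 - t)) sums (e / 2)"
      proof -
        have "(\<lambda>n. t ^ n) sums (1 / (1 - t))" using elim by (intro geometric_sums) auto
        from sums_mult[OF this, of "e / 2 * (1 - t)"] show ?thesis using elim by (simp add: mult_ac)
      qed
      have b: "(\<lambda>n. (if n < N then \<bar>A n - s\<bar> * (1 - t) else 0)) sums (B * (1 - t))"
        using sums_If_finite_set[of "{..<N}" "\<lambda>n. \<bar>A n - s\<bar> * (1 - t)"]
        by (simp add: B_def sum_distrib_right)
      have le: "norm ((A n - s) * t ^ n * (1 - t)) \<le>
          (if n < N then \<bar>A n - s\<bar> * (1 - t) else 0) + e / 2 * t ^ n * (1 - t)" for n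
      proof (cases "n < N")
        case True
        have "\<bar>A n - s\<bar> * t ^ n * (1 - t) \<le> \<bar>A n - s\<bar> * 1 * (1 - t)"
          using elim by (intro mult_right_mono mult_left_mono power_le_one) auto
        moreover have "0 \<le> e / 2 * t ^ n * (1 - t)" using elim e by simp
        ultimately show ?thesis using True elim by (simp add: abs_mult)
      next
        case False
        then have "\<bar>A n - s\<bar> * t ^ n * (1 - t) \<le> e / 2 * t ^ n * (1 - t)"
          using elim N[of n] by (intro mult_right_mono) auto
        then show ?thesis using False elim by (simp add: abs_mult)
      qed
      have "norm (\<Sum>n. (A n - s) * t ^ n * (1 - t)) \<le>
         (\<Sum>n. (if n < N then \<bar>A n - s\<bar> * (1 - t) else 0) + e / 2 * t ^ n * (1 - t))"
        by (rule norm_suminf_le[OF le]) (use sums_add[OF b g] in \<open>simp add: sums_iff\<close>)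
      also have "\<dots> = B * (1 - t) + e / 2" using sums_add[OF b g] by (simp add: sums_iff)
      also have "\<dots> < e" using elim by (simp add: mult.commute)
      finally show ?case using eq[of t] elim by (simp add: sums_iff dist_real_def)
    qed
  qed
qed

text \<open>The recurrence becomes the differential equation (1-z)^2 u' = (1-z-x) u for the power
  series u. The product of u with the reciprocal of the claimed closed form therefore has derivative
  0, and it equals 1 at the origin.\<close>

lemma laguerre_generating_function:
  assumes x: "x > 0" and t: "0 \<le> t" "t < 1"
  shows "(\<lambda>n. laguerre n 0 x * t ^ n) sums (exp (- x * t / (1 - t)) / (1 - t))"
proof -
  define L where "L n = laguerre n 0 x" for n
  have sma: "summable (\<lambda>n. L n / (real n + 1) * z ^ n)" if "norm z < 1" for z
    by (rule powser_inside[of _ 1]) (use that summable_laguerre_over_Suc[OF x] in \<open>simp_all add: L_def\<close>)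
  have smL: "summable (\<lambda>n. L n * z ^ n)" if z: "norm z < 1" for z
  proof -
    \<comment> \<open>The coefficients of an antiderivative. That series converges in the open unit
      disc because L_n/(n+1) is summable, and termwise differentiation keeps the disc of
      convergence.\<close>
    define b where "b n = (case n of 0 \<Rightarrow> 0 | Suc k \<Rightarrow> L k / (real k + 1))" for n
    have "summable (\<lambda>n. b n * z ^ n)" if "norm z < 1" for z
    proof -
      have "summable (\<lambda>n. z * (L n / (real n + 1) * z ^ n))"
        by (intro summable_mult sma that)
      then have "summable (\<lambda>n. b (Suc n) * z ^ Suc n)" by (simp add: b_def mult_ac)
      then show ?thesis by (subst (asm) summable_Suc_iff)
    qed
    then have "summable (\<lambda>n. diffs b n * z ^ n)" by (intro termdiff_converges[OF z]) auto
    moreover have "diffs b = L" by (simp add: fun_eq_iff diffs_def b_def add.commute[of 1])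
    ultimately show ?thesis by simp
  qed
  define u where "u z = (\<Sum>n. L n * z ^ n)" for z
  define u' where "u' z = (\<Sum>n. diffs L n * z ^ n)" for z
  have su: "(\<lambda>n. L n * z ^ n) sums u z" if "norm z < 1" for z
    unfolding u_def by (intro summable_sums smL that)
  have su': "(\<lambda>n. diffs L n * z ^ n) sums u' z" if "norm z < 1" for z
    unfolding u'_def by (intro summable_sums termdiff_converges[OF that smL])
  have du: "(u has_field_derivative u' z) (at z)" if "norm z < 1" for z
    unfolding u_def u'_def by (rule termdiffs_strong'[OF smL that])
  have ode: "u' z * (1 - z)\<^sup>2 = (1 - z - x) * u z" if z: "norm z < 1" for z
  proof -
    have 1: "(\<lambda>n. real n * L n * z ^ n) sums (z * u' z)"
    proof -
      have "(\<lambda>n. z * (diffs L n * z ^ n)) sums (z * u' z)" by (intro sums_mult su' z)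
      then have "(\<lambda>n. real (Suc n) * L (Suc n) * z ^ Suc n) sums (z * u' z)"
        by (simp add: diffs_def mult_ac)
      then show ?thesis by (subst (asm) sums_Suc_iff) simp
    qed
    have 2: "(\<lambda>n. (real n + 1) * L n * z ^ n) sums (z * u' z + u z)"
      using sums_add[OF 1 su[OF z]] by (simp add: algebra_simps)
    have 3: "(\<lambda>n. real n * L (n - 1) * z ^ n) sums (z * (z * u' z + u z))"
    proof -
      have "(\<lambda>n. z * ((real n + 1) * L n * z ^ n)) sums (z * (z * u' z + u z))"
        by (intro sums_mult 2)
      then have "(\<lambda>n. real (Suc n) * L (Suc n - 1) * z ^ Suc n) sums (z * (z * u' z + u z))"
        by (simp add: mult_ac add.commute)
      then show ?thesis by (subst (asm) sums_Suc_iff) simp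
    qed
    have rec: "real (Suc n) * L (Suc n) - (real n + 1) * L n = real n * L n - real n * L (n - 1) - x * L n" for n
      using laguerre_diff_rec[of n x] unfolding laguerre_diff_def L_def by (simp add: algebra_simps)
    have s1: "(\<lambda>n. diffs L n * z ^ n - (real n + 1) * L n * z ^ n) sums (u' z - (z * u' z + u z))"
      by (intro sums_diff su' z 2)
    have e: "(\<lambda>n. diffs L n * z ^ n - (real n + 1) * L n * z ^ n) =
       (\<lambda>n. real n * L n * z ^ n - real n * L (n - 1) * z ^ n - x * (L n * z ^ n))"
    proof
      fix n
      have "diffs L n * z ^ n - (real n + 1) * L n * z ^ n = (real (Suc n) * L (Suc n) - (real n + 1) * L n) * z ^ n"
        by (simp add: diffs_def algebra_simps)
      then show "diffs L n * z ^ n - (real n + 1) * L n * z ^ n =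
          real n * L n * z ^ n - real n * L (n - 1) * z ^ n - x * (L n * z ^ n)"
        unfolding rec by (simp add: algebra_simps)
    qed
    have s2: "(\<lambda>n. real n * L n * z ^ n - real n * L (n - 1) * z ^ n - x * (L n * z ^ n)) sums
        (z * u' z - z * (z * u' z + u z) - x * u z)"
      by (intro sums_diff 1 3 sums_mult su z)
    have "u' z - (z * u' z + u z) = z * u' z - z * (z * u' z + u z) - x * u z"
      using s1 s2 unfolding e by (rule sums_unique2)
    then show ?thesis by (simp add: power2_eq_square algebra_simps)
  qed
  define w where "w z = u z * ((1 - z) * exp (x * z / (1 - z)))" for z
  have dw: "(w has_real_derivative 0) (at z)" if z: "norm z < 1" for z
  proof -
    have z1: "1 - z \<noteq> 0" using z by auto
    define E where "E = exp (x * z / (1 - z))"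
    have "((\<lambda>z. x * z / (1 - z)) has_real_derivative x / (1 - z)\<^sup>2) (at z)"
      using z1 by (auto intro!: derivative_eq_intros simp: power2_eq_square field_simps)
    then have "((\<lambda>z. exp (x * z / (1 - z))) has_real_derivative E * (x / (1 - z)\<^sup>2)) (at z)"
      unfolding E_def by (rule DERIV_fun_exp)
    moreover have "((\<lambda>z. 1 - z) has_real_derivative - 1) (at z)"
      by (auto intro!: derivative_eq_intros)
    ultimately have "((\<lambda>z. (1 - z) * exp (x * z / (1 - z))) has_real_derivative
        - 1 * E + E * (x / (1 - z)\<^sup>2) * (1 - z)) (at z)"
      unfolding E_def by (rule DERIV_mult[rotated])
    from DERIV_mult[OF du[OF z] this]
    have "(w has_real_derivative u' z * ((1 - z) * E) + (- 1 * E + E * (x / (1 - z)\<^sup>2) * (1 - z)) * u z) (at z)"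
      unfolding w_def E_def .
    also have "u' z * ((1 - z) * E) + (- 1 * E + E * (x / (1 - z)\<^sup>2) * (1 - z)) * u z
      = E / (1 - z) * (u' z * (1 - z)\<^sup>2 - (1 - z - x) * u z)"
    proof -
      define q where "q = 1 - z"
      have "u' z * (q * E) + (- 1 * E + E * (x / q\<^sup>2) * q) * u z = E / q * (u' z * q\<^sup>2 - (q - x) * u z)"
        using z1 by (simp add: q_def[symmetric] power2_eq_square field_simps)
      then show ?thesis unfolding q_def .
    qed
    also have "\<dots> = 0" unfolding ode[OF z] by simp
    finally show ?thesis .
  qed
  have "w t = w 0"
  proof (cases "t = 0")
    case False
    then have "0 < t" using t by simp
    then show ?thesis
      using t by (intro DERIV_isconst2[of 0 t w t])
        (auto intro!: dw DERIV_isCont[OF dw] continuous_at_imp_continuous_on)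
  qed simp
  also have "w 0 = 1" by (simp add: w_def u_def L_def)
  finally have "u t * ((1 - t) * exp (x * t / (1 - t))) = 1" by (simp add: w_def)
  then have "u t = 1 / ((1 - t) * exp (x * t / (1 - t)))"
    using t by (intro eq_divide_imp) auto
  also have "\<dots> = exp (- (x * t / (1 - t))) / (1 - t)"
    unfolding exp_minus by (simp only: divide_inverse inverse_mult_distrib mult_1 mult.commute)
  finally have "u t = exp (- x * t / (1 - t)) / (1 - t)" by simp
  then show ?thesis using su[of t] t by (simp add: L_def)
qed

text \<open>
  With \<open>s = x t / (1 - t)\<close> the integrand is the generating function in the variable \<open>t\<close>, and the
  integral over \<open>[0, 1]\<close> of \<open>t^n\<close> is \<open>1 / (n + 1)\<close>.
\<close>

lemma nn_integral_exp_over_add: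
  assumes x: "x > 0"
  shows "(\<integral>\<^sup>+s. ennreal (exp (- s) / (x + s)) * indicator {0..} s \<partial>lborel)
     = ennreal (\<Sum>n. laguerre n 0 x / (real n + 1))"
    and suminf_laguerre_over_Suc_nonneg: "0 \<le> (\<Sum>n. laguerre n 0 x / (real n + 1))"
proof -
  define a where "a n = laguerre n 0 x / (real n + 1)" for n
  define S where "S = (\<Sum>n. a n)"
  have aS: "a sums S" unfolding S_def a_def by (intro summable_sums summable_laguerre_over_Suc x)
  \<comment> \<open>Coefficients of the antiderivative of the generating function that vanishes at
    0; at t = 1 its value is the required sum.\<close>
  define b where "b n = (case n of 0 \<Rightarrow> 0 | Suc k \<Rightarrow> a k)" for n
  have bS: "b sums S"
    using sums_Suc_iff[of b S] aS by (simp add: b_def)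
  define \<Phi> where "\<Phi> t = (\<Sum>n. b n * t ^ n)" for t
  have smb: "summable (\<lambda>n. b n * t ^ n)" if "norm t < 1" for t
    by (rule powser_inside[of _ 1]) (use that bS in \<open>simp_all add: sums_iff\<close>)
  have db: "diffs b = (\<lambda>n. laguerre n 0 x)" by (simp add: fun_eq_iff diffs_def b_def a_def add.commute[of 1])
  have d\<Phi>: "(\<Phi> has_real_derivative exp (- x * t / (1 - t)) / (1 - t)) (at t)" if "0 \<le> t" "t < 1" for t
    using termdiffs_strong'[of 1 b t, OF smb] laguerre_generating_function[OF x that] that
    unfolding \<Phi>_def db by (simp add: sums_iff)
  \<comment> \<open>The substitution s = x t/(1-t) solved for t. It makes \<open>\<Psi>\<close> an
    antiderivative of the integrand, and its limit at infinity is the Abel limit of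
    \<open>\<Phi>\<close> at 1.\<close>
  define \<Psi> where "\<Psi> s = \<Phi> (s / (x + s))" for s
  have d\<Psi>: "(\<Psi> has_real_derivative exp (- s) / (x + s)) (at s)" if s: "0 \<le> s" for s
  proof -
    have xs: "x + s > 0" using s x by simp
    have t: "0 \<le> s / (x + s)" "s / (x + s) < 1" using s x xs by (auto simp: field_simps)
    have 1: "((\<lambda>s. s / (x + s)) has_real_derivative x / (x + s)\<^sup>2) (at s)"
      using xs by (auto intro!: derivative_eq_intros simp: power2_eq_square)
    have q: "1 - s / (x + s) = x / (x + s)" using xs by (simp add: field_simps)
    have "- x * (s / (x + s)) / (x / (x + s)) = - s" using xs x by simp
    then have "exp (- x * (s / (x + s)) / (1 - s / (x + s))) / (1 - s / (x + s)) * (x / (x + s)\<^sup>2) = exp (- s) / (x + s)"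
      unfolding q using xs x by (simp add: power2_eq_square)
    then show ?thesis
      using DERIV_chain2[OF d\<Phi>[OF t] 1] unfolding \<Psi>_def by simp
  qed
  have lim: "(\<Psi> \<longlongrightarrow> S) at_top"
  proof -
    have "filterlim (\<lambda>s. s / (x + s)) (at_left 1) at_top"
    proof (rule tendsto_imp_filterlim_at_left)
      have "((\<lambda>s. 1 - x / (x + s)) \<longlongrightarrow> 1 - 0) at_top"
        by (intro tendsto_intros tendsto_divide_0[OF tendsto_const] filterlim_at_top_imp_at_infinity
             filterlim_tendsto_add_at_top[OF tendsto_const] filterlim_ident)
      moreover have "\<forall>\<^sub>F s in at_top. 1 - x / (x + s) = s / (x + s)"
        using eventually_ge_at_top[of 0] by eventually_elim (use x in \<open>simp add: field_simps\<close>)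
      ultimately show "((\<lambda>s. s / (x + s)) \<longlongrightarrow> 1) at_top"
        by (simp add: tendsto_cong)
      show "\<forall>\<^sub>F s in at_top. s / (x + s) < 1"
        using eventually_ge_at_top[of 0] by eventually_elim (use x in \<open>simp add: field_simps\<close>)
    qed
    from filterlim_compose[OF Abel_sums_at_left[OF bS] this] show ?thesis
      unfolding \<Psi>_def \<Phi>_def .
  qed
  have \<Psi>0: "\<Psi> 0 = 0" by (simp add: \<Psi>_def \<Phi>_def b_def)
  then show "(\<integral>\<^sup>+s. ennreal (exp (- s) / (x + s)) * indicator {0..} s \<partial>lborel)
     = ennreal (\<Sum>n. laguerre n 0 x / (real n + 1))"
    using nn_integral_FTC_atLeast[OF _ d\<Psi> _ lim] x unfolding S_def a_def by auto
  \<comment> \<open>\<open>ennreal\<close> maps negative numbers to 0, so the value of the integral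
    does not reveal the sign of the sum. The sign comes from the monotone \<open>\<Psi>\<close>,
    which starts at 0.\<close>
  have "0 \<le> \<Psi> s" if "s \<ge> 0" for s
  proof -
    have "\<exists>y. (\<Psi> has_real_derivative y) (at r) \<and> 0 \<le> y" if "0 \<le> r" "r \<le> s" for r
      using d\<Psi>[OF that(1)] x that by (intro exI[of _ "exp (- r) / (x + r)"]) simp
    from DERIV_nonneg_imp_nondecreasing[OF that this] show ?thesis by (simp add: \<Psi>0)
  qed
  then have "\<forall>\<^sub>F s in at_top. 0 \<le> \<Psi> s"
    by (rule eventually_mono[OF eventually_ge_at_top[of 0]])
  from tendsto_lowerbound[OF lim this] show "0 \<le> (\<Sum>n. laguerre n 0 x / (real n + 1))"
    by (simp add: S_def a_def)
qed

section \<open>Addition theorem and integration over the frequency\<close>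

lemma gbinomial_shift_eq_minus:
  "((real k + \<mu>) gchoose (k - i)) = (- 1) ^ (k - i) * ((- (real i + \<mu> + 1)) gchoose (k - i))"
  if "i \<le> k"
proof -
  have "real k + \<mu> = (real i + \<mu>) + real (k - i)" using that by (simp add: of_nat_diff)
  then show ?thesis by (simp only: gbinomial_minus')
qed

text \<open>The left-hand side is the coefficient of z^m in (1-z)^-(i+\<mu>+1) (1-z)^-(j+\<nu>+1).
  Upper negation makes the upper indices independent of the summation variable, and then the
  Vandermonde convolution applies.\<close>

lemma sum_gbinomial_shift_convolution:
  "(\<Sum>p\<le>m. ((real (i + p) + \<mu>) gchoose p) * ((real (j + (m - p)) + \<nu>) gchoose (m - p)))
    = (real (i + j + m) + (\<mu> + \<nu> + 1)) gchoose m"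
proof -
  have *: "((real (i + p) + \<mu>) gchoose p) = (- 1) ^ p * ((- (real i + \<mu> + 1)) gchoose p)" for i p \<mu>
    using gbinomial_shift_eq_minus[of i "i + p" \<mu>] by simp
  have "(\<Sum>p\<le>m. ((real (i + p) + \<mu>) gchoose p) * ((real (j + (m - p)) + \<nu>) gchoose (m - p)))
    = (\<Sum>p\<le>m. (- 1) ^ m * (((- (real i + \<mu> + 1)) gchoose p) * ((- (real j + \<nu> + 1)) gchoose (m - p))))"
  proof (rule sum.cong[OF refl])
    fix p assume "p \<in> {..m}"
    then have "(- 1 :: real) ^ m = (- 1) ^ p * (- 1) ^ (m - p)" by (simp flip: power_add)
    then show "((real (i + p) + \<mu>) gchoose p) * ((real (j + (m - p)) + \<nu>) gchoose (m - p)) =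
        (- 1) ^ m * (((- (real i + \<mu> + 1)) gchoose p) * ((- (real j + \<nu> + 1)) gchoose (m - p)))"
      unfolding * by (simp add: mult_ac)
  qed
  also have "\<dots> = (- 1) ^ m * ((- (real i + \<mu> + 1) + - (real j + \<nu> + 1)) gchoose m)"
    unfolding gbinomial_Vandermonde[symmetric] sum_distrib_left by (simp add: atLeast0AtMost)
  also have "\<dots> = (real (i + j + m) + (\<mu> + \<nu> + 1)) gchoose m"
  proof -
    have "- (real i + \<mu> + 1) + - (real j + \<nu> + 1) = - (real (i + j) + (\<mu> + \<nu> + 1) + 1)" by simp
    then show ?thesis unfolding *[of "i + j" m "\<mu> + \<nu> + 1"] by (simp only:)
  qed
  finally show ?thesis .
qed

lemma laguerre_extend:
  assumes "k \<le> m"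
  shows "laguerre k \<mu> x = (\<Sum>i\<le>m. if i \<le> k then (-1) ^ i * ((real k + \<mu>) gchoose (k - i)) * x ^ i / fact i else 0)"
  unfolding laguerre_def by (rule sum.mono_neutral_cong_left) (use assms in auto)

text \<open>The coefficient of x^i y^j in the sum of products is a convolution in k which depends
  only on i + j. The binomial theorem then assembles the powers of x + y. With both parameters equal
  to -1/2 the left-hand side has parameter 0.\<close>

lemma laguerre_addition:
  "laguerre n (\<mu> + \<nu> + 1) (x + y) = (\<Sum>k\<le>n. laguerre k \<mu> x * laguerre (n - k) \<nu> y)"
proof -
  define f where "f i = (- x) ^ i / fact i" for i
  define g where "g j = (- y) ^ j / fact j" for j
  define A where "A k i = ((real k + \<mu>) gchoose (k - i))" for k i
  define B where "B k i = ((real k + \<nu>) gchoose (k - i))" for k i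
  define C where "C i = ((real n + (\<mu> + \<nu> + 1)) gchoose (n - i))" for i
  have Lx: "laguerre k \<mu> x = (\<Sum>i\<le>n. if i \<le> k then A k i * f i else 0)" if "k \<le> n" for k
    unfolding laguerre_extend[OF that] A_def f_def power_minus[of x] by (rule sum.cong) auto
  have Ly: "laguerre k \<nu> y = (\<Sum>j\<le>n. if j \<le> k then B k j * g j else 0)" if "k \<le> n" for k
    unfolding laguerre_extend[OF that] B_def g_def power_minus[of y] by (rule sum.cong) auto
  \<comment> \<open>Only k from i to n - j contributes. Writing n = i + j + m and k = i + p turns
    the sum into the convolution over p from 0 to m.\<close>
  have conv: "(\<Sum>k\<le>n. if i \<le> k \<and> j \<le> n - k then A k i * B (n - k) j else 0) = (if i + j \<le> n then C (i + j) else 0)" for i j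
  proof (cases "i + j \<le> n")
    case True
    define m where "m = n - (i + j)"
    have n: "n = i + j + m" using True by (simp add: m_def)
    have "(\<Sum>k\<le>n. if i \<le> k \<and> j \<le> n - k then A k i * B (n - k) j else 0)
       = (\<Sum>k\<in>{i..i + m}. A k i * B (n - k) j)"
      by (rule sum.mono_neutral_cong_right) (auto simp: n)
    also have "\<dots> = (\<Sum>p\<in>{0..m}. A (i + p) i * B (n - (i + p)) j)"
      using sum.shift_bounds_cl_nat_ivl[of "\<lambda>k. A k i * B (n - k) j" 0 i m] by (simp add: add.commute)
    also have "\<dots> = (\<Sum>p\<le>m. ((real (i + p) + \<mu>) gchoose p) * ((real (j + (m - p)) + \<nu>) gchoose (m - p)))"
    proof (rule sum.cong)
      fix p assume "p \<in> {..m}"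
      then have "n - (i + p) = j + (m - p)" unfolding n by auto
      then show "A (i + p) i * B (n - (i + p)) j = ((real (i + p) + \<mu>) gchoose p) * ((real (j + (m - p)) + \<nu>) gchoose (m - p))"
        unfolding A_def B_def by simp
    qed (simp add: atLeast0AtMost)
    also have "\<dots> = (real (i + j + m) + (\<mu> + \<nu> + 1)) gchoose m"
      by (rule sum_gbinomial_shift_convolution)
    finally show ?thesis using True by (simp add: C_def n)
  next
    case False
    then show ?thesis by (auto intro!: sum.neutral)
  qed
  have "(\<Sum>k\<le>n. laguerre k \<mu> x * laguerre (n - k) \<nu> y) =
     (\<Sum>k\<le>n. (\<Sum>i\<le>n. \<Sum>j\<le>n. (if i \<le> k \<and> j \<le> n - k then A k i * B (n - k) j else 0) * (f i * g j)))"
    by (intro sum.cong refl) (auto simp: Lx Ly sum_product intro!: sum.cong)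
  also have "\<dots> = (\<Sum>i\<le>n. \<Sum>j\<le>n. (\<Sum>k\<le>n. if i \<le> k \<and> j \<le> n - k then A k i * B (n - k) j else 0) * (f i * g j))"
    unfolding sum_distrib_right
    by (subst sum.swap, rule sum.cong[OF refl], rule sum.swap)
  also have "\<dots> = (\<Sum>i\<le>n. \<Sum>j\<le>n. (if i + j \<le> n then C (i + j) * (f i * g j) else 0))"
    unfolding conv by (intro sum.cong refl) auto
  also have "\<dots> = (\<Sum>s\<le>n. \<Sum>i\<le>s. C s * (f i * g (s - i)))"
  proof -
    have "(\<Sum>i\<le>n. \<Sum>j\<le>n. (if i + j \<le> n then C (i + j) * (f i * g j) else 0))
       = (\<Sum>(i, j)\<in>{..n} \<times> {..n}. (if i + j \<le> n then C (i + j) * (f i * g j) else 0))"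
      by (rule sum.cartesian_product)
    also have "\<dots> = (\<Sum>(i, j)\<in>{(i, j). i + j \<le> n}. C (i + j) * (f i * g j))"
      by (rule sum.mono_neutral_cong_right) (auto split: if_splits)
    also have "\<dots> = (\<Sum>s\<le>n. \<Sum>i\<le>s. C (i + (s - i)) * (f i * g (s - i)))"
      by (rule sum.triangle_reindex_eq)
    also have "\<dots> = (\<Sum>s\<le>n. \<Sum>i\<le>s. C s * (f i * g (s - i)))"
      by (intro sum.cong refl) auto
    finally show ?thesis .
  qed
  also have "\<dots> = (\<Sum>s\<le>n. C s * ((- (x + y)) ^ s / fact s))"
  proof (rule sum.cong[OF refl])
    fix s
    have "(- (x + y)) ^ s / fact s = (\<Sum>i\<le>s. real (s choose i) * (- x) ^ i * (- y) ^ (s - i)) / fact s"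
      using binomial_ring[of "- x" "- y" s] by simp
    also have "\<dots> = (\<Sum>i\<le>s. f i * g (s - i))"
      unfolding sum_divide_distrib f_def g_def
      by (intro sum.cong refl) (simp add: binomial_fact)
    finally show "(\<Sum>i\<le>s. C s * (f i * g (s - i))) = C s * ((- (x + y)) ^ s / fact s)"
      by (simp add: sum_distrib_left)
  qed
  also have "\<dots> = laguerre n (\<mu> + \<nu> + 1) (x + y)"
    unfolding laguerre_def C_def power_minus[of "x + y"] by (intro sum.cong refl) (simp add: mult_ac)
  finally show ?thesis by simp
qed

text \<open>Integration of f^(2i) produces the factor 1/(2i+1). By this identity it raises the
  parameter from -1/2 to 1/2 at the cost of 1/(2k+1), which does not depend on i.\<close>

lemma gbinomial_half_ratio:
  assumes "i \<le> k"
  shows "((real k - 1 / 2) gchoose (k - i)) * (2 * real k + 1) = ((real k + 1 / 2) gchoose (k - i)) * (2 * real i + 1)"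
proof -
  define p where "p = k - i"
  have k: "real k = real i + real p" using assms by (simp add: p_def)
  have "((real k - 1 / 2) gchoose p) * (2 * real k + 1) = ((real k + 1 / 2) gchoose p) * (2 * real i + 1)"
  proof -
    have 1: "((real k + 1 / 2) gchoose p) * (real k + 1 / 2 - real p) = (real k + 1 / 2) * ((real k - 1 / 2) gchoose p)"
      using gbinomial_absorb_comp[of "real k + 1 / 2" p] by (simp add: mult.commute)
    show ?thesis using 1 unfolding k by (simp add: algebra_simps)
  qed
  then show ?thesis unfolding p_def .
qed

text \<open>The antiderivative of each even power is odd, so the two endpoints contribute equally;
  the argument of the result is \<beta> times the square of the endpoint W/2.\<close>

lemma has_integral_laguerre_square:
  assumes W: "W > 0"
  shows "((\<lambda>f. laguerre k (- 1 / 2) (\<beta> * f\<^sup>2)) has_integral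
     W * (1 / (2 * real k + 1) * laguerre k (1 / 2) (\<beta> * W\<^sup>2 / 4))) {- W / 2..W / 2}"
proof -
  define c where "c i = (-1) ^ i * ((real k + (- 1 / 2)) gchoose (k - i)) * \<beta> ^ i / fact i" for i
  have eq: "laguerre k (- 1 / 2) (\<beta> * f\<^sup>2) = (\<Sum>i\<le>k. c i * f ^ (2 * i))" for f
    unfolding laguerre_def c_def by (intro sum.cong refl) (simp add: power_mult_distrib power_mult)
  have int: "((\<lambda>f. c i * f ^ (2 * i)) has_integral c i * ((W / 2) ^ (2 * i + 1) * 2 / (2 * real i + 1))) {- W / 2..W / 2}" for i
  proof (intro has_integral_mult_right)
    have "((\<lambda>f. f ^ (2 * i)) has_integral (W / 2) ^ (2 * i + 1) / (2 * real i + 1) - (- W / 2) ^ (2 * i + 1) / (2 * real i + 1)) {- W / 2..W / 2}"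
    proof (rule fundamental_theorem_of_calculus)
      fix f :: real
      have "((\<lambda>f. f ^ (2 * i + 1) / (2 * real i + 1)) has_real_derivative f ^ (2 * i)) (at f within {- W / 2..W / 2})"
        using DERIV_cdivide[OF DERIV_pow[of "2 * i + 1" f], of "2 * real i + 1"] by (simp add: add.commute)
      then show "((\<lambda>f. f ^ (2 * i + 1) / (2 * real i + 1)) has_vector_derivative f ^ (2 * i)) (at f within {- W / 2..W / 2})"
        by (simp add: has_real_derivative_iff_has_vector_derivative)
    qed (use W in auto)
    moreover have "(- W / 2) ^ (2 * i + 1) = - ((W / 2) ^ (2 * i + 1))"
      using power_minus_odd[of "2 * i + 1" "W / 2"] by simp
    moreover have "A / c - (- A) / c = A * 2 / c" for A c :: real by (simp add: add_divide_distrib)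
    ultimately show "((\<lambda>f. f ^ (2 * i)) has_integral (W / 2) ^ (2 * i + 1) * 2 / (2 * real i + 1)) {- W / 2..W / 2}"
      by (simp only:)
  qed
  have "((\<lambda>f. \<Sum>i\<le>k. c i * f ^ (2 * i)) has_integral (\<Sum>i\<le>k. c i * ((W / 2) ^ (2 * i + 1) * 2 / (2 * real i + 1)))) {- W / 2..W / 2}"
    by (intro has_integral_sum int) auto
  also have "(\<Sum>i\<le>k. c i * ((W / 2) ^ (2 * i + 1) * 2 / (2 * real i + 1))) =
     W * (1 / (2 * real k + 1) * laguerre k (1 / 2) (\<beta> * W\<^sup>2 / 4))"
    unfolding laguerre_def sum_distrib_left
  proof (rule sum.cong[OF refl])
    fix i assume "i \<in> {..k}"
    then have "((real k - 1 / 2) gchoose (k - i)) = ((real k + 1 / 2) gchoose (k - i)) * (2 * real i + 1) / (2 * real k + 1)"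
      using gbinomial_half_ratio[of i k] by (simp add: field_simps)
    moreover have "(W / 2) ^ (2 * i + 1) = W / 2 * (W\<^sup>2 / 4) ^ i"
      by (simp add: power_mult power_divide)
    moreover have "(\<beta> * W\<^sup>2 / 4) ^ i = \<beta> ^ i * (W\<^sup>2 / 4) ^ i" by (simp add: power_mult_distrib[symmetric])
    moreover have "2 * real i + 1 > 0" by simp
    ultimately show "c i * ((W / 2) ^ (2 * i + 1) * 2 / (2 * real i + 1)) =
       W * (1 / (2 * real k + 1) * ((- 1) ^ i * (real k + 1 / 2 gchoose (k - i)) * (\<beta> * W\<^sup>2 / 4) ^ i / fact i))"
      unfolding c_def by (simp del: of_nat_add)
  qed
  finally show ?thesis unfolding eq .
qed

text \<open>The addition theorem separates \<beta> f^2 from the constant \<beta> \<gamma>. Only the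
  factor containing f is integrated, so its parameter becomes 1/2 while the other one keeps
  -1/2.\<close>

lemma has_integral_laguerre_affine_square:
  assumes W: "W > 0"
  shows "((\<lambda>f. laguerre n 0 (\<beta> * (\<gamma> + f\<^sup>2))) has_integral
     W * (\<Sum>k\<le>n. 1 / (2 * real k + 1) * laguerre k (1 / 2) (\<beta> * W\<^sup>2 / 4) * laguerre (n - k) (- 1 / 2) (\<beta> * \<gamma>)))
     {- W / 2..W / 2}"
proof -
  have "laguerre n 0 (\<beta> * (\<gamma> + f\<^sup>2)) = (\<Sum>k\<le>n. laguerre k (- 1 / 2) (\<beta> * f\<^sup>2) * laguerre (n - k) (- 1 / 2) (\<beta> * \<gamma>))" for f
    using laguerre_addition[of n "- 1 / 2" "- 1 / 2" "\<beta> * f\<^sup>2" "\<beta> * \<gamma>"] by (simp add: algebra_simps)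
  moreover have "((\<lambda>f. \<Sum>k\<le>n. laguerre k (- 1 / 2) (\<beta> * f\<^sup>2) * laguerre (n - k) (- 1 / 2) (\<beta> * \<gamma>)) has_integral
     (\<Sum>k\<le>n. W * (1 / (2 * real k + 1) * laguerre k (1 / 2) (\<beta> * W\<^sup>2 / 4)) * laguerre (n - k) (- 1 / 2) (\<beta> * \<gamma>)))
     {- W / 2..W / 2}"
    by (intro has_integral_sum has_integral_mult_left has_integral_laguerre_square W) auto
  ultimately show ?thesis by (simp add: sum_distrib_left mult.assoc)
qed

section \<open>Mean-square convergence\<close>

definition square_integrable :: "'w measure \<Rightarrow> ('w \<Rightarrow> 'b::euclidean_space) \<Rightarrow> bool"
  where "square_integrable M f \<longleftrightarrow> f \<in> borel_measurable M \<and> integrable M (\<lambda>\<omega>. (norm (f \<omega>))\<^sup>2)"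

lemma square_integrable_measurable [measurable_dest]: "square_integrable M f \<Longrightarrow> f \<in> borel_measurable M"
  by (simp add: square_integrable_def)

lemma square_integrable_integrable_norm: "square_integrable M f \<Longrightarrow> integrable M (\<lambda>\<omega>. (norm (f \<omega>))\<^sup>2)"
  by (simp add: square_integrable_def)

lemma square_integrable_iff_nn_integral:
  "square_integrable M f \<longleftrightarrow> f \<in> borel_measurable M \<and> (\<integral>\<^sup>+\<omega>. ennreal ((norm (f \<omega>))\<^sup>2) \<partial>M) < \<infinity>"
  unfolding square_integrable_def integrable_iff_bounded by auto

lemma nn_integral_norm_sq:
  "square_integrable M f \<Longrightarrow> (\<integral>\<^sup>+\<omega>. ennreal ((norm (f \<omega>))\<^sup>2) \<partial>M) = ennreal (\<integral>\<omega>. (norm (f \<omega>))\<^sup>2 \<partial>M)"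
  by (intro nn_integral_eq_integral square_integrable_integrable_norm) auto

lemma norm_add_sq_le:
  fixes x y :: "'b::real_normed_vector"
  shows "(norm (x + y))\<^sup>2 \<le> 2 * (norm x)\<^sup>2 + 2 * (norm y)\<^sup>2"
proof -
  have "(norm (x + y))\<^sup>2 \<le> (norm x + norm y)\<^sup>2" by (intro power_mono norm_triangle_ineq) auto
  also have "\<dots> \<le> 2 * (norm x)\<^sup>2 + 2 * (norm y)\<^sup>2"
    using sum_squares_bound[of "norm x" "norm y"] by (simp add: power2_sum)
  finally show ?thesis .
qed

lemma square_integrable_add:
  assumes "square_integrable M f" "square_integrable M g"
  shows "square_integrable M (\<lambda>\<omega>. f \<omega> + g \<omega>)"
  unfolding square_integrable_def
proof
  note [measurable] = assms[THEN square_integrable_measurable]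
  show "(\<lambda>\<omega>. f \<omega> + g \<omega>) \<in> borel_measurable M" by measurable
  show "integrable M (\<lambda>\<omega>. (norm (f \<omega> + g \<omega>))\<^sup>2)"
    by (rule Bochner_Integration.integrable_bound[where f = "\<lambda>\<omega>. 2 * (norm (f \<omega>))\<^sup>2 + 2 * (norm (g \<omega>))\<^sup>2"])
      (use assms[THEN square_integrable_integrable_norm] in \<open>auto intro!: norm_add_sq_le\<close>)
qed

lemma square_integrable_scaleR:
  assumes "square_integrable M f"
  shows "square_integrable M (\<lambda>\<omega>. c *\<^sub>R f \<omega>)"
  using assms by (auto simp: square_integrable_def power_mult_distrib)

lemma square_integrable_diff:
  assumes "square_integrable M f" "square_integrable M g"
  shows "square_integrable M (\<lambda>\<omega>. f \<omega> - g \<omega>)"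
  using square_integrable_add[OF assms(1) square_integrable_scaleR[OF assms(2), of "-1"]] by simp

lemma square_integrable_sum:
  assumes "\<And>i. i \<in> I \<Longrightarrow> square_integrable M (f i)"
  shows "square_integrable M (\<lambda>\<omega>. \<Sum>i\<in>I. f i \<omega>)"
  using assms
proof (induction I rule: infinite_finite_induct)
  case (insert i I)
  then show ?case by (simp add: square_integrable_add)
qed (simp_all add: square_integrable_def)

lemma integrable_inner:
  assumes "square_integrable M f" "square_integrable M g"
  shows "integrable M (\<lambda>\<omega>. f \<omega> \<bullet> g \<omega>)"
proof -
  note [measurable] = assms[THEN square_integrable_measurable]
  show ?thesis
  proof (rule Bochner_Integration.integrable_bound[where f = "\<lambda>\<omega>. (norm (f \<omega>))\<^sup>2 + (norm (g \<omega>))\<^sup>2"])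
    show "AE \<omega> in M. norm (f \<omega> \<bullet> g \<omega>) \<le> norm ((norm (f \<omega>))\<^sup>2 + (norm (g \<omega>))\<^sup>2)"
    proof (intro AE_I2)
      fix \<omega>
      have "\<bar>f \<omega> \<bullet> g \<omega>\<bar> \<le> norm (f \<omega>) * norm (g \<omega>)" by (rule Cauchy_Schwarz_ineq2)
      also have "\<dots> \<le> 2 * norm (f \<omega>) * norm (g \<omega>)" by simp
      also have "\<dots> \<le> (norm (f \<omega>))\<^sup>2 + (norm (g \<omega>))\<^sup>2" by (rule sum_squares_bound)
      finally show "norm (f \<omega> \<bullet> g \<omega>) \<le> norm ((norm (f \<omega>))\<^sup>2 + (norm (g \<omega>))\<^sup>2)" by simp
    qed
  qed (use assms[THEN square_integrable_integrable_norm] in auto)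
qed

lemma abs_integral_inner_le:
  assumes "square_integrable M f" "square_integrable M g"
  shows "\<bar>\<integral>\<omega>. f \<omega> \<bullet> g \<omega> \<partial>M\<bar> \<le> sqrt (\<integral>\<omega>. (norm (f \<omega>))\<^sup>2 \<partial>M) * sqrt (\<integral>\<omega>. (norm (g \<omega>))\<^sup>2 \<partial>M)"
proof -
  note [measurable] = assms[THEN square_integrable_measurable]
  define F where "F = (\<integral>\<omega>. (norm (f \<omega>))\<^sup>2 \<partial>M)"
  define G where "G = (\<integral>\<omega>. (norm (g \<omega>))\<^sup>2 \<partial>M)"
  define I where "I = (\<integral>\<omega>. norm (f \<omega>) * norm (g \<omega>) \<partial>M)"
  have FG: "F \<ge> 0" "G \<ge> 0" "I \<ge> 0" unfolding F_def G_def I_def by auto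
  have int: "integrable M (\<lambda>\<omega>. norm (f \<omega>) * norm (g \<omega>))"
    using integrable_inner[of M "\<lambda>\<omega>. norm (f \<omega>)" "\<lambda>\<omega>. norm (g \<omega>)"] assms
    by (auto simp: square_integrable_def)
  have "(\<integral>\<^sup>+\<omega>. ennreal (norm (f \<omega>)) * ennreal (norm (g \<omega>)) \<partial>M)\<^sup>2 \<le>
      (\<integral>\<^sup>+\<omega>. (ennreal (norm (f \<omega>)))\<^sup>2 \<partial>M) * (\<integral>\<^sup>+\<omega>. (ennreal (norm (g \<omega>)))\<^sup>2 \<partial>M)"
    by (rule Cauchy_Schwarz_nn_integral) auto
  also have "(\<integral>\<^sup>+\<omega>. ennreal (norm (f \<omega>)) * ennreal (norm (g \<omega>)) \<partial>M) = ennreal I"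
    unfolding I_def using int by (simp add: ennreal_mult[symmetric] nn_integral_eq_integral)
  also have "(\<integral>\<^sup>+\<omega>. (ennreal (norm (f \<omega>)))\<^sup>2 \<partial>M) = ennreal F"
    unfolding F_def using nn_integral_norm_sq[OF assms(1)] by (simp add: ennreal_power)
  also have "(\<integral>\<^sup>+\<omega>. (ennreal (norm (g \<omega>)))\<^sup>2 \<partial>M) = ennreal G"
    unfolding G_def using nn_integral_norm_sq[OF assms(2)] by (simp add: ennreal_power)
  finally have "I\<^sup>2 \<le> F * G" using FG by (simp add: ennreal_power ennreal_mult[symmetric])
  then have "I \<le> sqrt (F * G)" by (rule real_le_rsqrt)
  moreover have "\<bar>\<integral>\<omega>. f \<omega> \<bullet> g \<omega> \<partial>M\<bar> \<le> I"
  proof -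
    have "\<bar>\<integral>\<omega>. f \<omega> \<bullet> g \<omega> \<partial>M\<bar> \<le> (\<integral>\<omega>. \<bar>f \<omega> \<bullet> g \<omega>\<bar> \<partial>M)" by (rule integral_abs_bound)
    also have "\<dots> \<le> I" unfolding I_def
      using integrable_inner[OF assms] int by (intro integral_mono) (auto intro: Cauchy_Schwarz_ineq2)
    finally show ?thesis .
  qed
  ultimately show ?thesis by (simp add: real_sqrt_mult F_def G_def)
qed

text \<open>A distance tending to 0 is eventually finite, so the differences are eventually in L2.
  One index at which both \<open>S i\<close> and the difference are in L2 puts the limit there, and
  from then on the extended integrals are real integrals.\<close>

lemma ms_tendsto_square_integrable:
  assumes "ms_tendsto M S I F" "F \<noteq> bot" "\<forall>\<^sub>F i in F. square_integrable M (S i)"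
  shows "square_integrable M I"
    and "\<forall>\<^sub>F i in F. square_integrable M (\<lambda>\<omega>. S i \<omega> - I \<omega>)"
    and "((\<lambda>i. \<integral>\<omega>. (norm (S i \<omega> - I \<omega>))\<^sup>2 \<partial>M) \<longlongrightarrow> 0) F"
proof -
  have I [measurable]: "I \<in> borel_measurable M"
    and lim: "((\<lambda>i. \<integral>\<^sup>+\<omega>. ennreal ((norm (S i \<omega> - I \<omega>))\<^sup>2) \<partial>M) \<longlongrightarrow> 0) F"
    using assms(1) by (auto simp: ms_tendsto_def)
  have "\<forall>\<^sub>F i in F. (\<integral>\<^sup>+\<omega>. ennreal ((norm (S i \<omega> - I \<omega>))\<^sup>2) \<partial>M) < \<infinity>"
    using order_tendstoD(2)[OF lim, of \<infinity>] by simp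
  with assms(3) have *: "\<forall>\<^sub>F i in F. square_integrable M (\<lambda>\<omega>. S i \<omega> - I \<omega>)"
    by eventually_elim (auto simp: square_integrable_iff_nn_integral)
  then show "\<forall>\<^sub>F i in F. square_integrable M (\<lambda>\<omega>. S i \<omega> - I \<omega>)" .
  have "\<exists>i. square_integrable M (S i) \<and> square_integrable M (\<lambda>\<omega>. S i \<omega> - I \<omega>)"
    using eventually_happens'[OF assms(2) eventually_conj[OF assms(3) *]] .
  then obtain i where i: "square_integrable M (S i)" "square_integrable M (\<lambda>\<omega>. S i \<omega> - I \<omega>)" by blast
  show "square_integrable M I" using square_integrable_diff[OF i] by simp
  have "\<forall>\<^sub>F i in F. (\<integral>\<^sup>+\<omega>. ennreal ((norm (S i \<omega> - I \<omega>))\<^sup>2) \<partial>M) = ennreal (\<integral>\<omega>. (norm (S i \<omega> - I \<omega>))\<^sup>2 \<partial>M)"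
    using * by eventually_elim (rule nn_integral_norm_sq)
  with lim have "((\<lambda>i. ennreal (\<integral>\<omega>. (norm (S i \<omega> - I \<omega>))\<^sup>2 \<partial>M)) \<longlongrightarrow> ennreal 0) F"
    by (simp add: tendsto_cong)
  then show "((\<lambda>i. \<integral>\<omega>. (norm (S i \<omega> - I \<omega>))\<^sup>2 \<partial>M) \<longlongrightarrow> 0) F"
    by (rule tendsto_ennrealD) auto
qed

lemma ms_tendstoI:
  assumes "\<forall>\<^sub>F i in F. square_integrable M (S i)" "square_integrable M I"
    and "((\<lambda>i. \<integral>\<omega>. (norm (S i \<omega> - I \<omega>))\<^sup>2 \<partial>M) \<longlongrightarrow> 0) F"
  shows "ms_tendsto M S I F"
  unfolding ms_tendsto_def
proof (intro conjI)
  show "\<forall>\<^sub>F i in F. S i \<in> borel_measurable M"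
    using assms(1) by eventually_elim (rule square_integrable_measurable)
  show "I \<in> borel_measurable M" using assms(2) by (rule square_integrable_measurable)
  have "((\<lambda>i. ennreal (\<integral>\<omega>. (norm (S i \<omega> - I \<omega>))\<^sup>2 \<partial>M)) \<longlongrightarrow> ennreal 0) F"
    by (intro tendsto_ennrealI assms(3))
  moreover have "\<forall>\<^sub>F i in F. ennreal (\<integral>\<omega>. (norm (S i \<omega> - I \<omega>))\<^sup>2 \<partial>M) = (\<integral>\<^sup>+\<omega>. ennreal ((norm (S i \<omega> - I \<omega>))\<^sup>2) \<partial>M)"
    using assms(1) by eventually_elim (simp add: nn_integral_norm_sq square_integrable_diff assms(2))
  ultimately show "((\<lambda>i. \<integral>\<^sup>+\<omega>. ennreal ((norm (S i \<omega> - I \<omega>))\<^sup>2) \<partial>M) \<longlongrightarrow> 0) F"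
    by (simp add: tendsto_cong)
qed

text \<open>Cauchy-Schwarz makes the pairing with a fixed L2 function continuous. All means and
  covariances of stochastic integrals are obtained through this limit.\<close>

lemma ms_tendsto_integral_inner:
  assumes "ms_tendsto M S I F" "F \<noteq> bot" "\<forall>\<^sub>F i in F. square_integrable M (S i)" "square_integrable M V"
  shows "((\<lambda>i. \<integral>\<omega>. S i \<omega> \<bullet> V \<omega> \<partial>M) \<longlongrightarrow> (\<integral>\<omega>. I \<omega> \<bullet> V \<omega> \<partial>M)) F"
proof -
  note I = ms_tendsto_square_integrable[OF assms(1-3)]
  have "((\<lambda>i. sqrt (\<integral>\<omega>. (norm (S i \<omega> - I \<omega>))\<^sup>2 \<partial>M) * sqrt (\<integral>\<omega>. (norm (V \<omega>))\<^sup>2 \<partial>M)) \<longlongrightarrow> sqrt 0 * sqrt (\<integral>\<omega>. (norm (V \<omega>))\<^sup>2 \<partial>M)) F"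
    by (intro tendsto_intros I(3))
  then have g0: "((\<lambda>i. sqrt (\<integral>\<omega>. (norm (S i \<omega> - I \<omega>))\<^sup>2 \<partial>M) * sqrt (\<integral>\<omega>. (norm (V \<omega>))\<^sup>2 \<partial>M)) \<longlongrightarrow> 0) F"
    by simp
  have "\<forall>\<^sub>F i in F. norm ((\<integral>\<omega>. S i \<omega> \<bullet> V \<omega> \<partial>M) - (\<integral>\<omega>. I \<omega> \<bullet> V \<omega> \<partial>M))
      \<le> sqrt (\<integral>\<omega>. (norm (S i \<omega> - I \<omega>))\<^sup>2 \<partial>M) * sqrt (\<integral>\<omega>. (norm (V \<omega>))\<^sup>2 \<partial>M)"
    using assms(3) I(2)
  proof eventually_elim
    case (elim i)
    have "(\<integral>\<omega>. S i \<omega> \<bullet> V \<omega> \<partial>M) - (\<integral>\<omega>. I \<omega> \<bullet> V \<omega> \<partial>M) = (\<integral>\<omega>. (S i \<omega> - I \<omega>) \<bullet> V \<omega> \<partial>M)"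
      using elim I(1) assms(4) by (simp add: inner_diff_left integrable_inner)
    then show ?case using abs_integral_inner_le[OF elim(2) assms(4)] by simp
  qed
  from Lim_null_comparison[OF this g0] show ?thesis by (rule LIM_zero_cancel)
qed

text \<open>Expand |S|^2 = |S - I|^2 + 2 S . I - |I|^2 and take the limit of each term.\<close>

lemma ms_tendsto_integral_norm_sq:
  assumes "ms_tendsto M S I F" "F \<noteq> bot" "\<forall>\<^sub>F i in F. square_integrable M (S i)"
  shows "((\<lambda>i. \<integral>\<omega>. (norm (S i \<omega>))\<^sup>2 \<partial>M) \<longlongrightarrow> (\<integral>\<omega>. (norm (I \<omega>))\<^sup>2 \<partial>M)) F"
proof -
  note I = ms_tendsto_square_integrable[OF assms]
  have "((\<lambda>i. (\<integral>\<omega>. (norm (S i \<omega> - I \<omega>))\<^sup>2 \<partial>M) + 2 * (\<integral>\<omega>. S i \<omega> \<bullet> I \<omega> \<partial>M) - (\<integral>\<omega>. (norm (I \<omega>))\<^sup>2 \<partial>M)) \<longlongrightarrow>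
      0 + 2 * (\<integral>\<omega>. I \<omega> \<bullet> I \<omega> \<partial>M) - (\<integral>\<omega>. (norm (I \<omega>))\<^sup>2 \<partial>M)) F"
    by (intro tendsto_intros I(3) ms_tendsto_integral_inner[OF assms I(1)])
  moreover have "0 + 2 * (\<integral>\<omega>. I \<omega> \<bullet> I \<omega> \<partial>M) - (\<integral>\<omega>. (norm (I \<omega>))\<^sup>2 \<partial>M) = (\<integral>\<omega>. (norm (I \<omega>))\<^sup>2 \<partial>M)"
    by (simp add: power2_norm_eq_inner)
  moreover have "\<forall>\<^sub>F i in F. (\<integral>\<omega>. (norm (S i \<omega> - I \<omega>))\<^sup>2 \<partial>M) + 2 * (\<integral>\<omega>. S i \<omega> \<bullet> I \<omega> \<partial>M) - (\<integral>\<omega>. (norm (I \<omega>))\<^sup>2 \<partial>M)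
      = (\<integral>\<omega>. (norm (S i \<omega>))\<^sup>2 \<partial>M)"
    using assms(3) I(2)
  proof eventually_elim
    case (elim i)
    have "(\<integral>\<omega>. (norm (S i \<omega>))\<^sup>2 \<partial>M) = (\<integral>\<omega>. (norm (S i \<omega> - I \<omega>))\<^sup>2 + 2 * (S i \<omega> \<bullet> I \<omega>) - (norm (I \<omega>))\<^sup>2 \<partial>M)"
      by (intro Bochner_Integration.integral_cong refl)
        (simp add: power2_norm_eq_inner inner_diff_left inner_diff_right inner_commute)
    also have "\<dots> = (\<integral>\<omega>. (norm (S i \<omega> - I \<omega>))\<^sup>2 \<partial>M) + 2 * (\<integral>\<omega>. S i \<omega> \<bullet> I \<omega> \<partial>M) - (\<integral>\<omega>. (norm (I \<omega>))\<^sup>2 \<partial>M)"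
      using elim I(1) by (simp add: integrable_inner square_integrable_integrable_norm)
    finally show ?case by simp
  qed
  ultimately show ?thesis by (simp add: tendsto_cong)
qed

text \<open>
  Completeness of \<open>L\<^sup>2\<close> along a filter: as in the Riesz--Fischer theorem, a sequence with
  \<open>\<parallel>T\<^sub>n\<^sub>+\<^sub>1 - T\<^sub>n\<parallel>\<^sup>2 \<le> 4\<^sup>-\<^sup>n\<close> converges almost surely, because
  \<open>2 |d| \<le> 2\<^sup>-\<^sup>n + 2\<^sup>n d\<^sup>2\<close>.
\<close>

lemma ms_Cauchy_imp_ms_tendsto:
  fixes S :: "'i \<Rightarrow> 'w \<Rightarrow> 'b::euclidean_space"
  assumes F: "F \<noteq> bot" and si: "\<forall>\<^sub>F i in F. square_integrable M (S i)"
    and Cauchy: "\<And>e. e > 0 \<Longrightarrow> \<exists>P. eventually P F \<and>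
      (\<forall>i j. P i \<longrightarrow> P j \<longrightarrow> square_integrable M (S i) \<longrightarrow> square_integrable M (S j) \<longrightarrow>
         (\<integral>\<omega>. (norm (S i \<omega> - S j \<omega>))\<^sup>2 \<partial>M) \<le> e)"
  shows "\<exists>I. square_integrable M I \<and> ms_tendsto M S I F"
proof -
  have "\<exists>P. \<forall>n. eventually (P n) F \<and> (\<forall>i j. P n i \<longrightarrow> P n j \<longrightarrow> square_integrable M (S i) \<longrightarrow> square_integrable M (S j) \<longrightarrow>
         (\<integral>\<omega>. (norm (S i \<omega> - S j \<omega>))\<^sup>2 \<partial>M) \<le> (1 / 4) ^ n)"
    by (intro choice allI Cauchy) simp
  then obtain P where P: "\<And>n. eventually (P n) F"
    and PC: "\<And>n i j. P n i \<Longrightarrow> P n j \<Longrightarrow> square_integrable M (S i) \<Longrightarrow> square_integrable M (S j) \<Longrightarrow>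
         (\<integral>\<omega>. (norm (S i \<omega> - S j \<omega>))\<^sup>2 \<partial>M) \<le> (1 / 4) ^ n" by blast
  \<comment> \<open>Requiring all Cauchy conditions up to \<open>n\<close> makes the sets nested.
    Every later term of the sequence \<open>T\<close> then also satisfies the conditions of level
    \<open>n\<close>.\<close>
  define Q where "Q n i \<longleftrightarrow> square_integrable M (S i) \<and> (\<forall>k\<in>{..n}. P k i)" for n i
  have Q: "eventually (Q n) F" for n
    unfolding Q_def by (intro eventually_conj si eventually_ball_finite ballI P) auto
  then have "\<forall>n. \<exists>i. Q n i" using eventually_happens' F by blast
  then obtain \<iota> where \<iota>: "\<And>n. Q n (\<iota> n)" by metis
  define T where "T n = S (\<iota> n)" for n
  have T [measurable]: "T n \<in> borel_measurable M" for n
    using \<iota>[of n] by (auto simp: T_def Q_def intro: square_integrable_measurable)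
  have sqT: "square_integrable M (T n)" for n using \<iota>[of n] by (simp add: T_def Q_def)
  have TC: "(\<integral>\<omega>. (norm (S j \<omega> - T m \<omega>))\<^sup>2 \<partial>M) \<le> (1 / 4) ^ n" if "Q n j" "n \<le> m" for j m n
    using PC[of n j "\<iota> m"] \<iota>[of m] that unfolding T_def Q_def by auto
  define d where "d n \<omega> = norm (T n \<omega> - T (Suc n) \<omega>)" for n \<omega>
  have dm [measurable]: "d n \<in> borel_measurable M" for n unfolding d_def by measurable
  have "(\<integral>\<^sup>+\<omega>. (\<Sum>n. ennreal (2 ^ n * (d n \<omega>)\<^sup>2)) \<partial>M) = (\<Sum>n. \<integral>\<^sup>+\<omega>. ennreal (2 ^ n * (d n \<omega>)\<^sup>2) \<partial>M)"
    by (intro nn_integral_suminf) measurable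
  also have "\<dots> \<le> (\<Sum>n. ennreal ((1 / 2) ^ n))"
  proof (rule suminf_le)
    fix n
    have "(\<integral>\<^sup>+\<omega>. ennreal (2 ^ n * (d n \<omega>)\<^sup>2) \<partial>M) = ennreal (2 ^ n) * (\<integral>\<^sup>+\<omega>. ennreal ((d n \<omega>)\<^sup>2) \<partial>M)"
      by (subst nn_integral_cmult[symmetric]) (auto simp: ennreal_mult)
    also have "(\<integral>\<^sup>+\<omega>. ennreal ((d n \<omega>)\<^sup>2) \<partial>M) = ennreal (\<integral>\<omega>. (norm (T n \<omega> - T (Suc n) \<omega>))\<^sup>2 \<partial>M)"
      unfolding d_def by (intro nn_integral_norm_sq square_integrable_diff sqT)
    also have "\<dots> \<le> ennreal ((1 / 4) ^ n)"
      unfolding T_def[of n] using TC[of n "\<iota> n" "Suc n"] \<iota>[of n] by (intro ennreal_leI) simp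
    also have "ennreal (2 ^ n) * ennreal ((1 / 4) ^ n) = ennreal ((1 / 2) ^ n)"
      by (simp add: ennreal_mult[symmetric] power_mult_distrib[symmetric])
    finally show "(\<integral>\<^sup>+\<omega>. ennreal (2 ^ n * (d n \<omega>)\<^sup>2) \<partial>M) \<le> ennreal ((1 / 2) ^ n)"
      by (simp add: mult_left_mono)
  qed auto
  also have "\<dots> < \<infinity>"
    by (subst suminf_ennreal_eq[OF _ geometric_sums]) auto
  finally have "(\<integral>\<^sup>+\<omega>. (\<Sum>n. ennreal (2 ^ n * (d n \<omega>)\<^sup>2)) \<partial>M) \<noteq> \<infinity>" by simp
  then have "AE \<omega> in M. (\<Sum>n. ennreal (2 ^ n * (d n \<omega>)\<^sup>2)) \<noteq> \<infinity>"
    by (rule nn_integral_PInf_AE[rotated]) measurable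
  then have conv: "AE \<omega> in M. convergent (\<lambda>n. T n \<omega>)"
  proof eventually_elim
    case (elim \<omega>)
    have s1: "summable (\<lambda>n. 2 ^ n * (d n \<omega>)\<^sup>2)"
      by (rule summable_suminf_not_top) (use elim in auto)
    have s2: "summable (\<lambda>n. (1 / 2 :: real) ^ n)" by (intro summable_geometric) auto
    have "summable (\<lambda>n. norm (T (Suc n) \<omega> - T n \<omega>))"
    proof (rule summable_comparison_test'[OF summable_add[OF s2 s1], of 0])
      fix n
      define r where "r = (2::real) ^ n"
      have r: "r > 0" "(1 / 2) ^ n = 1 / r" by (auto simp: r_def power_one_over)
      have "2 * 1 * (r * d n \<omega>) \<le> 1\<^sup>2 + (r * d n \<omega>)\<^sup>2" by (rule sum_squares_bound)
      then have "2 * (r * d n \<omega>) / r \<le> (1 + (r * d n \<omega>)\<^sup>2) / r"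
        using r by (intro divide_right_mono) auto
      also have "\<dots> = 1 / r + r * (d n \<omega>)\<^sup>2" using r by (simp add: field_simps power2_eq_square)
      finally have "2 * d n \<omega> \<le> 1 / r + r * (d n \<omega>)\<^sup>2" using r by simp
      moreover have "d n \<omega> \<ge> 0" by (simp add: d_def)
      ultimately have "d n \<omega> \<le> 1 / r + r * (d n \<omega>)\<^sup>2" by linarith
      then show "norm (norm (T (Suc n) \<omega> - T n \<omega>)) \<le> (1 / 2) ^ n + 2 ^ n * (d n \<omega>)\<^sup>2"
        unfolding r(2) r_def[symmetric] by (simp add: d_def norm_minus_commute[of "T (Suc n) \<omega>"])
    qed
    then have "summable (\<lambda>n. T (Suc n) \<omega> - T n \<omega>)" by (rule summable_norm_cancel)
    then have "convergent (\<lambda>N. T N \<omega> - T 0 \<omega>)"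
      by (simp add: summable_iff_convergent sum_lessThan_telescope[of "\<lambda>n. T n \<omega>"])
    then obtain l where "(\<lambda>N. T N \<omega> - T 0 \<omega>) \<longlonglongrightarrow> l"
      by (auto simp: convergent_def)
    from tendsto_add[OF this tendsto_const[of "T 0 \<omega>"]] show ?case by (auto simp: convergent_def)
  qed
  define I where "I \<omega> = lim (\<lambda>n. T n \<omega>)" for \<omega>
  have I [measurable]: "I \<in> borel_measurable M" unfolding I_def by measurable
  \<comment> \<open>Fatou's lemma along the sequence \<open>T\<close>. The estimate holds for every
    index in \<open>Q n\<close>, whether or not it was selected for \<open>T\<close>, and therefore
    yields convergence along the whole filter.\<close>
  have bound: "(\<integral>\<^sup>+\<omega>. ennreal ((norm (S j \<omega> - I \<omega>))\<^sup>2) \<partial>M) \<le> ennreal ((1 / 4) ^ n)" if j: "Q n j" for n j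
  proof -
    have sqj: "square_integrable M (S j)" using j by (simp add: Q_def)
    then have [measurable]: "S j \<in> borel_measurable M" by (rule square_integrable_measurable)
    have "AE \<omega> in M. ennreal ((norm (S j \<omega> - I \<omega>))\<^sup>2) = liminf (\<lambda>m. ennreal ((norm (S j \<omega> - T m \<omega>))\<^sup>2))"
      using conv
    proof eventually_elim
      case (elim \<omega>)
      then have "(\<lambda>m. T m \<omega>) \<longlonglongrightarrow> I \<omega>" unfolding I_def by (simp add: convergent_LIMSEQ_iff)
      then have "(\<lambda>m. ennreal ((norm (S j \<omega> - T m \<omega>))\<^sup>2)) \<longlonglongrightarrow> ennreal ((norm (S j \<omega> - I \<omega>))\<^sup>2)"
        by (intro tendsto_ennrealI tendsto_intros)
      from lim_imp_Liminf[OF _ this] show ?case by simp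
    qed
    then have "(\<integral>\<^sup>+\<omega>. ennreal ((norm (S j \<omega> - I \<omega>))\<^sup>2) \<partial>M) = (\<integral>\<^sup>+\<omega>. liminf (\<lambda>m. ennreal ((norm (S j \<omega> - T m \<omega>))\<^sup>2)) \<partial>M)"
      by (rule nn_integral_cong_AE)
    also have "\<dots> \<le> liminf (\<lambda>m. \<integral>\<^sup>+\<omega>. ennreal ((norm (S j \<omega> - T m \<omega>))\<^sup>2) \<partial>M)"
      by (intro nn_integral_liminf) measurable
    also have "\<dots> \<le> liminf (\<lambda>m. ennreal ((1 / 4) ^ n))"
    proof (rule Liminf_mono)
      show "\<forall>\<^sub>F m in sequentially. (\<integral>\<^sup>+\<omega>. ennreal ((norm (S j \<omega> - T m \<omega>))\<^sup>2) \<partial>M) \<le> ennreal ((1 / 4) ^ n)"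
        using eventually_ge_at_top[of n]
        by eventually_elim (simp add: nn_integral_norm_sq square_integrable_diff sqT sqj TC j)
    qed
    also have "\<dots> = ennreal ((1 / 4) ^ n)" by (simp add: Liminf_const)
    finally show ?thesis .
  qed
  have lim: "((\<lambda>i. \<integral>\<^sup>+\<omega>. ennreal ((norm (S i \<omega> - I \<omega>))\<^sup>2) \<partial>M) \<longlongrightarrow> 0) F"
  proof (rule order_tendstoI)
    fix e :: ennreal assume e: "0 < e"
    have "(\<lambda>n. ennreal ((1 / 4) ^ n)) \<longlonglongrightarrow> ennreal 0"
      by (intro tendsto_ennrealI LIMSEQ_realpow_zero) auto
    then have "\<forall>\<^sub>F n in sequentially. ennreal ((1 / 4) ^ n) < e"
      using e by (intro order_tendstoD(2)) auto
    then obtain n where n: "ennreal ((1 / 4) ^ n) < e" using eventually_happens' sequentially_bot by blast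
    show "\<forall>\<^sub>F i in F. (\<integral>\<^sup>+\<omega>. ennreal ((norm (S i \<omega> - I \<omega>))\<^sup>2) \<partial>M) < e"
      using Q[of n] by eventually_elim (rule le_less_trans[OF bound n])
  qed simp
  have "ms_tendsto M S I F"
    unfolding ms_tendsto_def using si
    by (auto intro!: lim elim: eventually_mono intro: square_integrable_measurable)
  moreover from ms_tendsto_square_integrable(1)[OF this F si] have "square_integrable M I" .
  ultimately show ?thesis by blast
qed

section \<open>Stochastic Riemann integrals\<close>

lemma eventually_riemann_filter:
  "eventually P (riemann_filter A B) \<longleftrightarrow>
    (\<exists>\<delta>>0. \<forall>p. p tagged_division_of {A..B} \<and> (\<lambda>x. ball x \<delta>) fine p \<longrightarrow> P p)"
proof -
  have "eventually P (riemann_filter A B) \<longleftrightarrow>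
    (\<exists>\<delta>\<in>{0<..}. eventually P (principal {p. p tagged_division_of {A..B} \<and> (\<lambda>x. ball x \<delta>) fine p}))"
    unfolding riemann_filter_def
  proof (rule eventually_INF_base)
    fix a b :: real assume "a \<in> {0<..}" "b \<in> {0<..}"
    then have "min a b \<in> {0<..}" by auto
    moreover have "(\<lambda>x. ball x (min a b)) fine p \<Longrightarrow> (\<lambda>x. ball x a) fine p \<and> (\<lambda>x. ball x b) fine p" for p
      unfolding fine_def by fastforce
    ultimately show "\<exists>x\<in>{0<..}. principal {p. p tagged_division_of {A..B} \<and> (\<lambda>y. ball y x) fine p}
       \<le> inf (principal {p. p tagged_division_of {A..B} \<and> (\<lambda>x. ball x a) fine p})
           (principal {p. p tagged_division_of {A..B} \<and> (\<lambda>x. ball x b) fine p})"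
      by (intro bexI[of _ "min a b"]) auto
  qed auto
  then show ?thesis by (auto simp: eventually_principal)
qed

lemma eventually_riemann_filter_tagged_division:
  "\<forall>\<^sub>F p in riemann_filter A B. p tagged_division_of {A..B}"
  unfolding eventually_riemann_filter by (intro exI[of _ 1]) auto

lemma riemann_filter_neq_bot: "riemann_filter A B \<noteq> bot"
proof -
  have "\<exists>p. p tagged_division_of {A..B} \<and> (\<lambda>x. ball x \<delta>) fine p" if "\<delta> > 0" for \<delta>
    by (rule fine_division_exists_real[OF gauge_ball[OF that], of A B]) blast
  then show ?thesis
    unfolding trivial_limit_def eventually_riemann_filter by blast
qed

text \<open>A division fine for both the gauge and a small constant radius is close to both values.
  Hence integrals evaluated by the gauge or Lebesgue theory identify limits of Riemann sums, with no
  separate proof of Riemann integrability.\<close>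

lemma has_integral_eq_riemann_limit:
  fixes f :: "real \<Rightarrow> real"
  assumes "(f has_integral y) {A..B}"
    and lim: "((\<lambda>p. \<Sum>(t, K)\<in>p. measure lborel K *\<^sub>R f t) \<longlongrightarrow> l) (riemann_filter A B)"
  shows "l = y"
proof (rule ccontr)
  assume "l \<noteq> y"
  then have e: "\<bar>l - y\<bar> / 2 > 0" by simp
  have "\<exists>\<gamma>. gauge \<gamma> \<and> (\<forall>p. p tagged_division_of {A..B} \<and> \<gamma> fine p \<longrightarrow>
      norm ((\<Sum>(t, K)\<in>p. measure lborel K *\<^sub>R f t) - y) < \<bar>l - y\<bar> / 2)"
    using assms(1)[unfolded has_integral_real, rule_format, OF e] .
  then obtain \<gamma> where \<gamma>: "gauge \<gamma>"
    and fi: "\<And>p. p tagged_division_of {A..B} \<Longrightarrow> \<gamma> fine p \<Longrightarrow>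
      norm ((\<Sum>(t, K)\<in>p. measure lborel K *\<^sub>R f t) - y) < \<bar>l - y\<bar> / 2" by meson
  have "\<forall>\<^sub>F p in riemann_filter A B. dist (\<Sum>(t, K)\<in>p. measure lborel K *\<^sub>R f t) l < \<bar>l - y\<bar> / 2"
    using tendstoD[OF lim e] .
  then obtain \<delta> where \<delta>: "\<delta> > 0"
    and ri: "\<And>p. p tagged_division_of {A..B} \<Longrightarrow> (\<lambda>x. ball x \<delta>) fine p \<Longrightarrow>
      dist (\<Sum>(t, K)\<in>p. measure lborel K *\<^sub>R f t) l < \<bar>l - y\<bar> / 2"
    unfolding eventually_riemann_filter by meson
  obtain p where p: "p tagged_division_of {A..B}" "(\<lambda>x. \<gamma> x \<inter> ball x \<delta>) fine p"
    using fine_division_exists_real[OF gauge_Int[OF \<gamma> gauge_ball[OF \<delta>]], of A B] .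
  then have f1: "\<gamma> fine p" and f2: "(\<lambda>x. ball x \<delta>) fine p" by (simp_all add: fine_Int)
  have "False" if "\<bar>z - y\<bar> < \<bar>l - y\<bar> / 2" "\<bar>z - l\<bar> < \<bar>l - y\<bar> / 2" for z :: real
  proof -
    have "\<bar>l - y\<bar> \<le> \<bar>z - y\<bar> + \<bar>z - l\<bar>" by arith
    also have "\<dots> < \<bar>l - y\<bar> / 2 + \<bar>l - y\<bar> / 2" by (intro add_strict_mono that)
    finally show False by simp
  qed
  then show False using fi[OF p(1) f1] ri[OF p(1) f2] unfolding real_norm_def dist_real_def .
qed

lemma tagged_division_of_realD:
  fixes A B :: real
  assumes "p tagged_division_of {A..B}" "(t, K) \<in> p"
  shows "\<exists>a b. K = {a..b}" "t \<in> K" "K \<subseteq> {A..B}" "t \<in> {A..B}"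
proof -
  show "\<exists>a b. K = {a..b}" "t \<in> K" "K \<subseteq> {A..B}"
    using tagged_division_ofD(2-4)[OF assms] by (auto simp: cbox_interval)
  then show "t \<in> {A..B}" by auto
qed

lemma tagged_division_of_real_memD:
  fixes A B :: real
  assumes "p tagged_division_of {A..B}" "x \<in> p"
  shows "\<exists>a b. snd x = {a..b}" "snd x \<subseteq> {A..B}" "fst x \<in> {A..B}"
  using tagged_division_of_realD[OF assms(1), of "fst x" "snd x"] assms(2) by auto

text \<open>The cells overlap only in negligible sets, so lengths add up. The window
  \<open>{c..d}\<close> allows the total length to be restricted to a cell of another division or to
  a neighbourhood of time 0.\<close>

lemma sum_measure_Int_tagged_division:
  fixes A B :: real
  assumes p: "p tagged_division_of {A..B}"
  shows "(\<Sum>x\<in>p. measure lborel (snd x \<inter> {c..d})) = measure lborel ({A..B} \<inter> {c..d})"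
proof -
  have K: "\<exists>a b. snd x = {a..b}" if "x \<in> p" for x
    using tagged_division_of_real_memD(1)[OF p, of x] that by simp
  have "measure lebesgue (\<Union>((\<lambda>x. snd x \<inter> {c..d}) ` p)) = (\<Sum>x\<in>p. measure lebesgue (snd x \<inter> {c..d}))"
  proof (rule measure_negligible_finite_Union_image)
    show "finite p" using p by (rule tagged_division_of_finite)
    show "snd x \<inter> {c..d} \<in> lmeasurable" if "x \<in> p" for x
      using K[OF that] by auto
    show "pairwise (\<lambda>x y. negligible (snd x \<inter> {c..d} \<inter> (snd y \<inter> {c..d}))) p"
    proof (rule pairwiseI)
      fix x y assume xy: "x \<in> p" "y \<in> p" "x \<noteq> y"
      obtain a b a' b' where ab: "snd x = {a..b}" "snd y = {a'..b'}" using K xy by metis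
      have "interior (snd x) \<inter> interior (snd y) = {}"
        using tagged_division_ofD(5)[OF p, of "fst x" "snd x" "fst y" "snd y"] xy by (simp add: prod_eq_iff)
      then have "box (max a a') (min b b') = {}" unfolding ab by (auto simp: box_real)
      then have "negligible (cbox (max a a') (min b b'))"
        using negligible_interval(1) by blast
      then show "negligible (snd x \<inter> {c..d} \<inter> (snd y \<inter> {c..d}))"
        by (rule negligible_subset) (auto simp: ab)
    qed
  qed
  moreover have "\<Union>((\<lambda>x. snd x \<inter> {c..d}) ` p) = {A..B} \<inter> {c..d}"
    using tagged_division_ofD(6)[OF p] by force
  moreover have "measure lebesgue (snd x \<inter> {c..d}) = measure lborel (snd x \<inter> {c..d})" if "x \<in> p" for x
    using K[OF that] by (auto simp: measure_completion)
  ultimately show ?thesis by (simp add: measure_completion)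
qed

text \<open>The intersections of cells of \<open>p\<close> and \<open>q\<close> form the common
  refinement. Two applications of the one-division statement measure the part of it inside the
  window.\<close>

lemma sum_measure_tagged_division_pair:
  fixes A B :: real
  assumes p: "p tagged_division_of {A..B}" and q: "q tagged_division_of {A..B}"
  shows "(\<Sum>x\<in>p. \<Sum>y\<in>q. measure lborel (snd x \<inter> snd y \<inter> {c..d})) = measure lborel ({A..B} \<inter> {c..d})"
proof -
  have "(\<Sum>y\<in>q. measure lborel (snd x \<inter> snd y \<inter> {c..d})) = measure lborel (snd x \<inter> {c..d})" if x: "x \<in> p" for x
  proof -
    obtain a b where ab: "snd x = {a..b}" using tagged_division_of_real_memD(1)[OF p, of x] x by auto
    have sub: "{a..b} \<subseteq> {A..B}" using tagged_division_of_real_memD(2)[OF p, of x] x ab by simp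
    have "(\<Sum>y\<in>q. measure lborel (snd x \<inter> snd y \<inter> {c..d})) = (\<Sum>y\<in>q. measure lborel (snd y \<inter> {max a c..min b d}))"
      unfolding ab by (intro sum.cong refl arg_cong[of _ _ "measure lborel"]) auto
    also have "\<dots> = measure lborel ({A..B} \<inter> {max a c..min b d})" by (rule sum_measure_Int_tagged_division[OF q])
    also have "{A..B} \<inter> {max a c..min b d} = snd x \<inter> {c..d}" using sub unfolding ab by auto
    finally show ?thesis .
  qed
  then show ?thesis by (simp add: sum_measure_Int_tagged_division[OF p])
qed

lemma measure_lborel_Icc_Int_le:
  fixes a b c d :: real
  assumes "c \<le> d"
  shows "measure lborel ({a..b} \<inter> {c..d}) \<le> d - c"
  using assms unfolding Int_atLeastAtMost by (auto simp: content_real_if)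

lemma norm_weighted_sum_sq_le:
  fixes v :: "'i \<Rightarrow> 'b::real_normed_vector"
  assumes "\<And>i. i \<in> I \<Longrightarrow> w i \<ge> 0"
  shows "(norm (\<Sum>i\<in>I. w i *\<^sub>R v i))\<^sup>2 \<le> (\<Sum>i\<in>I. w i) * (\<Sum>i\<in>I. w i * (norm (v i))\<^sup>2)"
proof -
  have "norm (\<Sum>i\<in>I. w i *\<^sub>R v i) \<le> (\<Sum>i\<in>I. norm (w i *\<^sub>R v i))" by (rule norm_sum)
  also have "\<dots> = (\<Sum>i\<in>I. sqrt (w i) * (sqrt (w i) * norm (v i)))"
    using assms by (intro sum.cong refl) (simp add: mult.assoc[symmetric])
  finally have "(norm (\<Sum>i\<in>I. w i *\<^sub>R v i))\<^sup>2 \<le> (\<Sum>i\<in>I. sqrt (w i) * (sqrt (w i) * norm (v i)))\<^sup>2"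
    by (intro power_mono) auto
  also have "\<dots> \<le> (\<Sum>i\<in>I. (sqrt (w i))\<^sup>2) * (\<Sum>i\<in>I. (sqrt (w i) * norm (v i))\<^sup>2)"
    by (rule Cauchy_Schwarz_ineq_sum)
  also have "\<dots> = (\<Sum>i\<in>I. w i) * (\<Sum>i\<in>I. w i * (norm (v i))\<^sup>2)"
    using assms by (intro arg_cong2[of _ _ _ _ "(*)"] sum.cong refl) (auto simp: power_mult_distrib)
  finally show ?thesis .
qed

section \<open>Riemann sums and existence of mean-square integrals\<close>

definition riemann_sum :: "(real \<Rightarrow> 'w \<Rightarrow> 'b::real_normed_vector) \<Rightarrow> (real \<times> real set) set \<Rightarrow> 'w \<Rightarrow> 'b"
  where "riemann_sum Z p \<omega> = (\<Sum>(t, K)\<in>p. measure lborel K *\<^sub>R Z t \<omega>)"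

lemma has_ms_integral_riemann_sum:
  "has_ms_integral M Z A B I \<longleftrightarrow> ms_tendsto M (riemann_sum Z) I (riemann_filter A B)"
  unfolding has_ms_integral_def riemann_sum_def ..

lemma square_integrable_riemann_sum:
  assumes "p tagged_division_of {A..B}" "\<And>t. t \<in> {A..B} \<Longrightarrow> square_integrable M (Z t)"
  shows "square_integrable M (riemann_sum Z p)"
  unfolding riemann_sum_def[abs_def] split_def
  using tagged_division_of_realD(4)[OF assms(1)]
  by (intro square_integrable_sum square_integrable_scaleR assms(2)) auto

lemma eventually_square_integrable_riemann_sum:
  assumes "\<And>t. t \<in> {A..B} \<Longrightarrow> square_integrable M (Z t)"
  shows "\<forall>\<^sub>F p in riemann_filter A B. square_integrable M (riemann_sum Z p)"
  using eventually_riemann_filter_tagged_division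
  by eventually_elim (rule square_integrable_riemann_sum[OF _ assms])

text \<open>Both sums are rewritten over the intersections of their cells, as if over a common
  refinement with two systems of tags. The weights then have total mass B - A, and the weighted
  Cauchy-Schwarz inequality applies.\<close>

lemma riemann_sum_diff_le:
  fixes Z :: "real \<Rightarrow> 'w \<Rightarrow> 'b::real_normed_vector"
  assumes p: "p tagged_division_of {A..B}" and q: "q tagged_division_of {A..B}" and AB: "A \<le> B"
  shows "(norm (riemann_sum Z p \<omega> - riemann_sum Z q \<omega>))\<^sup>2 \<le>
    (B - A) * (\<Sum>(x, y)\<in>p \<times> q. measure lborel (snd x \<inter> snd y) * (norm (Z (fst x) \<omega> - Z (fst y) \<omega>))\<^sup>2)"
proof -
  define w where "w z = measure lborel (snd (fst z) \<inter> snd (snd z))" for z :: "(real \<times> real set) \<times> (real \<times> real set)"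
  have fin: "finite p" "finite q" using p q by (auto intro: tagged_division_of_finite)
  have 1: "(\<Sum>y\<in>q. measure lborel (snd x \<inter> snd y)) = measure lborel (snd x)" if x: "x \<in> p"
    and p: "p tagged_division_of {A..B}" and q: "q tagged_division_of {A..B}" for x p q
  proof -
    obtain a b where ab: "snd x = {a..b}" using tagged_division_of_real_memD(1)[OF p, of x] x by blast
    have "{A..B} \<inter> {a..b} = {a..b}" using tagged_division_of_real_memD(2)[OF p, of x] x ab by auto
    moreover have "(\<Sum>y\<in>q. measure lborel (snd x \<inter> snd y)) = (\<Sum>y\<in>q. measure lborel (snd y \<inter> {a..b}))"
      unfolding ab by (intro sum.cong refl arg_cong[of _ _ "measure lborel"]) (rule Int_commute)
    ultimately show ?thesis unfolding sum_measure_Int_tagged_division[OF q] ab by (simp only:)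
  qed
  have "riemann_sum Z p \<omega> = (\<Sum>x\<in>p. \<Sum>y\<in>q. measure lborel (snd x \<inter> snd y) *\<^sub>R Z (fst x) \<omega>)"
    unfolding riemann_sum_def split_def scaleR_left.sum[symmetric]
    by (intro sum.cong refl) (simp add: 1[OF _ p q])
  moreover have "riemann_sum Z q \<omega> = (\<Sum>y\<in>q. \<Sum>x\<in>p. measure lborel (snd y \<inter> snd x) *\<^sub>R Z (fst y) \<omega>)"
    unfolding riemann_sum_def split_def scaleR_left.sum[symmetric]
    by (intro sum.cong refl) (simp add: 1[OF _ q p])
  then have "riemann_sum Z q \<omega> = (\<Sum>x\<in>p. \<Sum>y\<in>q. measure lborel (snd x \<inter> snd y) *\<^sub>R Z (fst y) \<omega>)"
    by (subst sum.swap) (simp add: Int_commute)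
  ultimately have "riemann_sum Z p \<omega> - riemann_sum Z q \<omega> = (\<Sum>z\<in>p \<times> q. w z *\<^sub>R (Z (fst (fst z)) \<omega> - Z (fst (snd z)) \<omega>))"
    by (simp add: sum_subtractf[symmetric] sum.cartesian_product w_def split_def scaleR_diff_right)
  then have "(norm (riemann_sum Z p \<omega> - riemann_sum Z q \<omega>))\<^sup>2 \<le>
      (\<Sum>z\<in>p \<times> q. w z) * (\<Sum>z\<in>p \<times> q. w z * (norm (Z (fst (fst z)) \<omega> - Z (fst (snd z)) \<omega>))\<^sup>2)"
    by (simp only:) (rule norm_weighted_sum_sq_le, simp add: w_def)
  also have "(\<Sum>z\<in>p \<times> q. w z) = (\<Sum>x\<in>p. \<Sum>y\<in>q. measure lborel (snd x \<inter> snd y))"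
    by (simp add: sum.cartesian_product w_def split_def)
  also have "\<dots> = (\<Sum>x\<in>p. measure lborel (snd x))" by (rule sum.cong[OF refl], erule 1[OF _ p q])
  also have "\<dots> = (\<Sum>x\<in>p. measure lborel (snd x \<inter> {A..B}))"
    using tagged_division_of_real_memD(2)[OF p]
    by (intro sum.cong refl arg_cong[of _ _ "measure lborel"]) (auto simp: Int_absorb2)
  also have "\<dots> = B - A" using AB by (simp add: sum_measure_Int_tagged_division[OF p])
  finally show ?thesis by (simp add: w_def split_def)
qed

text \<open>The side condition on signs allows the process a jump at time 0, as the attenuated processes have.\<close>

lemma has_ms_integral_exists:
  fixes Z :: "real \<Rightarrow> 'w \<Rightarrow> 'b::euclidean_space"
  assumes AB: "A \<le> B" and Z: "\<And>t. t \<in> {A..B} \<Longrightarrow> square_integrable M (Z t)"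
    and C: "\<And>s t. s \<in> {A..B} \<Longrightarrow> t \<in> {A..B} \<Longrightarrow> (\<integral>\<omega>. (norm (Z s \<omega> - Z t \<omega>))\<^sup>2 \<partial>M) \<le> C"
    and cont: "\<And>e. e > 0 \<Longrightarrow> \<exists>\<delta>>0. \<forall>s\<in>{A..B}. \<forall>t\<in>{A..B}. \<bar>s - t\<bar> < \<delta> \<longrightarrow> (s < 0 \<longleftrightarrow> t < 0) \<longrightarrow>
      (\<integral>\<omega>. (norm (Z s \<omega> - Z t \<omega>))\<^sup>2 \<partial>M) \<le> e"
  shows "\<exists>I. square_integrable M I \<and> has_ms_integral M Z A B I"
  unfolding has_ms_integral_riemann_sum
proof (rule ms_Cauchy_imp_ms_tendsto[OF riemann_filter_neq_bot eventually_square_integrable_riemann_sum[OF Z]])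
  fix e :: real assume e: "e > 0"
  have C0: "C \<ge> 0" using C[of A A] AB by auto
  define e1 where "e1 = e / (2 * ((B - A)\<^sup>2 + 1))"
  have e1: "e1 > 0" unfolding e1_def using e by (intro divide_pos_pos) (auto intro: add_nonneg_pos)
  obtain \<delta>0 where \<delta>0: "\<delta>0 > 0" and d: "\<And>s t. s \<in> {A..B} \<Longrightarrow> t \<in> {A..B} \<Longrightarrow> \<bar>s - t\<bar> < \<delta>0 \<Longrightarrow> (s < 0 \<longleftrightarrow> t < 0) \<Longrightarrow>
      (\<integral>\<omega>. (norm (Z s \<omega> - Z t \<omega>))\<^sup>2 \<partial>M) \<le> e1" using cont[OF e1] by metis
  \<comment> \<open>Tags of overlapping cells are within 2 \<delta> of each other, hence
    \<delta>0/2. The second entry pays for pairs of tags on different sides of 0: the overlaps of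
    their cells have total length at most 2 \<delta>, and each pair costs at most \<open>C\<close>
    per unit length.\<close>
  define \<delta> where "\<delta> = min (\<delta>0 / 2) (e / (4 * (B - A + 1) * (C + 1)))"
  have \<delta>: "\<delta> > 0" unfolding \<delta>_def using \<delta>0 e AB C0 by (simp add: add_nonneg_pos)
  have \<delta>2: "2 * \<delta> \<le> \<delta>0" unfolding \<delta>_def by simp
  have \<delta>3: "(B - A) * (C * (2 * \<delta>)) \<le> e / 2"
  proof -
    have "\<delta> \<le> e / (4 * (B - A + 1) * (C + 1))" by (simp add: \<delta>_def)
    moreover have XY: "X * Y * (e / (4 * X * Y)) = e / 4" if "X > 0" "Y > 0" for X Y :: real using that by simp
    ultimately have "(B - A + 1) * (C + 1) * \<delta> \<le> (B - A + 1) * (C + 1) * (e / (4 * (B - A + 1) * (C + 1)))"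
      using AB C0 by (intro mult_left_mono) auto
    also have "\<dots> = e / 4" by (rule XY) (use AB C0 in auto)
    finally have *: "(B - A + 1) * (C + 1) * \<delta> \<le> e / 4" .
    have "(B - A) * C \<le> (B - A + 1) * (C + 1)" using AB C0 by (intro mult_mono) auto
    then have "(B - A) * C * \<delta> \<le> (B - A + 1) * (C + 1) * \<delta>" using \<delta> by (intro mult_right_mono) auto
    then show ?thesis using * by simp
  qed
  define P where "P p \<longleftrightarrow> p tagged_division_of {A..B} \<and> (\<lambda>x. ball x \<delta>) fine p" for p
  have "eventually P (riemann_filter A B)"
    unfolding eventually_riemann_filter P_def using \<delta> by blast
  moreover have "(\<integral>\<omega>. (norm (riemann_sum Z p \<omega> - riemann_sum Z q \<omega>))\<^sup>2 \<partial>M) \<le> e" if "P p" "P q" for p q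
  proof -
    have p: "p tagged_division_of {A..B}" "(\<lambda>x. ball x \<delta>) fine p"
      and q: "q tagged_division_of {A..B}" "(\<lambda>x. ball x \<delta>) fine q" using that by (auto simp: P_def)
    define \<phi> where "\<phi> s t = (\<integral>\<omega>. (norm (Z s \<omega> - Z t \<omega>))\<^sup>2 \<partial>M)" for s t
    define w where "w z = measure lborel (snd (fst z) \<inter> snd (snd z))" for z :: "(real \<times> real set) \<times> (real \<times> real set)"
    define v where "v z = measure lborel (snd (fst z) \<inter> snd (snd z) \<inter> {-\<delta>..\<delta>})" for z :: "(real \<times> real set) \<times> (real \<times> real set)"
    have w\<phi>: "w z * \<phi> (fst (fst z)) (fst (snd z)) \<le> e1 * w z + C * v z" if z: "z \<in> p \<times> q" for z
    proof -
      obtain s K t L where zz: "z = ((s, K), (t, L))" by (metis prod.exhaust)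
      have K: "(s, K) \<in> p" and L: "(t, L) \<in> q" using z zz by auto
      note Kp = tagged_division_of_realD[OF p(1) K] and Lp = tagged_division_of_realD[OF q(1) L]
      have w0: "w z \<ge> 0" "v z \<ge> 0" by (auto simp: w_def v_def)
      have Kb: "K \<subseteq> ball s \<delta>" and Lb: "L \<subseteq> ball t \<delta>" using p(2) q(2) K L by (auto dest: fineD)
      show ?thesis
      proof (cases "K \<inter> L = {}")
        case True
        then show ?thesis using w0 e1 C0 by (simp add: zz w_def v_def)
      next
        case False
        then obtain u where "u \<in> K" "u \<in> L" by auto
        then have "\<bar>s - u\<bar> < \<delta>" "\<bar>t - u\<bar> < \<delta>" using Kb Lb by (auto simp: dist_real_def)
        then have st: "\<bar>s - t\<bar> < \<delta>0" using \<delta>2 by linarith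
        show ?thesis
        proof (cases "s < 0 \<longleftrightarrow> t < 0")
          case True
          have "\<phi> s t \<le> e1" unfolding \<phi>_def by (rule d[OF Kp(4) Lp(4) st True])
          then have "w z * \<phi> s t \<le> w z * e1" by (intro mult_left_mono w0)
          moreover have "C * v z \<ge> 0" using C0 w0 by simp
          ultimately show ?thesis by (simp add: zz mult.commute)
        next
          case False
          \<comment> \<open>A point within \<delta> of both a negative and a nonnegative tag is
            itself within \<delta> of 0.\<close>
          have "K \<inter> L \<subseteq> {-\<delta>..\<delta>}"
          proof
            fix u assume "u \<in> K \<inter> L"
            then have "\<bar>s - u\<bar> < \<delta>" "\<bar>t - u\<bar> < \<delta>" using Kb Lb by (auto simp: dist_real_def)
            then show "u \<in> {-\<delta>..\<delta>}" using False by auto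
          qed
          then have "w z = v z" unfolding w_def v_def zz by (simp add: Int_absorb2)
          moreover have "w z * \<phi> s t \<le> w z * C" unfolding \<phi>_def by (intro mult_left_mono C Kp(4) Lp(4) w0)
          moreover have "e1 * w z \<ge> 0" using e1 w0 by simp
          ultimately show ?thesis by (simp add: zz mult.commute)
        qed
      qed
    qed
    have sq: "square_integrable M (riemann_sum Z p)" "square_integrable M (riemann_sum Z q)"
      by (rule square_integrable_riemann_sum[OF _ Z], fact p(1) q(1), assumption)+
    have Zst: "square_integrable M (\<lambda>\<omega>. Z (fst (fst z)) \<omega> - Z (fst (snd z)) \<omega>)" if "z \<in> p \<times> q" for z
      using tagged_division_of_real_memD(3)[OF p(1), of "fst z"]
        tagged_division_of_real_memD(3)[OF q(1), of "snd z"] that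
      by (intro square_integrable_diff Z) auto
    have int: "integrable M (\<lambda>\<omega>. w z * (norm (Z (fst (fst z)) \<omega> - Z (fst (snd z)) \<omega>))\<^sup>2)" if "z \<in> p \<times> q" for z
      by (intro integrable_mult_right square_integrable_integrable_norm Zst that)
    have "(\<integral>\<omega>. (norm (riemann_sum Z p \<omega> - riemann_sum Z q \<omega>))\<^sup>2 \<partial>M) \<le>
        (\<integral>\<omega>. (B - A) * (\<Sum>z\<in>p \<times> q. w z * (norm (Z (fst (fst z)) \<omega> - Z (fst (snd z)) \<omega>))\<^sup>2) \<partial>M)"
    proof (rule integral_mono)
      show "integrable M (\<lambda>\<omega>. (norm (riemann_sum Z p \<omega> - riemann_sum Z q \<omega>))\<^sup>2)"
        by (intro square_integrable_integrable_norm square_integrable_diff sq)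
      show "integrable M (\<lambda>\<omega>. (B - A) * (\<Sum>z\<in>p \<times> q. w z * (norm (Z (fst (fst z)) \<omega> - Z (fst (snd z)) \<omega>))\<^sup>2))"
        by (intro integrable_mult_right Bochner_Integration.integrable_sum int)
      show "(norm (riemann_sum Z p \<omega> - riemann_sum Z q \<omega>))\<^sup>2 \<le>
          (B - A) * (\<Sum>z\<in>p \<times> q. w z * (norm (Z (fst (fst z)) \<omega> - Z (fst (snd z)) \<omega>))\<^sup>2)" for \<omega>
        using riemann_sum_diff_le[OF p(1) q(1) AB, of Z \<omega>] by (simp add: w_def split_def)
    qed
    also have "\<dots> = (B - A) * (\<Sum>z\<in>p \<times> q. \<integral>\<omega>. w z * (norm (Z (fst (fst z)) \<omega> - Z (fst (snd z)) \<omega>))\<^sup>2 \<partial>M)"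
      by (simp only: integral_mult_right_zero Bochner_Integration.integral_sum[OF int])
    also have "\<dots> = (B - A) * (\<Sum>z\<in>p \<times> q. w z * \<phi> (fst (fst z)) (fst (snd z)))"
      by (simp add: \<phi>_def)
    also have "\<dots> \<le> (B - A) * (\<Sum>z\<in>p \<times> q. e1 * w z + C * v z)"
      using AB by (intro mult_left_mono sum_mono w\<phi>) auto
    also have "\<dots> = (B - A) * (e1 * (\<Sum>z\<in>p \<times> q. w z) + C * (\<Sum>z\<in>p \<times> q. v z))"
      by (simp add: sum.distrib sum_distrib_left)
    also have "\<dots> \<le> (B - A) * (e1 * (B - A) + C * (2 * \<delta>))"
    proof (intro mult_left_mono add_mono)
      have "(\<Sum>z\<in>p \<times> q. w z) = (\<Sum>x\<in>p. \<Sum>y\<in>q. measure lborel (snd x \<inter> snd y \<inter> {A..B}))"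
        unfolding sum.cartesian_product
      proof (intro sum.cong refl)
        fix z assume "z \<in> p \<times> q"
        then have "snd (fst z) \<subseteq> {A..B}"
          by (intro tagged_division_of_real_memD(2)[OF p(1)]) (simp add: mem_Times_iff)
        then have "snd (fst z) \<inter> snd (snd z) \<inter> {A..B} = snd (fst z) \<inter> snd (snd z)" by blast
        then show "w z = (case z of (x, y) \<Rightarrow> measure lborel (snd x \<inter> snd y \<inter> {A..B}))"
          by (simp add: w_def split_def)
      qed
      then show "(\<Sum>z\<in>p \<times> q. w z) \<le> B - A"
        using AB by (simp add: sum_measure_tagged_division_pair[OF p(1) q(1)])
      have "(\<Sum>z\<in>p \<times> q. v z) = (\<Sum>x\<in>p. \<Sum>y\<in>q. measure lborel (snd x \<inter> snd y \<inter> {-\<delta>..\<delta>}))"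
        unfolding sum.cartesian_product by (intro sum.cong refl) (auto simp: v_def)
      then show "(\<Sum>z\<in>p \<times> q. v z) \<le> 2 * \<delta>"
        using measure_lborel_Icc_Int_le[of "-\<delta>" \<delta> A B] \<delta>
        by (simp add: sum_measure_tagged_division_pair[OF p(1) q(1)])
    qed (use AB C0 e1 in auto)
    also have "\<dots> = e1 * (B - A)\<^sup>2 + (B - A) * (C * (2 * \<delta>))"
      by (simp add: power2_eq_square algebra_simps)
    also have "\<dots> \<le> e / 2 + e / 2"
    proof (intro add_mono \<delta>3)
      have "(B - A)\<^sup>2 + 1 > 0" by (intro add_nonneg_pos) auto
      then have "e1 * ((B - A)\<^sup>2 + 1) = e / 2"
        unfolding e1_def by (metis less_numeral_extra(3) mult.commute nonzero_mult_divide_mult_cancel_left times_divide_eq_right)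
      moreover have "e1 * (B - A)\<^sup>2 \<le> e1 * ((B - A)\<^sup>2 + 1)" using e1 by (intro mult_left_mono) auto
      ultimately show "e1 * (B - A)\<^sup>2 \<le> e / 2" by simp
    qed
    finally show ?thesis by simp
  qed
  ultimately show "\<exists>P. eventually P (riemann_filter A B) \<and>
      (\<forall>p q. P p \<longrightarrow> P q \<longrightarrow> square_integrable M (riemann_sum Z p) \<longrightarrow> square_integrable M (riemann_sum Z q) \<longrightarrow>
         (\<integral>\<omega>. (norm (riemann_sum Z p \<omega> - riemann_sum Z q \<omega>))\<^sup>2 \<partial>M) \<le> e)" by blast
qed

lemma has_ms_integral_square_integrable:
  fixes Z :: "real \<Rightarrow> 'w \<Rightarrow> 'b::euclidean_space"
  assumes "has_ms_integral M Z A B I" "\<And>t. t \<in> {A..B} \<Longrightarrow> square_integrable M (Z t)"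
  shows "square_integrable M I"
  using assms(1) unfolding has_ms_integral_riemann_sum
  by (rule ms_tendsto_square_integrable(1)[OF _ riemann_filter_neq_bot eventually_square_integrable_riemann_sum[OF assms(2)]])

text \<open>The substitute for Fubini: along Riemann sums the expectation is a finite sum, and its
  limit is recognised as the given gauge integral. Taking for \<open>V\<close> another value or
  integral of the process yields covariances, and the constant 1 yields expectations.\<close>

lemma has_ms_integral_inner:
  fixes Z :: "real \<Rightarrow> 'w \<Rightarrow> 'b::euclidean_space"
  assumes "has_ms_integral M Z A B I" and Z: "\<And>t. t \<in> {A..B} \<Longrightarrow> square_integrable M (Z t)"
    and V: "square_integrable M V"
    and y: "((\<lambda>t. \<integral>\<omega>. Z t \<omega> \<bullet> V \<omega> \<partial>M) has_integral y) {A..B}"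
  shows "(\<integral>\<omega>. I \<omega> \<bullet> V \<omega> \<partial>M) = y"
proof (rule has_integral_eq_riemann_limit[OF y])
  have "((\<lambda>p. \<integral>\<omega>. riemann_sum Z p \<omega> \<bullet> V \<omega> \<partial>M) \<longlongrightarrow> (\<integral>\<omega>. I \<omega> \<bullet> V \<omega> \<partial>M)) (riemann_filter A B)"
    using assms(1) unfolding has_ms_integral_riemann_sum
    by (rule ms_tendsto_integral_inner[OF _ riemann_filter_neq_bot eventually_square_integrable_riemann_sum[OF Z] V])
  moreover have "\<forall>\<^sub>F p in riemann_filter A B. (\<integral>\<omega>. riemann_sum Z p \<omega> \<bullet> V \<omega> \<partial>M) =
      (\<Sum>(t, K)\<in>p. measure lborel K *\<^sub>R (\<integral>\<omega>. Z t \<omega> \<bullet> V \<omega> \<partial>M))"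
    using eventually_riemann_filter_tagged_division
  proof eventually_elim
    case (elim p)
    have "(\<integral>\<omega>. riemann_sum Z p \<omega> \<bullet> V \<omega> \<partial>M) = (\<integral>\<omega>. (\<Sum>x\<in>p. measure lborel (snd x) * (Z (fst x) \<omega> \<bullet> V \<omega>)) \<partial>M)"
      unfolding riemann_sum_def split_def by (simp add: inner_sum_left)
    also have "\<dots> = (\<Sum>x\<in>p. \<integral>\<omega>. measure lborel (snd x) * (Z (fst x) \<omega> \<bullet> V \<omega>) \<partial>M)"
    proof (rule Bochner_Integration.integral_sum)
      fix x assume "x \<in> p"
      then have "fst x \<in> {A..B}" using tagged_division_of_real_memD(3)[OF elim, of x] by simp
      then show "integrable M (\<lambda>\<omega>. measure lborel (snd x) * (Z (fst x) \<omega> \<bullet> V \<omega>))"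
        by (intro integrable_mult_right integrable_inner Z V)
    qed
    finally show ?case by (simp add: split_def)
  qed
  ultimately show "((\<lambda>p. \<Sum>(t, K)\<in>p. measure lborel K *\<^sub>R (\<integral>\<omega>. Z t \<omega> \<bullet> V \<omega> \<partial>M)) \<longlongrightarrow> (\<integral>\<omega>. I \<omega> \<bullet> V \<omega> \<partial>M)) (riemann_filter A B)"
    by (simp add: tendsto_cong)
qed

section \<open>Gaussian processes\<close>

context prob_space
begin

lemma gaussian_rv_square_integrable:
  assumes "gaussian_rv M P"
  shows "square_integrable M P"
  using assms unfolding gaussian_rv_def
proof (elim disjE exE conjE)
  fix m \<sigma> :: real
  assume s: "\<sigma> > 0" and d: "distributed M lborel P (normal_density m \<sigma>)"
  have [measurable]: "P \<in> borel_measurable M" using distributed_measurable[OF d] by simp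
  have "integrable lborel (\<lambda>x. normal_density m \<sigma> x * (x - m)\<^sup>2)"
    using s by (rule integrable_normal_moment)
  moreover have "integrable lborel (\<lambda>x. normal_density m \<sigma> x * x)"
    using s by (rule integrable_normal_moment_nz_1)
  moreover have "integrable lborel (normal_density m \<sigma>)"
    using s by (rule integrable_normal_density)
  ultimately have "integrable lborel (\<lambda>x. normal_density m \<sigma> x * (x - m)\<^sup>2
      + 2 * m * (normal_density m \<sigma> x * x) - m\<^sup>2 * normal_density m \<sigma> x)"
    by (intro Bochner_Integration.integrable_add Bochner_Integration.integrable_diff integrable_mult_right) auto
  also have "(\<lambda>x. normal_density m \<sigma> x * (x - m)\<^sup>2
      + 2 * m * (normal_density m \<sigma> x * x) - m\<^sup>2 * normal_density m \<sigma> x) = (\<lambda>x. normal_density m \<sigma> x * x\<^sup>2)"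
    by (simp add: fun_eq_iff power2_eq_square algebra_simps)
  finally have "integrable M (\<lambda>\<omega>. (P \<omega>)\<^sup>2)"
    by (subst (asm) distributed_integrable[OF d]) auto
  then show ?thesis by (simp add: square_integrable_def)
next
  fix m assume [measurable]: "P \<in> borel_measurable M" and "AE \<omega> in M. P \<omega> = m"
  then have "integrable M (\<lambda>\<omega>. (P \<omega>)\<^sup>2)"
    by (intro integrable_const_bound[of _ "m\<^sup>2"]) auto
  then show ?thesis by (simp add: square_integrable_def)
qed

text \<open>In the nondegenerate case rescaling by \<sigma> reduces to the standard normal law. In
  the degenerate case zero mean forces the constant 0, and both sides are 1.\<close>

lemma gaussian_rv_char:
  assumes "gaussian_rv M P" and E: "expectation P = 0"
  shows "(\<integral>\<omega>. iexp (P \<omega>) \<partial>M) = exp (- (\<integral>\<omega>. (P \<omega>)\<^sup>2 \<partial>M) / 2)"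
  using assms(1) unfolding gaussian_rv_def
proof (elim disjE exE conjE)
  fix m \<sigma> :: real
  assume s: "\<sigma> > 0" and d: "distributed M lborel P (normal_density m \<sigma>)"
  have [measurable]: "P \<in> borel_measurable M" using distributed_measurable[OF d] by simp
  have m: "m = 0" using normal_distributed_expectation[OF s d] E by simp
  have v: "(\<integral>\<omega>. (P \<omega>)\<^sup>2 \<partial>M) = \<sigma>\<^sup>2" using normal_distributed_variance[OF s d] E by simp
  have "distributed M lborel (\<lambda>\<omega>. P \<omega> / \<sigma>) std_normal_density"
    using d unfolding normal_standard_normal_convert[OF s] m by simp
  then have D: "distr M lborel (\<lambda>\<omega>. P \<omega> / \<sigma>) = std_normal_distribution"
    by (simp add: distributed_distr_eq_density)
  have "(\<integral>\<omega>. iexp (P \<omega>) \<partial>M) = (\<integral>\<omega>. iexp (\<sigma> * (P \<omega> / \<sigma>)) \<partial>M)" using s by simp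
  also have "\<dots> = (\<integral>x. iexp (\<sigma> * x) \<partial>distr M lborel (\<lambda>\<omega>. P \<omega> / \<sigma>))"
    by (subst integral_distr) auto
  also have "\<dots> = char std_normal_distribution \<sigma>" unfolding D char_def ..
  also have "\<dots> = exp (- (\<integral>\<omega>. (P \<omega>)\<^sup>2 \<partial>M) / 2)"
    unfolding char_std_normal_distribution v by (simp add: exp_of_real)
  finally show ?thesis .
next
  fix m assume [measurable]: "P \<in> borel_measurable M" and ae: "AE \<omega> in M. P \<omega> = m"
  have "expectation P = expectation (\<lambda>_. m)" using ae by (intro integral_cong_AE) auto
  then have "m = 0" using E by (simp add: prob_space)
  with ae have ae: "AE \<omega> in M. P \<omega> = 0" by simp
  have "(\<integral>\<omega>. iexp (P \<omega>) \<partial>M) = (\<integral>\<omega>. 1 \<partial>M)" using ae by (intro integral_cong_AE) auto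
  moreover have "(\<integral>\<omega>. (P \<omega>)\<^sup>2 \<partial>M) = (\<integral>\<omega>. 0 \<partial>M)" using ae by (intro integral_cong_AE) auto
  ultimately show ?thesis by (simp add: prob_space)
qed

lemma gaussian_process_rv:
  assumes "gaussian_process M Z"
  shows "gaussian_rv M (Z t)"
proof -
  have "gaussian_rv M (\<lambda>\<omega>. \<Sum>t\<in>{t}. 1 * Z t \<omega>)"
    using assms[unfolded gaussian_process_def, rule_format, of "{t}" "\<lambda>_. 1"] by simp
  then show ?thesis by simp
qed

text \<open>Tags of a division may repeat, whereas the definition of a Gaussian process sums over a
  set of times; weights belonging to the same time are therefore collected first.\<close>

lemma gaussian_process_sum:
  assumes "gaussian_process M Z" "finite p"
  shows "gaussian_rv M (\<lambda>\<omega>. \<Sum>x\<in>p. w x * Z (\<tau> x) \<omega>)"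
proof -
  have "(\<Sum>x\<in>p. w x * Z (\<tau> x) \<omega>) = (\<Sum>t\<in>\<tau> ` p. (\<Sum>x\<in>{x\<in>p. \<tau> x = t}. w x) * Z t \<omega>)" for \<omega>
    unfolding sum.image_gen[OF assms(2), of _ \<tau>] sum_distrib_right by (intro sum.cong refl) auto
  moreover have "gaussian_rv M (\<lambda>\<omega>. \<Sum>t\<in>\<tau> ` p. (\<Sum>x\<in>{x\<in>p. \<tau> x = t}. w x) * Z t \<omega>)"
    using assms(1)[unfolded gaussian_process_def, rule_format, of "\<tau> ` p"] assms(2) by simp
  ultimately show ?thesis by simp
qed

end

section \<open>The channel\<close>

lemma has_bochner_integral_exp_Ici:
  fixes l :: real
  assumes l: "l > 0"
  shows "has_bochner_integral lborel (\<lambda>t. exp (- l * t) * indicator {0..} t) (1 / l)"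
proof (rule has_bochner_integral_nn_integral)
  have "(\<integral>\<^sup>+t. ennreal (exp (- l * t) * indicator {0..} t) \<partial>lborel) = (\<integral>\<^sup>+t. ennreal (exp (- l * t)) * indicator {0..} t \<partial>lborel)"
    by (intro nn_integral_cong) (auto simp: indicator_def)
  also have "\<dots> = ennreal (0 - (- exp (- l * 0) / l))"
  proof (rule nn_integral_FTC_atLeast)
    show "((\<lambda>t. - exp (- l * t) / l) has_real_derivative exp (- l * t)) (at t)" for t
      using l by (auto intro!: derivative_eq_intros)
    have "((\<lambda>t. - exp (- l * t) / l) \<longlongrightarrow> - 0 / l) at_top"
      using l by (intro tendsto_intros filterlim_compose[OF exp_at_bot]
         filterlim_tendsto_neg_mult_at_bot[OF tendsto_const] filterlim_ident) auto
    then show "((\<lambda>t. - exp (- l * t) / l) \<longlongrightarrow> 0) at_top" by simp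
  qed auto
  finally show "(\<integral>\<^sup>+t. ennreal (exp (- l * t) * indicator {0..} t) \<partial>lborel) = ennreal (1 / l)" by simp
qed (use l in auto)

locale OU_channel = prob_space M for M :: "'w measure" +
  fixes a b c :: real and X Y :: "real \<Rightarrow> 'w \<Rightarrow> real"
  assumes abc: "a > 0" "b > 0" "c > 0"
    and OU: "attenuated_OU_process M a b c X" "attenuated_OU_process M a b c Y"
    and indep: "indep_var (PiM UNIV (\<lambda>_. borel)) (\<lambda>\<omega> t. X t \<omega>) (PiM UNIV (\<lambda>_. borel)) (\<lambda>\<omega> t. Y t \<omega>)"
begin

abbreviation R :: "real \<Rightarrow> real \<Rightarrow> real" where "R \<equiv> attenuated_OU_cov a b c"

definition H :: "real \<Rightarrow> 'w \<Rightarrow> complex"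
  where "H t \<omega> = complex_of_real (X t \<omega>) + \<i> * complex_of_real (Y t \<omega>)"

lemma gaussian: "gaussian_process M X" "gaussian_process M Y"
  using OU by (auto simp: attenuated_OU_process_def)

lemma sq_XY: "square_integrable M (X t)" "square_integrable M (Y t)"
  by (intro gaussian_rv_square_integrable gaussian_process_rv gaussian)+

lemma meas_XY [measurable]: "X t \<in> borel_measurable M" "Y t \<in> borel_measurable M"
  using sq_XY by (auto intro: square_integrable_measurable)

lemma expectation_XY: "expectation (X t) = 0" "expectation (Y t) = 0"
  using OU by (auto simp: attenuated_OU_process_def)

lemma cov_XY: "expectation (\<lambda>\<omega>. X s \<omega> * X t \<omega>) = R s t" "expectation (\<lambda>\<omega>. Y s \<omega> * Y t \<omega>) = R s t"
  using OU by (auto simp: attenuated_OU_process_def)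

lemma integrable_products:
  "integrable M (\<lambda>\<omega>. X s \<omega> * X t \<omega>)" "integrable M (\<lambda>\<omega>. Y s \<omega> * Y t \<omega>)" "integrable M (\<lambda>\<omega>. X s \<omega> * Y t \<omega>)"
  using integrable_inner[OF sq_XY(1) sq_XY(1), of s t] integrable_inner[OF sq_XY(2) sq_XY(2), of s t]
    integrable_inner[OF sq_XY(1) sq_XY(2), of s t] by simp_all

lemma integrable_XY: "integrable M (X t)" "integrable M (Y t)"
  using integrable_inner[OF sq_XY(1), of "\<lambda>_. 1"] integrable_inner[OF sq_XY(2), of "\<lambda>_. 1"]
  by (simp_all add: square_integrable_def)

lemma indep_sums:
  assumes "finite p"
  shows "indep_var borel (\<lambda>\<omega>. \<Sum>x\<in>p. w x * X (\<tau> x) \<omega>) borel (\<lambda>\<omega>. \<Sum>x\<in>p. v x * Y (\<tau> x) \<omega>)"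
proof -
  have m: "(\<lambda>path. \<Sum>x\<in>p. w x * path (\<tau> x)) \<in> borel_measurable (PiM UNIV (\<lambda>_. borel))" for w :: "'a \<Rightarrow> real"
    by (intro borel_measurable_sum borel_measurable_times borel_measurable_const measurable_component_singleton) auto
  show ?thesis using indep_var_compose[OF indep m[of w] m[of v]] by (simp add: comp_def)
qed

lemma expectation_X_Y: "expectation (\<lambda>\<omega>. X s \<omega> * Y t \<omega>) = 0"
proof -
  have m: "(\<lambda>path. path t) \<in> borel_measurable (PiM UNIV (\<lambda>_. borel))" for t :: real
    by (intro measurable_component_singleton) auto
  have "indep_var borel (X s) borel (Y t)"
    using indep_var_compose[OF indep m[of s] m[of t]] by (simp add: comp_def)
  from indep_var_lebesgue_integral[OF this integrable_XY] show ?thesis by (simp add: expectation_XY)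
qed

lemma meas_H [measurable]: "H t \<in> borel_measurable M"
  unfolding H_def[abs_def] by measurable

lemma sq_H: "square_integrable M (\<lambda>\<omega>. k * H t \<omega>)"
proof -
  have "integrable M (\<lambda>\<omega>. (cmod k)\<^sup>2 * (X t \<omega> * X t \<omega> + Y t \<omega> * Y t \<omega>))"
    by (intro integrable_mult_right Bochner_Integration.integrable_add integrable_products)
  moreover have "(norm (k * H t \<omega>))\<^sup>2 = (cmod k)\<^sup>2 * (X t \<omega> * X t \<omega> + Y t \<omega> * Y t \<omega>)" for \<omega>
    unfolding norm_mult power_mult_distrib cmod_power2[of "H t \<omega>"] by (simp add: H_def power2_eq_square)
  ultimately show ?thesis by (simp add: square_integrable_def)
qed

text \<open>The covariance of the process k H for the real inner product of the plane. The factor 2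
  arises because the real and imaginary parts of H each contribute \<open>R\<close>, while their
  cross terms vanish.\<close>

definition \<rho> :: "(real \<Rightarrow> complex) \<Rightarrow> real \<Rightarrow> real \<Rightarrow> real"
  where "\<rho> k s t = 2 * (k s \<bullet> k t) * R s t"

lemma expectation_inner_H:
  "expectation (\<lambda>\<omega>. (k s * H s \<omega>) \<bullet> (k t * H t \<omega>)) = \<rho> k s t"
proof -
  define z where "z = k s * cnj (k t)"
  have z: "Re z = k s \<bullet> k t" by (simp add: z_def inner_complex_def)
  have "(k s * H s \<omega>) \<bullet> (k t * H t \<omega>) =
     Re z * (X s \<omega> * X t \<omega>) + Re z * (Y s \<omega> * Y t \<omega>) + (Im z * (X s \<omega> * Y t \<omega>) - Im z * (X t \<omega> * Y s \<omega>))" for \<omega>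
    unfolding z_def H_def inner_complex_def by (simp add: algebra_simps)
  then have "expectation (\<lambda>\<omega>. (k s * H s \<omega>) \<bullet> (k t * H t \<omega>)) =
     Re z * R s t + Re z * R s t + (Im z * 0 - Im z * 0)"
    by (simp add: integrable_products cov_XY expectation_X_Y)
  then show ?thesis by (simp add: \<rho>_def z)
qed

lemma R_sym: "R s t = R t s"
  by (simp add: attenuated_OU_cov_def abs_minus_commute add.commute mult_ac)

lemma \<rho>_sym: "\<rho> k s t = \<rho> k t s"
  unfolding \<rho>_def R_sym[of s t] inner_commute[of "k s"] ..

text \<open>The attenuation profile of the channel without its constant sqrt(b c).\<close>

definition h :: "real \<Rightarrow> real" where "h t = exp (- b * t) * indicator {0..} t"

lemma h_nonneg: "h t \<ge> 0" by (simp add: h_def)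

lemma h_measurable [measurable]: "h \<in> borel_measurable borel" unfolding h_def[abs_def] by measurable

lemma R_eq: "R s t = b * c * h s * h t * exp (- a * \<bar>s - t\<bar>)"
  by (simp add: attenuated_OU_cov_def h_def exp_add[symmetric] algebra_simps)

text \<open>Dropping the Ornstein-Uhlenbeck factor, which is at most 1, leaves a product of
  functions of s and of t. All double integrals are dominated by such products.\<close>

lemma R_le: "\<bar>R s t\<bar> \<le> b * c * h s * h t"
proof -
  have "exp (- a * \<bar>s - t\<bar>) \<le> 1" using abc by simp
  then have "(b * c * h s * h t) * exp (- a * \<bar>s - t\<bar>) \<le> (b * c * h s * h t) * 1"
    using abc h_nonneg by (intro mult_left_mono) auto
  moreover have "R s t \<ge> 0" unfolding attenuated_OU_cov_def using abc by simp
  ultimately show ?thesis by (simp add: R_eq)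
qed

lemma h_integral: "integrable lborel h" "(\<integral>t. h t \<partial>lborel) = 1 / b"
proof -
  have "has_bochner_integral lborel h (1 / b)"
    unfolding h_def[abs_def] using abc by (intro has_bochner_integral_exp_Ici) auto
  then show "integrable lborel h" "(\<integral>t. h t \<partial>lborel) = 1 / b"
    by (auto simp: has_bochner_integral_iff)
qed

end

text \<open>
  The weight \<open>k\<close> is a Fourier kernel, or the difference of two of them: the latter gives the
  mean-square continuity of the transfer function in the frequency.
\<close>

locale OU_weighted = OU_channel +
  fixes k :: "real \<Rightarrow> complex" and C :: real
  assumes k_cont: "continuous_on UNIV k" and k_bound: "\<And>t. cmod (k t) \<le> C"
begin

lemma C_nonneg: "C \<ge> 0" using k_bound[of 0] norm_ge_zero order_trans by blast

lemma k_measurable [measurable]: "k \<in> borel_measurable borel"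
  using k_cont by (rule borel_measurable_continuous_onI)

definition Z :: "real \<Rightarrow> 'a \<Rightarrow> complex" where "Z t \<omega> = k t * H t \<omega>"

lemma sq_Z: "square_integrable M (Z t)"
  unfolding Z_def[abs_def] by (rule sq_H)

lemma expectation_inner_Z: "expectation (\<lambda>\<omega>. Z s \<omega> \<bullet> Z t \<omega>) = \<rho> k s t"
  unfolding Z_def by (rule expectation_inner_H)

lemma expectation_norm_sq_diff:
  "expectation (\<lambda>\<omega>. (norm (Z s \<omega> - Z t \<omega>))\<^sup>2) = \<rho> k s s - 2 * \<rho> k s t + \<rho> k t t"
proof -
  have "(norm (Z s \<omega> - Z t \<omega>))\<^sup>2 = Z s \<omega> \<bullet> Z s \<omega> - 2 * (Z s \<omega> \<bullet> Z t \<omega>) + Z t \<omega> \<bullet> Z t \<omega>" for \<omega>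
    by (simp add: power2_norm_eq_inner inner_diff_left inner_diff_right inner_commute)
  then show ?thesis by (simp add: integrable_inner sq_Z expectation_inner_Z)
qed

definition g :: "real \<Rightarrow> real" where "g t = cmod (k t) * h t"

lemma g_nonneg: "g t \<ge> 0" by (simp add: g_def h_nonneg)

lemma g_measurable [measurable]: "g \<in> borel_measurable borel" unfolding g_def[abs_def] by measurable

lemma g_integrable: "integrable lborel g"
proof (rule Bochner_Integration.integrable_bound)
  show "integrable lborel (\<lambda>t. C * h t)" by (intro integrable_mult_right h_integral)
  show "AE t in lborel. norm (g t) \<le> norm (C * h t)"
    using k_bound h_nonneg C_nonneg by (auto simp: g_def abs_mult intro!: mult_right_mono)
qed auto

lemma \<rho>_measurable' [measurable]: "(\<lambda>s. \<rho> k s t) \<in> borel_measurable borel" "\<rho> k s \<in> borel_measurable borel"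
  unfolding \<rho>_def[abs_def] R_eq by measurable

lemma \<rho>_le: "\<bar>\<rho> k s t\<bar> \<le> 2 * b * c * g s * g t"
proof -
  have "\<bar>\<rho> k s t\<bar> = 2 * \<bar>k s \<bullet> k t\<bar> * \<bar>R s t\<bar>" by (simp add: \<rho>_def abs_mult)
  also have "\<dots> \<le> 2 * (cmod (k s) * cmod (k t)) * (b * c * h s * h t)"
    by (intro mult_mono R_le mult_left_mono Cauchy_Schwarz_ineq2) auto
  also have "\<dots> = 2 * b * c * g s * g t" by (simp add: g_def)
  finally show ?thesis .
qed

text \<open>The process vanishes in mean square before time 0, and on [0, \<infinity>) its
  covariance is continuous; the only jump is at 0, as \<open>has_ms_integral_exists\<close>
  permits.\<close>

lemma Z_ms_integral_exists:
  assumes AB: "A \<le> B"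
  shows "\<exists>I. square_integrable M I \<and> has_ms_integral M Z A B I"
proof (rule has_ms_integral_exists[OF AB sq_Z])
  have g: "g t \<le> C" for t
  proof -
    have "h t \<le> 1" using abc by (auto simp: h_def indicator_def)
    then have "cmod (k t) * h t \<le> C * 1" by (intro mult_mono k_bound C_nonneg h_nonneg)
    then show ?thesis by (simp add: g_def)
  qed
  have \<rho>C: "\<bar>\<rho> k s t\<bar> \<le> 2 * b * c * C * C" for s t
    using abc g_nonneg C_nonneg by (intro order_trans[OF \<rho>_le] mult_mono g) auto
  show "expectation (\<lambda>\<omega>. (norm (Z s \<omega> - Z t \<omega>))\<^sup>2) \<le> 4 * (2 * b * c * C * C)" for s t
    unfolding expectation_norm_sq_diff using \<rho>C[of s s] \<rho>C[of s t] \<rho>C[of t t] by linarith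
  \<comment> \<open>The covariance with its indicators removed: jointly continuous everywhere and
    equal to \<open>\<rho> k s t\<close> for nonnegative times. Uniform continuity on the square
    then provides a common \<delta>.\<close>
  define \<psi> where "\<psi> s t = 2 * (k s \<bullet> k t) * (c * exp (- a * \<bar>s - t\<bar>) * b * exp (- b * (s + t)))" for s t
  have ck: "continuous_on S (\<lambda>z. k (f z))" if "continuous_on S f" for S and f :: "real \<times> real \<Rightarrow> real"
    using continuous_on_compose2[OF k_cont that] by simp
  define F where "F z = \<psi> (fst z) (fst z) - 2 * \<psi> (fst z) (snd z) + \<psi> (snd z) (snd z)" for z
  have "continuous_on (cbox (A, A) (B, B)) F"
    unfolding F_def \<psi>_def by (intro continuous_intros ck)
  then have uc: "uniformly_continuous_on (cbox (A, A) (B, B)) F"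
    by (rule compact_uniformly_continuous) simp
  fix e :: real assume "e > 0"
  with uc obtain d where d: "d > 0"
    and dd: "\<And>z z'. z \<in> cbox (A, A) (B, B) \<Longrightarrow> z' \<in> cbox (A, A) (B, B) \<Longrightarrow> dist z' z < d \<Longrightarrow> dist (F z') (F z) < e"
    unfolding uniformly_continuous_on_def by metis
  have "expectation (\<lambda>\<omega>. (norm (Z s \<omega> - Z t \<omega>))\<^sup>2) \<le> e"
    if st: "s \<in> {A..B}" "t \<in> {A..B}" "\<bar>s - t\<bar> < d" "s < 0 \<longleftrightarrow> t < 0" for s t
  proof (cases "s < 0")
    case True
    then show ?thesis using st(4) \<open>e > 0\<close>
      by (simp add: expectation_norm_sq_diff \<rho>_def attenuated_OU_cov_def indicator_def)
  next
    case False
    then have "expectation (\<lambda>\<omega>. (norm (Z s \<omega> - Z t \<omega>))\<^sup>2) = F (s, t)"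
      using st(4) by (simp add: expectation_norm_sq_diff \<rho>_def attenuated_OU_cov_def F_def \<psi>_def)
    moreover have "dist (F (s, t)) (F (t, t)) < e"
      using st by (intro dd) (auto simp: cbox_Pair_eq dist_Pair_Pair dist_real_def)
    moreover have "F (t, t) = 0" by (simp add: F_def)
    ultimately show ?thesis by (simp add: dist_real_def)
  qed
  then show "\<exists>\<delta>>0. \<forall>s\<in>{A..B}. \<forall>t\<in>{A..B}. \<bar>s - t\<bar> < \<delta> \<longrightarrow> (s < 0 \<longleftrightarrow> t < 0) \<longrightarrow>
      expectation (\<lambda>\<omega>. (norm (Z s \<omega> - Z t \<omega>))\<^sup>2) \<le> e"
    using d by blast
qed

section \<open>The covariance form of the stochastic integrals\<close>

definition q :: "(real \<Rightarrow> real) \<Rightarrow> real \<Rightarrow> real"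
  where "q u t = (\<integral>s. u s * \<rho> k s t \<partial>lborel)"

text \<open>Formally \<open>\<Gamma> u v\<close> is the covariance of the integrals of u Z and v Z,
  and \<open>q u t\<close> that of the integral of u Z with \<open>Z t\<close>. Working with weights
  u and v makes the form bilinear, so that integrals over different intervals can be
  compared.\<close>

definition \<Gamma> :: "(real \<Rightarrow> real) \<Rightarrow> (real \<Rightarrow> real) \<Rightarrow> real"
  where "\<Gamma> u v = (\<integral>t. v t * q u t \<partial>lborel)"

text \<open>An L1 norm with the envelope \<open>g\<close> as weight. It controls the covariance form
  because \<rho> is dominated by the product of two envelopes.\<close>

definition G :: "(real \<Rightarrow> real) \<Rightarrow> real"
  where "G u = (\<integral>t. \<bar>u t\<bar> * g t \<partial>lborel)"

text \<open>A class of weights which contains indicators of intervals and constants and is closed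
  under differences, as needed to express the remainders outside a finite interval.\<close>

definition bdd :: "(real \<Rightarrow> real) \<Rightarrow> bool"
  where "bdd u \<longleftrightarrow> u \<in> borel_measurable borel \<and> (\<exists>B. \<forall>t. \<bar>u t\<bar> \<le> B)"

lemma bdd_indicator: "S \<in> sets borel \<Longrightarrow> bdd (indicator S)"
  by (auto simp: bdd_def indicator_def intro!: exI[of _ 1])

lemma bdd_const: "bdd (\<lambda>_. r)"
  by (auto simp: bdd_def)

lemma bdd_diff:
  assumes "bdd u" "bdd v"
  shows "bdd (\<lambda>t. u t - v t)"
proof -
  obtain B B' where B: "\<And>t. \<bar>u t\<bar> \<le> B" "\<And>t. \<bar>v t\<bar> \<le> B'" using assms by (auto simp: bdd_def)
  have "\<bar>u t - v t\<bar> \<le> B + B'" for t using B(1)[of t] B(2)[of t] by linarith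
  then show ?thesis using assms by (auto simp: bdd_def)
qed

lemma integrable_bdd_times:
  assumes "bdd u" "integrable lborel f"
  shows "integrable lborel (\<lambda>t. u t * f t)"
proof -
  obtain B where B: "\<And>t. \<bar>u t\<bar> \<le> B" using assms by (auto simp: bdd_def)
  have [measurable]: "u \<in> borel_measurable borel" "f \<in> borel_measurable borel" using assms by (auto simp: bdd_def)
  show ?thesis
  proof (rule Bochner_Integration.integrable_bound)
    show "integrable lborel (\<lambda>t. B * f t)" using assms by simp
    show "AE t in lborel. norm (u t * f t) \<le> norm (B * f t)"
    proof (intro AE_I2)
      fix t
      have "\<bar>u t\<bar> \<le> \<bar>B\<bar>" using B[of t] by linarith
      then show "norm (u t * f t) \<le> norm (B * f t)" by (simp add: abs_mult mult_right_mono)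
    qed
  qed auto
qed

lemma \<rho>_integrable: "integrable lborel (\<lambda>s. \<rho> k s t)"
  by (rule Bochner_Integration.integrable_bound[where f = "\<lambda>s. 2 * b * c * g s * g t"])
    (use \<rho>_le[of _ t] g_integrable abc g_nonneg in \<open>auto intro!: integrable_mult_left integrable_mult_right\<close>)

lemma G_bdd: "bdd u \<Longrightarrow> integrable lborel (\<lambda>t. \<bar>u t\<bar> * g t)"
  by (intro integrable_bdd_times g_integrable) (auto simp: bdd_def)

lemma G_nonneg: "G u \<ge> 0" by (simp add: G_def g_nonneg)

lemma q_le:
  assumes u: "bdd u"
  shows "\<bar>q u t\<bar> \<le> 2 * b * c * G u * g t"
proof -
  have "\<bar>q u t\<bar> \<le> (\<integral>s. \<bar>u s * \<rho> k s t\<bar> \<partial>lborel)" unfolding q_def by (rule integral_abs_bound)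
  also have "\<dots> \<le> (\<integral>s. 2 * b * c * (\<bar>u s\<bar> * g s) * g t \<partial>lborel)"
  proof (rule integral_mono)
    show "integrable lborel (\<lambda>s. \<bar>u s * \<rho> k s t\<bar>)"
      by (intro integrable_abs integrable_bdd_times u \<rho>_integrable)
    show "integrable lborel (\<lambda>s. 2 * b * c * (\<bar>u s\<bar> * g s) * g t)"
      by (intro integrable_mult_left integrable_mult_right G_bdd u)
    fix s
    have "\<bar>u s\<bar> * \<bar>\<rho> k s t\<bar> \<le> \<bar>u s\<bar> * (2 * b * c * g s * g t)" by (intro mult_left_mono \<rho>_le) auto
    then show "\<bar>u s * \<rho> k s t\<bar> \<le> 2 * b * c * (\<bar>u s\<bar> * g s) * g t" by (simp add: abs_mult mult_ac)
  qed
  also have "\<dots> = 2 * b * c * G u * g t" by (simp add: G_def)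
  finally show ?thesis .
qed

lemma q_measurable [measurable]:
  assumes "bdd u"
  shows "q u \<in> borel_measurable borel"
proof -
  have [measurable]: "u \<in> borel_measurable borel" using assms by (simp add: bdd_def)
  show ?thesis
    unfolding q_def[abs_def] \<rho>_def R_eq by measurable
qed

lemma q_integrable: "bdd u \<Longrightarrow> integrable lborel (q u)"
  by (rule Bochner_Integration.integrable_bound[where f = "\<lambda>t. 2 * b * c * G u * g t"])
    (use q_le[of u] g_integrable abc g_nonneg G_nonneg in \<open>auto intro!: integrable_mult_right\<close>)

lemma \<Gamma>_le:
  assumes u: "bdd u" and v: "bdd v"
  shows "\<bar>\<Gamma> u v\<bar> \<le> 2 * b * c * G u * G v"
proof -
  have "\<bar>\<Gamma> u v\<bar> \<le> (\<integral>t. \<bar>v t * q u t\<bar> \<partial>lborel)" unfolding \<Gamma>_def by (rule integral_abs_bound)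
  also have "\<dots> \<le> (\<integral>t. 2 * b * c * G u * (\<bar>v t\<bar> * g t) \<partial>lborel)"
  proof (rule integral_mono)
    show "integrable lborel (\<lambda>t. \<bar>v t * q u t\<bar>)"
      by (intro integrable_abs integrable_bdd_times v q_integrable u)
    show "integrable lborel (\<lambda>t. 2 * b * c * G u * (\<bar>v t\<bar> * g t))"
      by (intro integrable_mult_right G_bdd v)
    fix t
    have "\<bar>v t\<bar> * \<bar>q u t\<bar> \<le> \<bar>v t\<bar> * (2 * b * c * G u * g t)" by (intro mult_left_mono q_le u) auto
    then show "\<bar>v t * q u t\<bar> \<le> 2 * b * c * G u * (\<bar>v t\<bar> * g t)" by (simp add: abs_mult mult_ac)
  qed
  also have "\<dots> = 2 * b * c * G u * G v" by (simp add: G_def)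
  finally show ?thesis .
qed

lemma q_diff: "bdd u \<Longrightarrow> bdd u' \<Longrightarrow> q (\<lambda>t. u t - u' t) t = q u t - q u' t"
  unfolding q_def left_diff_distrib
  by (intro Bochner_Integration.integral_diff integrable_bdd_times \<rho>_integrable)

lemma \<Gamma>_diff_left: "bdd u \<Longrightarrow> bdd u' \<Longrightarrow> bdd v \<Longrightarrow> \<Gamma> (\<lambda>t. u t - u' t) v = \<Gamma> u v - \<Gamma> u' v"
  unfolding \<Gamma>_def by (simp add: q_diff right_diff_distrib integrable_bdd_times q_integrable)

lemma \<Gamma>_diff_right: "bdd u \<Longrightarrow> bdd v \<Longrightarrow> bdd v' \<Longrightarrow> \<Gamma> u (\<lambda>t. v t - v' t) = \<Gamma> u v - \<Gamma> u v'"
  unfolding \<Gamma>_def by (simp add: left_diff_distrib integrable_bdd_times q_integrable)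

lemma has_integral_indicator_times:
  assumes f: "integrable lborel (f :: real \<Rightarrow> real)"
  shows "(f has_integral (\<integral>t. indicator {A..B} t * f t \<partial>lborel)) {A..B}"
proof -
  have "set_integrable lborel {A..B} f"
    unfolding set_integrable_def using integrable_bdd_times[OF bdd_indicator f, of "{A..B}"] by simp
  from set_borel_integral_eq_integral[OF this] have "(f has_integral (LINT x:{A..B}|lborel. f x)) {A..B}"
    by (simp add: has_integral_iff)
  then show ?thesis by (simp add: set_lebesgue_integral_def)
qed

text \<open>The pairing rule is applied once to each factor: against a single value
  \<open>Z t\<close> it gives \<open>q\<close>, and against the first integral it gives
  \<open>\<Gamma>\<close>.\<close>

lemma inner_ms_integrals:
  assumes "has_ms_integral M Z A B I" "has_ms_integral M Z A' B' I'"
  shows "expectation (\<lambda>\<omega>. I \<omega> \<bullet> I' \<omega>) = \<Gamma> (indicator {A..B}) (indicator {A'..B'})"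
proof -
  have I: "square_integrable M I" by (rule has_ms_integral_square_integrable[OF assms(1) sq_Z])
  have 1: "expectation (\<lambda>\<omega>. I \<omega> \<bullet> Z t \<omega>) = q (indicator {A..B}) t" for t
  proof (rule has_ms_integral_inner[OF assms(1) sq_Z sq_Z])
    show "((\<lambda>s. expectation (\<lambda>\<omega>. Z s \<omega> \<bullet> Z t \<omega>)) has_integral q (indicator {A..B}) t) {A..B}"
      unfolding expectation_inner_Z q_def by (rule has_integral_indicator_times[OF \<rho>_integrable])
  qed
  have "expectation (\<lambda>\<omega>. I' \<omega> \<bullet> I \<omega>) = \<Gamma> (indicator {A..B}) (indicator {A'..B'})"
  proof (rule has_ms_integral_inner[OF assms(2) sq_Z I])
    have "expectation (\<lambda>\<omega>. Z t \<omega> \<bullet> I \<omega>) = q (indicator {A..B}) t" for t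
      using 1[of t] by (simp add: inner_commute)
    then show "((\<lambda>t. expectation (\<lambda>\<omega>. Z t \<omega> \<bullet> I \<omega>)) has_integral \<Gamma> (indicator {A..B}) (indicator {A'..B'})) {A'..B'}"
      unfolding \<Gamma>_def by (simp add: has_integral_indicator_times q_integrable bdd_indicator)
  qed
  then show ?thesis by (simp add: inner_commute)
qed

text \<open>By bilinearity the squared distance of two integrals is \<open>\<Gamma> u u\<close>,
  where u is the difference of the two indicators.\<close>

lemma ms_integral_diff_norm_sq:
  assumes "has_ms_integral M Z A B I" "has_ms_integral M Z A' B' I'"
  defines "u \<equiv> \<lambda>t. indicator {A..B} t - indicator {A'..B'} t"
  shows "expectation (\<lambda>\<omega>. (norm (I \<omega> - I' \<omega>))\<^sup>2) \<le> 2 * b * c * (G u)\<^sup>2"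
proof -
  note sq = has_ms_integral_square_integrable[OF assms(1) sq_Z] has_ms_integral_square_integrable[OF assms(2) sq_Z]
  have "(norm (I \<omega> - I' \<omega>))\<^sup>2 = I \<omega> \<bullet> I \<omega> - I \<omega> \<bullet> I' \<omega> - (I' \<omega> \<bullet> I \<omega> - I' \<omega> \<bullet> I' \<omega>)" for \<omega>
    by (simp add: power2_norm_eq_inner inner_diff_left inner_diff_right)
  then have "expectation (\<lambda>\<omega>. (norm (I \<omega> - I' \<omega>))\<^sup>2) =
      \<Gamma> (indicator {A..B}) (indicator {A..B}) - \<Gamma> (indicator {A..B}) (indicator {A'..B'})
      - (\<Gamma> (indicator {A'..B'}) (indicator {A..B}) - \<Gamma> (indicator {A'..B'}) (indicator {A'..B'}))"
    by (simp add: integrable_inner sq inner_ms_integrals[OF assms(1,1)] inner_ms_integrals[OF assms(1,2)]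
       inner_ms_integrals[OF assms(2,1)] inner_ms_integrals[OF assms(2,2)])
  also have "\<dots> = \<Gamma> u u"
    unfolding u_def by (simp add: \<Gamma>_diff_left \<Gamma>_diff_right bdd_indicator bdd_diff)
  also have "\<dots> \<le> \<bar>\<Gamma> u u\<bar>" by simp
  also have "\<dots> \<le> 2 * b * c * G u * G u"
    by (intro \<Gamma>_le) (auto simp: u_def intro!: bdd_diff bdd_indicator)
  finally show ?thesis by (simp add: power2_eq_square mult_ac)
qed

section \<open>Mean-square integrals over the whole line\<close>

lemma G_tail: "(\<lambda>n. G (indicator {real n<..})) \<longlonglongrightarrow> 0"
proof -
  have "(\<lambda>n. \<integral>t. \<bar>indicator {real n<..} t\<bar> * g t \<partial>lborel) \<longlonglongrightarrow> (\<integral>t. 0 \<partial>(lborel :: real measure))"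
  proof (rule integral_dominated_convergence[where w = g])
    show "AE t in lborel. (\<lambda>n. \<bar>indicator {real n<..} t\<bar> * g t) \<longlonglongrightarrow> 0"
    proof (intro AE_I2 tendsto_eventually)
      fix t :: real
      show "\<forall>\<^sub>F n in sequentially. \<bar>indicator {real n<..} t\<bar> * g t = 0"
        using eventually_ge_at_top[of "nat \<lceil>t\<rceil>"] by eventually_elim (auto simp: indicator_def nat_le_iff ceiling_le_iff)
    qed
  qed (use g_nonneg g_integrable in \<open>auto simp: indicator_def\<close>)
  then show ?thesis by (simp add: G_def)
qed

text \<open>The envelope vanishes at negative times, so only the part of \<open>u\<close> beyond
  \<open>n\<close> counts. For the same reason a lower integration bound A \<le> 0 already exhausts
  the left half-line.\<close>

lemma G_le_tail:
  assumes "bdd u" "\<And>t. \<bar>u t\<bar> \<le> 1" "\<And>t. 0 \<le> t \<Longrightarrow> t \<le> real n \<Longrightarrow> u t = 0"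
  shows "G u \<le> G (indicator {real n<..})"
  unfolding G_def
proof (rule integral_mono)
  fix t
  show "\<bar>u t\<bar> * g t \<le> \<bar>indicator {real n<..} t\<bar> * g t"
  proof (cases "t < 0 \<or> (0 \<le> t \<and> t \<le> real n)")
    case True
    then have "\<bar>u t\<bar> * g t = 0" using assms(3)[of t] by (auto simp: g_def h_def)
    then show ?thesis by (simp only:) (simp add: g_nonneg)
  next
    case False
    then have "t \<in> {real n<..}" by auto
    then show ?thesis using mult_right_mono[OF assms(2) g_nonneg, of t] by simp
  qed
qed (intro G_bdd assms(1) bdd_indicator; simp)+

lemma eventually_wide: "\<forall>\<^sub>F (A, B) in at_bot \<times>\<^sub>F at_top. A \<le> (0::real) \<and> real n \<le> (B::real)"
  unfolding eventually_prod_filter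
  by (intro exI[of _ "\<lambda>A. A \<le> 0"] exI[of _ "\<lambda>B. real n \<le> B"]) (simp add: eventually_le_at_bot eventually_ge_at_top)

lemma line_filter_neq_bot: "at_bot \<times>\<^sub>F at_top \<noteq> (bot :: (real \<times> real) filter)"
  by (simp add: prod_filter_eq_bot)

lemma Z_ms_integral_line_exists: "\<exists>J. has_ms_integral_line M Z J"
proof -
  have "\<exists>I. \<forall>A B. A \<le> B \<longrightarrow> square_integrable M (I A B) \<and> has_ms_integral M Z A B (I A B)"
    using Z_ms_integral_exists by metis
  then obtain I where sqI: "\<And>A B. A \<le> B \<Longrightarrow> square_integrable M (I A B)"
    and I: "\<And>A B. A \<le> B \<Longrightarrow> has_ms_integral M Z A B (I A B)" by blast
  have "\<exists>J. square_integrable M J \<and> ms_tendsto M (\<lambda>(A, B). I A B) J (at_bot \<times>\<^sub>F at_top)"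
  proof (rule ms_Cauchy_imp_ms_tendsto[OF line_filter_neq_bot])
    show "\<forall>\<^sub>F i in at_bot \<times>\<^sub>F at_top. square_integrable M (case i of (A, B) \<Rightarrow> I A B)"
      using eventually_wide[of 0] by eventually_elim (auto intro: sqI)
    fix e :: real assume e: "e > 0"
    have "(\<lambda>n. 2 * b * c * (G (indicator {real n<..}))\<^sup>2) \<longlonglongrightarrow> 2 * b * c * 0\<^sup>2"
      by (intro tendsto_intros G_tail)
    then have "\<forall>\<^sub>F n in sequentially. 2 * b * c * (G (indicator {real n<..}))\<^sup>2 < e"
      using e by (intro order_tendstoD(2)) auto
    then obtain n where n: "2 * b * c * (G (indicator {real n<..}))\<^sup>2 < e"
      using eventually_happens' sequentially_bot by blast
    have "expectation (\<lambda>\<omega>. (norm (I A B \<omega> - I A' B' \<omega>))\<^sup>2) \<le> e"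
      if w: "A \<le> 0" "real n \<le> B" "A' \<le> 0" "real n \<le> B'" for A B A' B'
    proof -
      define u where "u t = (indicator {A..B} t - indicator {A'..B'} t :: real)" for t
      have "expectation (\<lambda>\<omega>. (norm (I A B \<omega> - I A' B' \<omega>))\<^sup>2) \<le> 2 * b * c * (G u)\<^sup>2"
        unfolding u_def using w by (intro ms_integral_diff_norm_sq I) auto
      also have "\<dots> \<le> 2 * b * c * (G (indicator {real n<..}))\<^sup>2"
      proof (intro mult_left_mono power_mono G_nonneg G_le_tail)
        show "bdd u" unfolding u_def by (intro bdd_diff bdd_indicator) auto
      qed (use w abc in \<open>auto simp: u_def indicator_def\<close>)
      finally show ?thesis using n by simp
    qed
    then show "\<exists>P. eventually P (at_bot \<times>\<^sub>F at_top) \<and>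
       (\<forall>i j. P i \<longrightarrow> P j \<longrightarrow> square_integrable M (case i of (A, B) \<Rightarrow> I A B) \<longrightarrow> square_integrable M (case j of (A, B) \<Rightarrow> I A B) \<longrightarrow>
        expectation (\<lambda>\<omega>. (norm ((case i of (A, B) \<Rightarrow> I A B) \<omega> - (case j of (A, B) \<Rightarrow> I A B) \<omega>))\<^sup>2) \<le> e)"
      by (intro exI[of _ "\<lambda>(A, B). A \<le> 0 \<and> real n \<le> B"] conjI eventually_wide) auto
  qed
  then show ?thesis unfolding has_ms_integral_line_def using I by blast
qed

lemma has_ms_integral_line_square_integrable:
  assumes I: "\<And>A B. A \<le> B \<Longrightarrow> has_ms_integral M Z A B (I A B)"
  shows "\<forall>\<^sub>F i in at_bot \<times>\<^sub>F at_top. square_integrable M (case i of (A, B) \<Rightarrow> I A B)"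
  using eventually_wide[of 0]
  by eventually_elim (auto intro: has_ms_integral_square_integrable[OF I sq_Z])

text \<open>For u the indicator of the interval and v = 1 - u, the missing part of the second moment
  is \<Gamma>(v,1) + \<Gamma>(u,v), at most a constant times the tail of \<open>G\<close>. The value
  holds for every version \<open>J\<close> of the integral.\<close>

lemma ms_integral_line_norm_sq:
  assumes "has_ms_integral_line M Z J"
  shows "square_integrable M J" "expectation (\<lambda>\<omega>. (norm (J \<omega>))\<^sup>2) = \<Gamma> (\<lambda>_. 1) (\<lambda>_. 1)"
proof -
  obtain I where I: "\<And>A B. A \<le> B \<Longrightarrow> has_ms_integral M Z A B (I A B)"
    and J: "ms_tendsto M (\<lambda>(A, B). I A B) J (at_bot \<times>\<^sub>F at_top)"
    using assms unfolding has_ms_integral_line_def by blast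
  note sq = has_ms_integral_line_square_integrable[OF I]
  show "square_integrable M J" by (rule ms_tendsto_square_integrable(1)[OF J line_filter_neq_bot sq])
  note lim = ms_tendsto_integral_norm_sq[OF J line_filter_neq_bot sq]
  define T where "T n = 4 * b * c * G (indicator {real n<..}) * G (\<lambda>_. 1)" for n
  have T: "T \<longlonglongrightarrow> 0"
  proof -
    have "T \<longlonglongrightarrow> 4 * b * c * 0 * G (\<lambda>_. 1)" unfolding T_def by (intro tendsto_intros G_tail)
    then show ?thesis by simp
  qed
  have est: "\<bar>expectation (\<lambda>\<omega>. (norm (I A B \<omega>))\<^sup>2) - \<Gamma> (\<lambda>_. 1) (\<lambda>_. 1)\<bar> \<le> T n" if w: "A \<le> 0" "real n \<le> B" for A B n
  proof -
    define u where "u = (indicator {A..B} :: real \<Rightarrow> real)"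
    define v where "v t = 1 - u t" for t
    have b: "bdd u" "bdd v" "bdd (\<lambda>_. 1)" unfolding v_def u_def by (intro bdd_diff bdd_indicator bdd_const; simp)+
    have "expectation (\<lambda>\<omega>. (norm (I A B \<omega>))\<^sup>2) = \<Gamma> u u"
      unfolding power2_norm_eq_inner u_def using w by (intro inner_ms_integrals I) auto
    moreover have "\<Gamma> (\<lambda>_. 1) (\<lambda>_. 1) - \<Gamma> u u = \<Gamma> v (\<lambda>_. 1) + \<Gamma> u v"
      unfolding v_def by (simp add: \<Gamma>_diff_left \<Gamma>_diff_right b)
    moreover have Gv: "G v \<le> G (indicator {real n<..})"
      using w by (intro G_le_tail b) (auto simp: v_def u_def indicator_def)
    have Gu: "G u \<le> G (\<lambda>_. 1)"
      unfolding G_def by (intro integral_mono G_bdd b mult_right_mono g_nonneg) (auto simp: u_def indicator_def)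
    have "\<bar>\<Gamma> v (\<lambda>_. 1)\<bar> \<le> 2 * b * c * G v * G (\<lambda>_. 1)" "\<bar>\<Gamma> u v\<bar> \<le> 2 * b * c * G u * G v"
      by (intro \<Gamma>_le b)+
    moreover have "2 * b * c * G v * G (\<lambda>_. 1) \<le> 2 * b * c * G (indicator {real n<..}) * G (\<lambda>_. 1)"
      using abc by (intro mult_right_mono mult_left_mono Gv G_nonneg) auto
    moreover have "2 * b * c * G u * G v \<le> 2 * b * c * G (\<lambda>_. 1) * G (indicator {real n<..})"
      using abc by (intro mult_mono Gv Gu mult_left_mono G_nonneg mult_nonneg_nonneg) auto
    ultimately show ?thesis unfolding T_def by (simp add: mult_ac)
  qed
  have "((\<lambda>i. expectation (\<lambda>\<omega>. (norm ((case i of (A, B) \<Rightarrow> I A B) \<omega>))\<^sup>2)) \<longlongrightarrow> \<Gamma> (\<lambda>_. 1) (\<lambda>_. 1)) (at_bot \<times>\<^sub>F at_top)"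
  proof (rule tendstoI)
    fix e :: real assume "e > 0"
    then have "\<forall>\<^sub>F n in sequentially. T n < e" using T by (intro order_tendstoD(2)) auto
    then obtain n where n: "T n < e" using eventually_happens' sequentially_bot by blast
    show "\<forall>\<^sub>F i in at_bot \<times>\<^sub>F at_top. dist (expectation (\<lambda>\<omega>. (norm ((case i of (A, B) \<Rightarrow> I A B) \<omega>))\<^sup>2)) (\<Gamma> (\<lambda>_. 1) (\<lambda>_. 1)) < e"
      using eventually_wide[of n]
    proof eventually_elim
      case (elim i)
      then show ?case using est[of "fst i" n "snd i"] n by (simp add: split_def dist_real_def)
    qed
  qed
  from tendsto_unique[OF line_filter_neq_bot lim this]
  show "expectation (\<lambda>\<omega>. (norm (J \<omega>))\<^sup>2) = \<Gamma> (\<lambda>_. 1) (\<lambda>_. 1)" .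
qed

end

section \<open>Circularly symmetric complex Gaussian variables\<close>

lemma cmod_iexp_diff_le: "cmod (iexp x - iexp y) \<le> \<bar>x - y\<bar>"
proof -
  have "iexp x - iexp y = iexp y * (iexp (x - y) - 1)"
    by (simp add: right_diff_distrib exp_add[symmetric])
  then have "cmod (iexp x - iexp y) = cmod (iexp (x - y) - 1)"
    by (simp add: norm_mult)
  also have "\<dots> \<le> \<bar>x - y\<bar>" using iexp_approx1[of "x - y" 0] by simp
  finally show ?thesis .
qed

text \<open>The characteristic function depends on |w| alone, which is circular symmetry. Each real
  component has variance E|S|^2/2, whence the 4. The zero variable is included, as limits
  require.\<close>

definition circular_gaussian :: "'w measure \<Rightarrow> ('w \<Rightarrow> complex) \<Rightarrow> bool"
  where "circular_gaussian M S \<longleftrightarrow> square_integrable M S \<and>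
    (\<forall>w. (\<integral>\<omega>. iexp (w \<bullet> S \<omega>) \<partial>M) = exp (- ((cmod w)\<^sup>2 * (\<integral>\<omega>. (norm (S \<omega>))\<^sup>2 \<partial>M) / 4)))"

lemma gaussian_transform:
  fixes x :: real
  assumes "s \<ge> 0"
  shows "(\<integral>v. iexp (sqrt (2 * s) * x * v) \<partial>std_normal_distribution) = exp (- (s * x\<^sup>2))"
proof -
  have "(\<integral>v. iexp (sqrt (2 * s) * x * v) \<partial>std_normal_distribution) = char std_normal_distribution (sqrt (2 * s) * x)"
    by (simp add: char_def mult.assoc)
  also have "\<dots> = exp (- (s * x\<^sup>2))"
    unfolding char_std_normal_distribution using assms by (simp add: power_mult_distrib exp_of_real)
  finally show ?thesis .
qed

text \<open>Up to a constant factor the integrand is a normal density of variance 1/(1+l).\<close>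

lemma integral_std_normal_exp_square:
  assumes "l \<ge> 0"
  shows "(\<integral>u. exp (- (l * u\<^sup>2 / 2)) \<partial>std_normal_distribution) = 1 / sqrt (1 + l)"
proof -
  define \<sigma> where "\<sigma> = 1 / sqrt (1 + l)"
  have s: "\<sigma> > 0" using assms by (simp add: \<sigma>_def)
  have s2: "1 / \<sigma>\<^sup>2 = 1 + l" using assms by (simp add: \<sigma>_def power_divide)
  have "std_normal_density u * exp (- (l * u\<^sup>2 / 2)) = \<sigma> * normal_density 0 \<sigma> u" for u
  proof -
    have "- u\<^sup>2 / 2 + - (l * u\<^sup>2 / 2) = - u\<^sup>2 * (1 / \<sigma>\<^sup>2) / 2" unfolding s2 by (simp add: field_simps)
    then have "exp (- u\<^sup>2 / 2) * exp (- (l * u\<^sup>2 / 2)) = exp (- (u - 0)\<^sup>2 / (2 * \<sigma>\<^sup>2))"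
      unfolding exp_add[symmetric] by simp
    then show ?thesis
      using s unfolding normal_density_def by (simp add: real_sqrt_mult)
  qed
  then have "(\<integral>u. exp (- (l * u\<^sup>2 / 2)) \<partial>std_normal_distribution) = (\<integral>u. \<sigma> * normal_density 0 \<sigma> u \<partial>lborel)"
    by (subst integral_density) auto
  also have "\<dots> = \<sigma>" using s by simp
  finally show ?thesis by (simp add: \<sigma>_def)
qed

context prob_space
begin

text \<open>An auxiliary standard normal variable v linearises the square in the exponent. Since F
  is bounded and both measures are probabilities, Fubini applies. The lemma is used once for each
  component of the complex variable.\<close>

lemma integral_exp_square_eq:
  fixes F :: "'a \<Rightarrow> complex" and y :: "'a \<Rightarrow> real"
  assumes [measurable]: "F \<in> borel_measurable M" "y \<in> borel_measurable M"
    and F: "\<And>\<omega>. cmod (F \<omega>) \<le> 1" and s: "s \<ge> 0"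
  shows "(\<integral>\<omega>. F \<omega> * exp (- (s * (y \<omega>)\<^sup>2)) \<partial>M) =
    (\<integral>v. (\<integral>\<omega>. F \<omega> * iexp (sqrt (2 * s) * y \<omega> * v) \<partial>M) \<partial>std_normal_distribution)"
proof -
  interpret N: prob_space std_normal_distribution
    by (rule prob_space_normal_density) simp
  interpret P: pair_prob_space M std_normal_distribution ..
  have "(\<integral>\<omega>. F \<omega> * exp (- (s * (y \<omega>)\<^sup>2)) \<partial>M) =
    (\<integral>\<omega>. (\<integral>v. F \<omega> * iexp (sqrt (2 * s) * y \<omega> * v) \<partial>std_normal_distribution) \<partial>M)"
    by (intro Bochner_Integration.integral_cong refl) (simp add: gaussian_transform[OF s, symmetric] exp_of_real)
  also have "\<dots> = (\<integral>v. (\<integral>\<omega>. F \<omega> * iexp (sqrt (2 * s) * y \<omega> * v) \<partial>M) \<partial>std_normal_distribution)"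
  proof (rule P.Fubini_integral[symmetric])
    show "integrable (M \<Otimes>\<^sub>M std_normal_distribution) (\<lambda>(\<omega>, v). F \<omega> * iexp (sqrt (2 * s) * y \<omega> * v))"
      by (rule P.integrable_const_bound[of _ 1]) (auto simp: norm_mult F split_beta')
  qed
  finally show ?thesis .
qed

text \<open>
  The Gaussian factors \<open>exp (- s x\<^sup>2)\<close> and \<open>exp (- s y\<^sup>2)\<close> of the integrand are averages of
  characters, so that the Laplace transform is the Gaussian average of the characteristic function.
\<close>

lemma circular_gaussian_Laplace:
  assumes circ: "circular_gaussian M S" and s: "s \<ge> 0"
  shows "expectation (\<lambda>\<omega>. exp (- (s * (norm (S \<omega>))\<^sup>2))) = 1 / (1 + s * expectation (\<lambda>\<omega>. (norm (S \<omega>))\<^sup>2))"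
proof -
  have [measurable]: "S \<in> borel_measurable M" using circ by (auto simp: circular_gaussian_def intro: square_integrable_measurable)
  define m where "m = expectation (\<lambda>\<omega>. (norm (S \<omega>))\<^sup>2)"
  have m: "m \<ge> 0" by (simp add: m_def)
  have char: "(\<integral>\<omega>. iexp (w \<bullet> S \<omega>) \<partial>M) = exp (- ((cmod w)\<^sup>2 * m / 4))" for w
    using circ by (simp add: circular_gaussian_def m_def)
  have [measurable]: "(\<lambda>\<omega>. Re (S \<omega>)) \<in> borel_measurable M" "(\<lambda>\<omega>. Im (S \<omega>)) \<in> borel_measurable M" by measurable
  have eq: "(\<integral>u. complex_of_real (exp (- (s * m * u\<^sup>2 / 2))) \<partial>std_normal_distribution) = complex_of_real (1 / sqrt (1 + s * m))"
    unfolding integral_complex_of_real by (subst integral_std_normal_exp_square) (use s m in auto)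
  \<comment> \<open>With v fixed, the real part is linearised by a second variable u, and the
    characteristic function at w = sqrt(2s) (u + iv) factorises. The average over u yields
    1/sqrt(1+sm), and so does the later average over v.\<close>
  have 1: "(\<integral>\<omega>. complex_of_real (exp (- (s * (Re (S \<omega>))\<^sup>2))) * iexp (sqrt (2 * s) * Im (S \<omega>) * v) \<partial>M)
      = exp (- (s * m * v\<^sup>2 / 2)) * (1 / sqrt (1 + s * m))" for v
  proof -
    have "(\<integral>\<omega>. complex_of_real (exp (- (s * (Re (S \<omega>))\<^sup>2))) * iexp (sqrt (2 * s) * Im (S \<omega>) * v) \<partial>M)
      = (\<integral>\<omega>. iexp (sqrt (2 * s) * Im (S \<omega>) * v) * complex_of_real (exp (- (s * (Re (S \<omega>))\<^sup>2))) \<partial>M)"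
      by (simp only: mult.commute)
    also have "\<dots> = (\<integral>u. (\<integral>\<omega>. iexp (sqrt (2 * s) * Im (S \<omega>) * v) * iexp (sqrt (2 * s) * Re (S \<omega>) * u) \<partial>M) \<partial>std_normal_distribution)"
      by (rule integral_exp_square_eq) (use s in auto)
    also have "\<dots> = (\<integral>u. complex_of_real (exp (- (s * m * v\<^sup>2 / 2))) * complex_of_real (exp (- (s * m * u\<^sup>2 / 2))) \<partial>std_normal_distribution)"
    proof (rule Bochner_Integration.integral_cong[OF refl])
      fix u
      define w where "w = Complex (sqrt (2 * s) * u) (sqrt (2 * s) * v)"
      have "iexp (sqrt (2 * s) * Im (S \<omega>) * v) * iexp (sqrt (2 * s) * Re (S \<omega>) * u) = iexp (w \<bullet> S \<omega>)" for \<omega>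
        unfolding exp_add[symmetric] by (simp add: w_def inner_complex_def algebra_simps)
      then have "(\<integral>\<omega>. iexp (sqrt (2 * s) * Im (S \<omega>) * v) * iexp (sqrt (2 * s) * Re (S \<omega>) * u) \<partial>M) = exp (- ((cmod w)\<^sup>2 * m / 4))"
        by (simp only: char)
      also have "(cmod w)\<^sup>2 = 2 * s * (u\<^sup>2 + v\<^sup>2)"
        unfolding cmod_power2 w_def using s by (simp add: power_mult_distrib algebra_simps)
      also have "complex_of_real (exp (- (2 * s * (u\<^sup>2 + v\<^sup>2) * m / 4))) = complex_of_real (exp (- (s * m * v\<^sup>2 / 2))) * complex_of_real (exp (- (s * m * u\<^sup>2 / 2)))"
        unfolding of_real_mult[symmetric] exp_add[symmetric] by (simp add: algebra_simps add_divide_distrib)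
      finally show "(\<integral>\<omega>. iexp (sqrt (2 * s) * Im (S \<omega>) * v) * iexp (sqrt (2 * s) * Re (S \<omega>) * u) \<partial>M) =
          complex_of_real (exp (- (s * m * v\<^sup>2 / 2))) * complex_of_real (exp (- (s * m * u\<^sup>2 / 2)))" .
    qed
    also have "\<dots> = complex_of_real (exp (- (s * m * v\<^sup>2 / 2))) * (\<integral>u. complex_of_real (exp (- (s * m * u\<^sup>2 / 2))) \<partial>std_normal_distribution)"
      by (rule integral_mult_right_zero)
    finally show ?thesis unfolding eq by simp
  qed
  have "complex_of_real (expectation (\<lambda>\<omega>. exp (- (s * (norm (S \<omega>))\<^sup>2)))) =
      (\<integral>\<omega>. complex_of_real (exp (- (s * (Re (S \<omega>))\<^sup>2))) * exp (- (s * (Im (S \<omega>))\<^sup>2)) \<partial>M)"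
    unfolding integral_complex_of_real[symmetric]
    by (intro Bochner_Integration.integral_cong refl)
      (simp add: cmod_power2 distrib_left exp_add[symmetric] flip: of_real_mult)
  also have "\<dots> = (\<integral>v. (\<integral>\<omega>. complex_of_real (exp (- (s * (Re (S \<omega>))\<^sup>2))) * iexp (sqrt (2 * s) * Im (S \<omega>) * v) \<partial>M) \<partial>std_normal_distribution)"
    by (rule integral_exp_square_eq) (use s in auto)
  also have "\<dots> = (\<integral>v. complex_of_real (exp (- (s * m * v\<^sup>2 / 2))) * complex_of_real (1 / sqrt (1 + s * m)) \<partial>std_normal_distribution)"
    unfolding 1 by simp
  also have "\<dots> = (\<integral>v. complex_of_real (exp (- (s * m * v\<^sup>2 / 2))) \<partial>std_normal_distribution) * complex_of_real (1 / sqrt (1 + s * m))"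
    by (rule integral_mult_left_zero)
  also have "\<dots> = complex_of_real (1 / (1 + s * m))"
    unfolding eq of_real_mult[symmetric] using s m by simp
  finally show ?thesis unfolding m_def of_real_eq_iff .
qed

lemma integral_norm_le_sqrt:
  assumes "square_integrable M f"
  shows "integrable M (\<lambda>\<omega>. norm (f \<omega>))" "expectation (\<lambda>\<omega>. norm (f \<omega>)) \<le> sqrt (expectation (\<lambda>\<omega>. (norm (f \<omega>))\<^sup>2))"
proof -
  have 1: "square_integrable M (\<lambda>\<omega>. norm (f \<omega>))" "square_integrable M (\<lambda>_. 1 :: real)"
    using assms by (auto simp: square_integrable_def)
  show "integrable M (\<lambda>\<omega>. norm (f \<omega>))" using integrable_inner[OF 1] by simp
  show "expectation (\<lambda>\<omega>. norm (f \<omega>)) \<le> sqrt (expectation (\<lambda>\<omega>. (norm (f \<omega>))\<^sup>2))"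
    using abs_integral_inner_le[OF 1] by (simp add: prob_space)
qed

text \<open>Since \<open>iexp\<close> is Lipschitz with constant 1, mean-square convergence implies
  convergence of the characteristic functions. The second moments in the Gaussian exponent converge
  as well, so the defining identity passes to the limit.\<close>

lemma circular_gaussian_limit:
  assumes lim: "ms_tendsto M S I F" and F: "F \<noteq> bot" and circ: "\<forall>\<^sub>F i in F. circular_gaussian M (S i)"
  shows "circular_gaussian M I"
proof -
  have sq: "\<forall>\<^sub>F i in F. square_integrable M (S i)" using circ by eventually_elim (simp add: circular_gaussian_def)
  note I = ms_tendsto_square_integrable[OF lim F sq]
  have [measurable]: "I \<in> borel_measurable M" using I(1) by (rule square_integrable_measurable)
  have "(\<integral>\<omega>. iexp (w \<bullet> I \<omega>) \<partial>M) = exp (- ((cmod w)\<^sup>2 * (\<integral>\<omega>. (norm (I \<omega>))\<^sup>2 \<partial>M) / 4))" for w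
  proof (rule tendsto_unique[OF F])
    have "((\<lambda>i. complex_of_real (exp (- ((cmod w)\<^sup>2 * (\<integral>\<omega>. (norm (S i \<omega>))\<^sup>2 \<partial>M) / 4)))) \<longlongrightarrow>
        complex_of_real (exp (- ((cmod w)\<^sup>2 * (\<integral>\<omega>. (norm (I \<omega>))\<^sup>2 \<partial>M) / 4)))) F"
      by (intro tendsto_intros ms_tendsto_integral_norm_sq[OF lim F sq]) auto
    moreover have "\<forall>\<^sub>F i in F. complex_of_real (exp (- ((cmod w)\<^sup>2 * (\<integral>\<omega>. (norm (S i \<omega>))\<^sup>2 \<partial>M) / 4))) = (\<integral>\<omega>. iexp (w \<bullet> S i \<omega>) \<partial>M)"
      using circ by eventually_elim (simp add: circular_gaussian_def)
    ultimately show "((\<lambda>i. \<integral>\<omega>. iexp (w \<bullet> S i \<omega>) \<partial>M) \<longlongrightarrow> exp (- ((cmod w)\<^sup>2 * (\<integral>\<omega>. (norm (I \<omega>))\<^sup>2 \<partial>M) / 4))) F"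
      by (simp add: tendsto_cong)
    have "((\<lambda>i. cmod w * sqrt (\<integral>\<omega>. (norm (S i \<omega> - I \<omega>))\<^sup>2 \<partial>M)) \<longlongrightarrow> cmod w * sqrt 0) F"
      by (intro tendsto_intros I(3))
    then have z: "((\<lambda>i. cmod w * sqrt (\<integral>\<omega>. (norm (S i \<omega> - I \<omega>))\<^sup>2 \<partial>M)) \<longlongrightarrow> 0) F" by simp
    have "\<forall>\<^sub>F i in F. norm ((\<integral>\<omega>. iexp (w \<bullet> S i \<omega>) \<partial>M) - (\<integral>\<omega>. iexp (w \<bullet> I \<omega>) \<partial>M)) \<le> cmod w * sqrt (\<integral>\<omega>. (norm (S i \<omega> - I \<omega>))\<^sup>2 \<partial>M)"
      using sq I(2)
    proof eventually_elim
      case (elim i)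
      have [measurable]: "S i \<in> borel_measurable M" using elim(1) by (rule square_integrable_measurable)
      have int: "integrable M (\<lambda>\<omega>. iexp (w \<bullet> f \<omega>))" if [measurable]: "f \<in> borel_measurable M" for f
        by (rule integrable_const_bound[of _ 1]) auto
      have "norm ((\<integral>\<omega>. iexp (w \<bullet> S i \<omega>) \<partial>M) - (\<integral>\<omega>. iexp (w \<bullet> I \<omega>) \<partial>M)) = norm (\<integral>\<omega>. iexp (w \<bullet> S i \<omega>) - iexp (w \<bullet> I \<omega>) \<partial>M)"
        by (subst Bochner_Integration.integral_diff) (auto intro!: int)
      also have "\<dots> \<le> (\<integral>\<omega>. norm (iexp (w \<bullet> S i \<omega>) - iexp (w \<bullet> I \<omega>)) \<partial>M)" by (rule integral_norm_bound)
      also have "\<dots> \<le> (\<integral>\<omega>. cmod w * norm (S i \<omega> - I \<omega>) \<partial>M)"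
      proof (rule integral_mono)
        show "integrable M (\<lambda>\<omega>. norm (iexp (w \<bullet> S i \<omega>) - iexp (w \<bullet> I \<omega>)))"
          by (intro integrable_norm Bochner_Integration.integrable_diff int) auto
        show "integrable M (\<lambda>\<omega>. cmod w * norm (S i \<omega> - I \<omega>))"
          by (intro integrable_mult_right integral_norm_le_sqrt elim)
        show "norm (iexp (w \<bullet> S i \<omega>) - iexp (w \<bullet> I \<omega>)) \<le> cmod w * norm (S i \<omega> - I \<omega>)" for \<omega>
        proof -
          have "norm (iexp (w \<bullet> S i \<omega>) - iexp (w \<bullet> I \<omega>)) \<le> \<bar>w \<bullet> (S i \<omega> - I \<omega>)\<bar>"
            unfolding inner_diff_right by (rule cmod_iexp_diff_le)
          also have "\<dots> \<le> cmod w * norm (S i \<omega> - I \<omega>)" by (rule Cauchy_Schwarz_ineq2)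
          finally show ?thesis .
        qed
      qed
      also have "\<dots> \<le> cmod w * sqrt (\<integral>\<omega>. (norm (S i \<omega> - I \<omega>))\<^sup>2 \<partial>M)"
        using integral_norm_le_sqrt(2)[OF elim(2)] by (simp add: mult_left_mono)
      finally show ?case .
    qed
    from Lim_null_comparison[OF this z] show "((\<lambda>i. \<integral>\<omega>. iexp (w \<bullet> S i \<omega>) \<partial>M) \<longlongrightarrow> (\<integral>\<omega>. iexp (w \<bullet> I \<omega>) \<partial>M)) F"
      by (rule LIM_zero_cancel)
  qed
  then show ?thesis using I(1) by (simp add: circular_gaussian_def)
qed

end

text \<open>Write (1 - e^(-ys))/s as the integral of e^(-su) over u from 0 to y and exchange the
  order; the inner integral over s is 1/(1+u). Nonnegative integrands make the exchange
  unconditional.\<close>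

lemma nn_integral_Frullani:
  assumes y: "y \<ge> 0"
  shows "(\<integral>\<^sup>+s. ennreal (exp (- s) / s * (1 - exp (- (y * s)))) * indicator {0<..} s \<partial>lborel) = ennreal (ln (1 + y))"
proof -
  have 1: "(\<integral>\<^sup>+u. ennreal (exp (- (s * (1 + u)))) * indicator {0..y} u \<partial>lborel) = ennreal (exp (- s) / s * (1 - exp (- (y * s))))" if s: "s > 0" for s
  proof -
    have "(\<integral>\<^sup>+u. ennreal (exp (- (s * (1 + u)))) * indicator {0..y} u \<partial>lborel)
       = ennreal (- exp (- (s * (1 + y))) / s - (- exp (- (s * (1 + 0))) / s))"
    proof (rule nn_integral_FTC_Icc)
      show "((\<lambda>u. - exp (- (s * (1 + u))) / s) has_real_derivative exp (- (s * (1 + u)))) (at u)" for u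
        using s by (auto intro!: derivative_eq_intros)
    qed (use y in auto)
    also have "- exp (- (s * (1 + y))) / s - (- exp (- (s * (1 + 0))) / s) = exp (- s) / s * (1 - exp (- (y * s)))"
      using s by (simp add: field_simps exp_add[symmetric])
    finally show ?thesis .
  qed
  have 2: "(\<integral>\<^sup>+s. ennreal (exp (- (s * (1 + u)))) * indicator {0..} s \<partial>lborel) = ennreal (1 / (1 + u))" if u: "u \<ge> 0" for u
  proof -
    have "(\<integral>\<^sup>+s. ennreal (exp (- (s * (1 + u)))) * indicator {0..} s \<partial>lborel) = ennreal (0 - (- exp (- (0 * (1 + u))) / (1 + u)))"
    proof (rule nn_integral_FTC_atLeast)
      show "((\<lambda>s. - exp (- (s * (1 + u))) / (1 + u)) has_real_derivative exp (- (s * (1 + u)))) (at s)" for s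
        using u by (auto intro!: derivative_eq_intros simp: divide_simps, (simp add: algebra_simps)?)
      have "filterlim (\<lambda>s. - (s * (1 + u))) at_bot at_top"
        using u by (intro filterlim_compose[OF filterlim_uminus_at_bot_at_top]
            filterlim_at_top_mult_tendsto_pos[OF tendsto_const] filterlim_ident) auto
      then have "((\<lambda>s. - exp (- (s * (1 + u))) / (1 + u)) \<longlongrightarrow> - 0 / (1 + u)) at_top"
        using u by (intro tendsto_intros filterlim_compose[OF exp_at_bot]) auto
      then show "((\<lambda>s. - exp (- (s * (1 + u))) / (1 + u)) \<longlongrightarrow> 0) at_top" by simp
    qed auto
    then show ?thesis by simp
  qed
  have "(\<integral>\<^sup>+s. ennreal (exp (- s) / s * (1 - exp (- (y * s)))) * indicator {0<..} s \<partial>lborel) =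
     (\<integral>\<^sup>+s. (\<integral>\<^sup>+u. ennreal (exp (- (s * (1 + u)))) * indicator {0..y} u * indicator {0<..} s \<partial>lborel) \<partial>lborel)"
  proof (intro nn_integral_cong)
    fix s :: real
    show "ennreal (exp (- s) / s * (1 - exp (- (y * s)))) * indicator {0<..} s =
       (\<integral>\<^sup>+u. ennreal (exp (- (s * (1 + u)))) * indicator {0..y} u * indicator {0<..} s \<partial>lborel)"
      using 1[of s] by (cases "s > 0") auto
  qed
  also have "\<dots> = (\<integral>\<^sup>+u. (\<integral>\<^sup>+s. ennreal (exp (- (s * (1 + u)))) * indicator {0..y} u * indicator {0<..} s \<partial>lborel) \<partial>lborel)"
    by (rule lborel_pair.Fubini') measurable
  also have "\<dots> = (\<integral>\<^sup>+u. ennreal (1 / (1 + u)) * indicator {0..y} u \<partial>lborel)"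
  proof (intro nn_integral_cong)
    fix u :: real
    show "(\<integral>\<^sup>+s. ennreal (exp (- (s * (1 + u)))) * indicator {0..y} u * indicator {0<..} s \<partial>lborel) = ennreal (1 / (1 + u)) * indicator {0..y} u"
    proof (cases "u \<in> {0..y}")
      case True
      \<comment> \<open>The open and the closed half-line differ only by the null set consisting of
        0.\<close>
      have "(\<integral>\<^sup>+s. ennreal (exp (- (s * (1 + u)))) * indicator {0<..} s \<partial>lborel) = (\<integral>\<^sup>+s. ennreal (exp (- (s * (1 + u)))) * indicator {0..} s \<partial>lborel)"
        using AE_lborel_singleton[of 0] by (intro nn_integral_cong_AE) (auto simp: indicator_def)
      then show ?thesis using True 2[of u] by simp
    qed simp
  qed
  also have "\<dots> = ennreal (ln (1 + y) - ln (1 + 0))"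
  proof (rule nn_integral_FTC_Icc)
    show "((\<lambda>u. ln (1 + u)) has_real_derivative 1 / (1 + u)) (at u)" if "u \<in> {0..y}" for u
      using that by (auto intro!: derivative_eq_intros)
  qed (use y in auto)
  finally show ?thesis by simp
qed

text \<open>By Tonelli the expectation acts inside the Frullani integral, where only the Laplace
  transform of |S|^2 appears. Then (1 - 1/(1+\<alpha>sm))/s = 1/(x+s) with x = 1/(\<alpha>m), which
  is the integral already expanded in Laguerre polynomials.\<close>

lemma (in prob_space) circular_gaussian_log_expectation:
  assumes circ: "circular_gaussian M S" and \<alpha>: "\<alpha> > 0"
    and m: "m = expectation (\<lambda>\<omega>. (norm (S \<omega>))\<^sup>2)" "m > 0"
  shows "expectation (\<lambda>\<omega>. ln (1 + \<alpha> * (norm (S \<omega>))\<^sup>2)) = (\<Sum>n. laguerre n 0 (1 / (\<alpha> * m)) / (real n + 1))"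
proof -
  have [measurable]: "S \<in> borel_measurable M" using circ by (auto simp: circular_gaussian_def intro: square_integrable_measurable)
  define x where "x = 1 / (\<alpha> * m)"
  have x: "x > 0" using \<alpha> m by (simp add: x_def)
  have "(\<integral>\<^sup>+\<omega>. ennreal (ln (1 + \<alpha> * (norm (S \<omega>))\<^sup>2)) \<partial>M) =
    (\<integral>\<^sup>+\<omega>. (\<integral>\<^sup>+s. ennreal (exp (- s) / s * (1 - exp (- (\<alpha> * (norm (S \<omega>))\<^sup>2 * s)))) * indicator {0<..} s \<partial>lborel) \<partial>M)"
    using \<alpha> by (intro nn_integral_cong nn_integral_Frullani[symmetric]) auto
  also have "\<dots> = (\<integral>\<^sup>+s. (\<integral>\<^sup>+\<omega>. ennreal (exp (- s) / s * (1 - exp (- (\<alpha> * (norm (S \<omega>))\<^sup>2 * s)))) * indicator {0<..} s \<partial>M) \<partial>lborel)"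
  proof -
    interpret P: pair_sigma_finite M lborel ..
    show ?thesis by (rule P.Fubini'[symmetric]) measurable
  qed
  also have "\<dots> = (\<integral>\<^sup>+s. ennreal (exp (- s) / (x + s)) * indicator {0..} s \<partial>lborel)"
  proof (rule nn_integral_cong_AE)
    show "AE s in lborel. (\<integral>\<^sup>+\<omega>. ennreal (exp (- s) / s * (1 - exp (- (\<alpha> * (norm (S \<omega>))\<^sup>2 * s)))) * indicator {0<..} s \<partial>M)
       = ennreal (exp (- s) / (x + s)) * indicator {0..} s"
      using AE_lborel_singleton[of 0]
    proof eventually_elim
      case (elim s)
      show ?case
      proof (cases "s > 0")
        case s: True
        have bd: "0 \<le> exp (- (\<alpha> * (norm (S \<omega>))\<^sup>2 * s))" "exp (- (\<alpha> * (norm (S \<omega>))\<^sup>2 * s)) \<le> 1" for \<omega>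
          using \<alpha> s by auto
        have int: "integrable M (\<lambda>\<omega>. exp (- (\<alpha> * (norm (S \<omega>))\<^sup>2 * s)))"
          by (rule integrable_const_bound[of _ 1]) (use bd in auto)
        have "(\<integral>\<^sup>+\<omega>. ennreal (exp (- s) / s * (1 - exp (- (\<alpha> * (norm (S \<omega>))\<^sup>2 * s)))) \<partial>M)
            = ennreal (expectation (\<lambda>\<omega>. exp (- s) / s * (1 - exp (- (\<alpha> * (norm (S \<omega>))\<^sup>2 * s)))))"
          by (rule nn_integral_eq_integral) (use s bd int in auto)
        also have "expectation (\<lambda>\<omega>. exp (- s) / s * (1 - exp (- (\<alpha> * (norm (S \<omega>))\<^sup>2 * s))))
            = exp (- s) / s * (1 - expectation (\<lambda>\<omega>. exp (- (\<alpha> * s * (norm (S \<omega>))\<^sup>2))))"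
          using int by (simp add: prob_space mult_ac)
        also have "expectation (\<lambda>\<omega>. exp (- (\<alpha> * s * (norm (S \<omega>))\<^sup>2))) = 1 / (1 + \<alpha> * s * m)"
          unfolding m(1) by (rule circular_gaussian_Laplace[OF circ]) (use s \<alpha> in simp)
        also have "exp (- s) / s * (1 - 1 / (1 + \<alpha> * s * m)) = exp (- s) / (x + s)"
        proof -
          define r where "r = \<alpha> * m"
          have r: "r > 0" using \<alpha> m by (simp add: r_def)
          have p: "1 + s * r > 0" using r s by (simp add: add_pos_pos)
          have "1 - 1 / (1 + s * r) = s * r / (1 + s * r)" using p by (simp add: field_simps)
          moreover have "x = 1 / r" by (simp add: x_def r_def)
          then have "x + s = (1 + s * r) / r" using r by (simp add: field_simps)
          ultimately have "exp (- s) / s * (1 - 1 / (1 + s * r)) = exp (- s) / (x + s)"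
            using s r p by simp
          then show ?thesis by (simp add: r_def mult_ac)
        qed
        finally show ?thesis using s by simp
      qed (use elim in \<open>auto simp: indicator_def\<close>)
    qed
  qed
  also have "\<dots> = ennreal (\<Sum>n. laguerre n 0 x / (real n + 1))" by (rule nn_integral_exp_over_add[OF x])
  finally have nn: "(\<integral>\<^sup>+\<omega>. ennreal (ln (1 + \<alpha> * (norm (S \<omega>))\<^sup>2)) \<partial>M) = ennreal (\<Sum>n. laguerre n 0 x / (real n + 1))" .
  have "has_bochner_integral M (\<lambda>\<omega>. ln (1 + \<alpha> * (norm (S \<omega>))\<^sup>2)) (\<Sum>n. laguerre n 0 x / (real n + 1))"
    by (rule has_bochner_integral_nn_integral[OF _ _ suminf_laguerre_over_Suc_nonneg[OF x] nn])
      (use \<alpha> in \<open>auto intro!: ln_ge_zero\<close>)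
  then show ?thesis unfolding x_def by (rule has_bochner_integral_integral_eq)
qed

section \<open>The law of the transfer function\<close>

context OU_weighted
begin

text \<open>The pairing of w with the sum splits into independent Gaussian combinations P of X and Q
  of Y. As X and Y have the same covariance, the two variances add up to |w|^2 E|S|^2/2, and the
  phase of w disappears.\<close>

lemma circular_gaussian_riemann_sum:
  assumes p: "p tagged_division_of {A..B}"
  shows "circular_gaussian M (riemann_sum Z p)"
proof -
  have fin: "finite p" using p by (rule tagged_division_of_finite)
  define S where "S = riemann_sum Z p"
  define l where "l x = measure lborel (snd x)" for x :: "real \<times> real set"
  have S_eq: "S \<omega> = (\<Sum>x\<in>p. l x *\<^sub>R Z (fst x) \<omega>)" for \<omega>
    by (simp add: S_def riemann_sum_def split_def l_def)
  have sqS: "square_integrable M S" unfolding S_def by (rule square_integrable_riemann_sum[OF p sq_Z])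
  have ES: "expectation (\<lambda>\<omega>. (norm (S \<omega>))\<^sup>2) = (\<Sum>x\<in>p. \<Sum>y\<in>p. l x * (l y * \<rho> k (fst x) (fst y)))"
  proof -
    have "(norm (S \<omega>))\<^sup>2 = (\<Sum>x\<in>p. \<Sum>y\<in>p. l x * (l y * (Z (fst x) \<omega> \<bullet> Z (fst y) \<omega>)))" for \<omega>
      unfolding power2_norm_eq_inner S_eq by (simp add: inner_sum_left inner_sum_right sum_distrib_left inner_commute mult.left_commute)
    then show ?thesis by (simp add: integrable_inner sq_Z expectation_inner_Z)
  qed
  have "(\<integral>\<omega>. iexp (w \<bullet> S \<omega>) \<partial>M) = exp (- ((cmod w)\<^sup>2 * expectation (\<lambda>\<omega>. (norm (S \<omega>))\<^sup>2) / 4))" for w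
  proof -
    define \<alpha> where "\<alpha> x = l x * Re (cnj w * k (fst x))" for x
    \<comment> \<open>For z = cnj w * k the pairing of w with k H is Re z X - Im z Y, hence the
      minus sign.\<close>
    define \<beta> where "\<beta> x = - (l x * Im (cnj w * k (fst x)))" for x
    define P where "P \<omega> = (\<Sum>x\<in>p. \<alpha> x * X (fst x) \<omega>)" for \<omega>
    define Q where "Q \<omega> = (\<Sum>x\<in>p. \<beta> x * Y (fst x) \<omega>)" for \<omega>
    have wS: "w \<bullet> S \<omega> = P \<omega> + Q \<omega>" for \<omega>
      unfolding S_eq P_def Q_def inner_sum_right sum.distrib[symmetric]
      by (intro sum.cong refl) (simp add: Z_def H_def \<alpha>_def \<beta>_def inner_complex_def algebra_simps)
    have gP: "gaussian_rv M P" unfolding P_def[abs_def] by (rule gaussian_process_sum[OF gaussian(1) fin])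
    have gQ: "gaussian_rv M Q" unfolding Q_def[abs_def] by (rule gaussian_process_sum[OF gaussian(2) fin])
    have EP: "expectation P = 0" "expectation Q = 0"
      unfolding P_def Q_def by (simp_all add: integrable_XY expectation_XY)
    have EP2: "expectation (\<lambda>\<omega>. (P \<omega>)\<^sup>2) = (\<Sum>x\<in>p. \<Sum>y\<in>p. \<alpha> x * (\<alpha> y * R (fst x) (fst y)))"
    proof -
      have "(P \<omega>)\<^sup>2 = (\<Sum>x\<in>p. \<Sum>y\<in>p. \<alpha> x * (\<alpha> y * (X (fst x) \<omega> * X (fst y) \<omega>)))" for \<omega>
        unfolding P_def power2_eq_square sum_product by (intro sum.cong refl) (simp add: mult_ac)
      then show ?thesis by (simp add: integrable_products cov_XY)
    qed
    have EQ2: "expectation (\<lambda>\<omega>. (Q \<omega>)\<^sup>2) = (\<Sum>x\<in>p. \<Sum>y\<in>p. \<beta> x * (\<beta> y * R (fst x) (fst y)))"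
    proof -
      have "(Q \<omega>)\<^sup>2 = (\<Sum>x\<in>p. \<Sum>y\<in>p. \<beta> x * (\<beta> y * (Y (fst x) \<omega> * Y (fst y) \<omega>)))" for \<omega>
        unfolding Q_def power2_eq_square sum_product by (intro sum.cong refl) (simp add: mult_ac)
      then show ?thesis by (simp add: integrable_products cov_XY)
    qed
    have "expectation (\<lambda>\<omega>. (P \<omega>)\<^sup>2) + expectation (\<lambda>\<omega>. (Q \<omega>)\<^sup>2) = (cmod w)\<^sup>2 * expectation (\<lambda>\<omega>. (norm (S \<omega>))\<^sup>2) / 2"
    proof -
      have *: "\<alpha> x * (\<alpha> y * R (fst x) (fst y)) + \<beta> x * (\<beta> y * R (fst x) (fst y))
          = (cmod w)\<^sup>2 / 2 * (l x * (l y * \<rho> k (fst x) (fst y)))" for x y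
        unfolding \<alpha>_def \<beta>_def \<rho>_def cmod_power2 inner_complex_def by (simp add: field_simps power2_eq_square)
      show ?thesis
        unfolding EP2 EQ2 ES sum.distrib[symmetric] * by (simp add: sum_distrib_left sum_divide_distrib)
    qed
    then have e: "- expectation (\<lambda>\<omega>. (P \<omega>)\<^sup>2) / 2 + - expectation (\<lambda>\<omega>. (Q \<omega>)\<^sup>2) / 2 = - ((cmod w)\<^sup>2 * expectation (\<lambda>\<omega>. (norm (S \<omega>))\<^sup>2) / 4)"
      by simp
    have "indep_var borel P borel Q"
      unfolding P_def[abs_def] Q_def[abs_def] by (rule indep_sums[OF fin])
    then have ind: "indep_var borel (\<lambda>\<omega>. iexp (P \<omega>)) borel (\<lambda>\<omega>. iexp (Q \<omega>))"
      by (rule indep_var_compose[unfolded comp_def]) auto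
    have [measurable]: "P \<in> borel_measurable M" "Q \<in> borel_measurable M"
      using gaussian_rv_square_integrable[OF gP] gaussian_rv_square_integrable[OF gQ] by (auto intro: square_integrable_measurable)
    have "(\<integral>\<omega>. iexp (w \<bullet> S \<omega>) \<partial>M) = (\<integral>\<omega>. iexp (P \<omega>) * iexp (Q \<omega>) \<partial>M)"
      unfolding wS by (simp add: distrib_left exp_add)
    also have "\<dots> = (\<integral>\<omega>. iexp (P \<omega>) \<partial>M) * (\<integral>\<omega>. iexp (Q \<omega>) \<partial>M)"
      by (rule indep_var_lebesgue_integral[OF ind]) (auto intro!: integrable_const_bound[of _ 1])
    also have "\<dots> = exp (- ((cmod w)\<^sup>2 * expectation (\<lambda>\<omega>. (norm (S \<omega>))\<^sup>2) / 4))"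
      unfolding gaussian_rv_char[OF gP EP(1)] gaussian_rv_char[OF gQ EP(2)] of_real_mult[symmetric] exp_add[symmetric] e ..
    finally show ?thesis .
  qed
  then show ?thesis using sqS unfolding circular_gaussian_def S_def by simp
qed

lemma circular_gaussian_ms_integral_line:
  assumes "has_ms_integral_line M Z J"
  shows "circular_gaussian M J"
proof -
  obtain I where I: "\<And>A B. A \<le> B \<Longrightarrow> has_ms_integral M Z A B (I A B)"
    and J: "ms_tendsto M (\<lambda>(A, B). I A B) J (at_bot \<times>\<^sub>F at_top)"
    using assms unfolding has_ms_integral_line_def by blast
  have circ: "circular_gaussian M (I A B)" if "A \<le> B" for A B
  proof (rule circular_gaussian_limit[OF _ riemann_filter_neq_bot])
    show "ms_tendsto M (riemann_sum Z) (I A B) (riemann_filter A B)"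
      using I[OF that] by (simp add: has_ms_integral_riemann_sum)
    show "\<forall>\<^sub>F p in riemann_filter A B. circular_gaussian M (riemann_sum Z p)"
      using eventually_riemann_filter_tagged_division by eventually_elim (rule circular_gaussian_riemann_sum)
  qed
  show ?thesis
  proof (rule circular_gaussian_limit[OF J line_filter_neq_bot])
    show "\<forall>\<^sub>F i in at_bot \<times>\<^sub>F at_top. circular_gaussian M (case i of (A, B) \<Rightarrow> I A B)"
      using eventually_wide[of 0] by eventually_elim (auto intro: circ)
  qed
qed

end

lemma integral_exp_cos_Ici:
  fixes l w :: real
  assumes l: "l > 0"
  shows "(\<integral>u. exp (- l * u) * cos (w * u) * indicator {0..} u \<partial>lborel) = l / (l\<^sup>2 + w\<^sup>2)"
proof -
  define f where "f u = exp (- l * u) * cos (w * u)" for u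
  \<comment> \<open>The real part of e^((-l+iw)u)/(-l+iw).\<close>
  define F where "F u = exp (- l * u) * (w * sin (w * u) - l * cos (w * u)) / (l\<^sup>2 + w\<^sup>2)" for u
  have lw: "l\<^sup>2 + w\<^sup>2 > 0" using l by (simp add: add_pos_nonneg)
  have D: "(F has_real_derivative f u) (at u)" for u
  proof -
    have "((\<lambda>u. exp (- l * u) * (w * sin (w * u) - l * cos (w * u))) has_real_derivative
        (exp (- l * u) * - l) * (w * sin (w * u) - l * cos (w * u)) + exp (- l * u) * (w * (cos (w * u) * w) + l * (sin (w * u) * w))) (at u)"
      by (auto intro!: derivative_eq_intros simp: algebra_simps)
    also have "(exp (- l * u) * - l) * (w * sin (w * u) - l * cos (w * u)) + exp (- l * u) * (w * (cos (w * u) * w) + l * (sin (w * u) * w))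
        = f u * (l\<^sup>2 + w\<^sup>2)"
      by (simp add: f_def power2_eq_square algebra_simps)
    finally have "((\<lambda>u. exp (- l * u) * (w * sin (w * u) - l * cos (w * u))) has_real_derivative f u * (l\<^sup>2 + w\<^sup>2)) (at u)" .
    from DERIV_cdivide[OF this, of "l\<^sup>2 + w\<^sup>2"] show ?thesis using lw l by (simp add: F_def[abs_def])
  qed
  have fc: "isCont f u" for u unfolding f_def by (intro continuous_intros)
  have I: "(\<integral>u. f u * indicator {0..real n} u \<partial>lborel) = F (real n) - F 0" for n
    using integral_FTC_Icc_real[of 0 "real n" F f] D fc by simp
  have e: "(\<lambda>n. exp (- l * real n)) \<longlonglongrightarrow> 0"
    using l by (intro filterlim_compose[OF exp_at_bot] filterlim_tendsto_neg_mult_at_bot[OF tendsto_const] filterlim_real_sequentially) auto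
  have "(\<lambda>n. F (real n)) \<longlonglongrightarrow> 0"
  proof (rule Lim_null_comparison)
    have "(\<lambda>n. exp (- l * real n) * ((\<bar>w\<bar> + \<bar>l\<bar>) / (l\<^sup>2 + w\<^sup>2))) \<longlonglongrightarrow> 0 * ((\<bar>w\<bar> + \<bar>l\<bar>) / (l\<^sup>2 + w\<^sup>2))"
      by (intro tendsto_intros e)
    then show "(\<lambda>n. exp (- l * real n) * ((\<bar>w\<bar> + \<bar>l\<bar>) / (l\<^sup>2 + w\<^sup>2))) \<longlonglongrightarrow> 0" by simp
    show "\<forall>\<^sub>F n in sequentially. norm (F (real n)) \<le> exp (- l * real n) * ((\<bar>w\<bar> + \<bar>l\<bar>) / (l\<^sup>2 + w\<^sup>2))"
    proof (intro always_eventually allI)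
      fix n :: nat
      have "\<bar>w * sin (w * n) - l * cos (w * n)\<bar> \<le> \<bar>w * sin (w * n)\<bar> + \<bar>l * cos (w * n)\<bar>" by (rule abs_triangle_ineq4)
      also have "\<dots> \<le> \<bar>w\<bar> * 1 + \<bar>l\<bar> * 1" unfolding abs_mult by (intro add_mono mult_left_mono) auto
      finally have "exp (- l * real n) * (\<bar>w * sin (w * n) - l * cos (w * n)\<bar> / (l\<^sup>2 + w\<^sup>2)) \<le> exp (- l * real n) * ((\<bar>w\<bar> + \<bar>l\<bar>) / (l\<^sup>2 + w\<^sup>2))"
        using lw by (intro mult_left_mono divide_right_mono) auto
      then show "norm (F (real n)) \<le> exp (- l * real n) * ((\<bar>w\<bar> + \<bar>l\<bar>) / (l\<^sup>2 + w\<^sup>2))"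
        using lw by (simp add: F_def abs_mult)
    qed
  qed
  then have "(\<lambda>n. F (real n) - F 0) \<longlonglongrightarrow> 0 - F 0" by (intro tendsto_intros)
  moreover have "(\<lambda>n. \<integral>u. f u * indicator {0..real n} u \<partial>lborel) \<longlonglongrightarrow> (\<integral>u. f u * indicator {0..} u \<partial>lborel)"
  proof (rule integral_dominated_convergence[where w = "\<lambda>u. exp (- l * u) * indicator {0..} u"])
    show "integrable lborel (\<lambda>u. exp (- l * u) * indicator {0..} u)"
      using has_bochner_integral_exp_Ici[OF l] by (simp add: has_bochner_integral_iff)
    show "AE u in lborel. (\<lambda>n. f u * indicator {0..real n} u) \<longlonglongrightarrow> f u * indicator {0..} u"
    proof (intro AE_I2 tendsto_eventually)
      fix u :: real
      show "\<forall>\<^sub>F n in sequentially. f u * indicator {0..real n} u = f u * indicator {0..} u"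
        using eventually_ge_at_top[of "nat \<lceil>u\<rceil>"] by eventually_elim (auto simp: indicator_def nat_le_iff ceiling_le_iff)
    qed
    show "AE u in lborel. norm (f u * indicator {0..real n} u) \<le> exp (- l * u) * indicator {0..} u" for n
    proof (intro AE_I2)
      fix u
      have "exp (- l * u) * \<bar>cos (w * u)\<bar> \<le> exp (- l * u) * 1" by (intro mult_left_mono) auto
      then show "norm (f u * indicator {0..real n} u) \<le> exp (- l * u) * indicator {0..} u"
        by (auto simp: f_def abs_mult indicator_def)
    qed
  qed (auto simp: f_def)
  ultimately have "(\<integral>u. f u * indicator {0..} u \<partial>lborel) = 0 - F 0"
    unfolding I using LIMSEQ_unique by blast
  also have "0 - F 0 = l / (l\<^sup>2 + w\<^sup>2)" by (simp add: F_def)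
  finally show ?thesis by (simp add: f_def)
qed

lemma ms_tendsto_diff:
  assumes S: "ms_tendsto M S I F" "\<forall>\<^sub>F i in F. square_integrable M (S i)"
    and S': "ms_tendsto M S' I' F" "\<forall>\<^sub>F i in F. square_integrable M (S' i)" and F: "F \<noteq> bot"
  shows "ms_tendsto M (\<lambda>i \<omega>. S i \<omega> - S' i \<omega>) (\<lambda>\<omega>. I \<omega> - I' \<omega>) F"
proof (rule ms_tendstoI)
  note I = ms_tendsto_square_integrable[OF S(1) F S(2)] and I' = ms_tendsto_square_integrable[OF S'(1) F S'(2)]
  show "\<forall>\<^sub>F i in F. square_integrable M (\<lambda>\<omega>. S i \<omega> - S' i \<omega>)"
    using S(2) S'(2) by eventually_elim (rule square_integrable_diff)
  show "square_integrable M (\<lambda>\<omega>. I \<omega> - I' \<omega>)" using I(1) I'(1) by (rule square_integrable_diff)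
  have "((\<lambda>i. 2 * (\<integral>\<omega>. (norm (S i \<omega> - I \<omega>))\<^sup>2 \<partial>M) + 2 * (\<integral>\<omega>. (norm (S' i \<omega> - I' \<omega>))\<^sup>2 \<partial>M)) \<longlongrightarrow> 2 * 0 + 2 * 0) F"
    by (intro tendsto_intros I(3) I'(3))
  then have z: "((\<lambda>i. 2 * (\<integral>\<omega>. (norm (S i \<omega> - I \<omega>))\<^sup>2 \<partial>M) + 2 * (\<integral>\<omega>. (norm (S' i \<omega> - I' \<omega>))\<^sup>2 \<partial>M)) \<longlongrightarrow> 0) F" by simp
  show "((\<lambda>i. \<integral>\<omega>. (norm (S i \<omega> - S' i \<omega> - (I \<omega> - I' \<omega>)))\<^sup>2 \<partial>M) \<longlongrightarrow> 0) F"
  proof (rule Lim_null_comparison[OF _ z])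
    show "\<forall>\<^sub>F i in F. norm (\<integral>\<omega>. (norm (S i \<omega> - S' i \<omega> - (I \<omega> - I' \<omega>)))\<^sup>2 \<partial>M) \<le>
        2 * (\<integral>\<omega>. (norm (S i \<omega> - I \<omega>))\<^sup>2 \<partial>M) + 2 * (\<integral>\<omega>. (norm (S' i \<omega> - I' \<omega>))\<^sup>2 \<partial>M)"
      using I(2) I'(2)
    proof eventually_elim
      case (elim i)
      note int = elim[THEN square_integrable_integrable_norm]
      have eq: "S i \<omega> - S' i \<omega> - (I \<omega> - I' \<omega>) = (S i \<omega> - I \<omega>) - (S' i \<omega> - I' \<omega>)" for \<omega> by simp
      have "(\<integral>\<omega>. (norm (S i \<omega> - S' i \<omega> - (I \<omega> - I' \<omega>)))\<^sup>2 \<partial>M) \<le>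
          (\<integral>\<omega>. 2 * (norm (S i \<omega> - I \<omega>))\<^sup>2 + 2 * (norm (S' i \<omega> - I' \<omega>))\<^sup>2 \<partial>M)"
      proof (rule integral_mono)
        show "integrable M (\<lambda>\<omega>. (norm (S i \<omega> - S' i \<omega> - (I \<omega> - I' \<omega>)))\<^sup>2)"
          unfolding eq by (intro square_integrable_integrable_norm square_integrable_diff[OF elim])
        show "integrable M (\<lambda>\<omega>. 2 * (norm (S i \<omega> - I \<omega>))\<^sup>2 + 2 * (norm (S' i \<omega> - I' \<omega>))\<^sup>2)"
          using int by simp
        show "(norm (S i \<omega> - S' i \<omega> - (I \<omega> - I' \<omega>)))\<^sup>2 \<le> 2 * (norm (S i \<omega> - I \<omega>))\<^sup>2 + 2 * (norm (S' i \<omega> - I' \<omega>))\<^sup>2" for \<omega>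
          using norm_add_sq_le[of "S i \<omega> - I \<omega>" "- (S' i \<omega> - I' \<omega>)"] unfolding eq by (simp only: norm_minus_cancel diff_conv_add_uminus)
      qed
      then show ?case using int by simp
    qed
  qed
qed

lemma riemann_sum_diff: "riemann_sum (\<lambda>t \<omega>. Z t \<omega> - Z' t \<omega>) p \<omega> = riemann_sum Z p \<omega> - riemann_sum Z' p \<omega>"
  by (simp add: riemann_sum_def split_def scaleR_diff_right sum_subtractf)

text \<open>The difference of the transfer functions at two frequencies thus becomes one line
  integral, with the difference of the Fourier kernels as weight, and its second moment can be
  estimated directly.\<close>

lemma has_ms_integral_line_diff:
  fixes Z Z' :: "real \<Rightarrow> 'w \<Rightarrow> 'b::euclidean_space"
  assumes J: "has_ms_integral_line M Z J" "\<And>t. square_integrable M (Z t)"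
    and J': "has_ms_integral_line M Z' J'" "\<And>t. square_integrable M (Z' t)"
  shows "has_ms_integral_line M (\<lambda>t \<omega>. Z t \<omega> - Z' t \<omega>) (\<lambda>\<omega>. J \<omega> - J' \<omega>)"
proof -
  obtain I where I: "\<And>A B. A \<le> B \<Longrightarrow> has_ms_integral M Z A B (I A B)"
    and IJ: "ms_tendsto M (\<lambda>(A, B). I A B) J (at_bot \<times>\<^sub>F at_top)"
    using J(1) unfolding has_ms_integral_line_def by blast
  obtain I' where I': "\<And>A B. A \<le> B \<Longrightarrow> has_ms_integral M Z' A B (I' A B)"
    and IJ': "ms_tendsto M (\<lambda>(A, B). I' A B) J' (at_bot \<times>\<^sub>F at_top)"
    using J'(1) unfolding has_ms_integral_line_def by blast
  have le: "\<forall>\<^sub>F (A, B) in at_bot \<times>\<^sub>F at_top. A \<le> (B :: real)"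
    unfolding eventually_prod_filter
    by (intro exI[of _ "\<lambda>A. A \<le> 0"] exI[of _ "\<lambda>B. 0 \<le> B"]) (auto simp: eventually_le_at_bot eventually_ge_at_top)
  have sq: "\<forall>\<^sub>F i in at_bot \<times>\<^sub>F at_top. square_integrable M (case i of (A, B) \<Rightarrow> I A B)"
    using le by eventually_elim (auto intro: has_ms_integral_square_integrable[OF I J(2)])
  have sq': "\<forall>\<^sub>F i in at_bot \<times>\<^sub>F at_top. square_integrable M (case i of (A, B) \<Rightarrow> I' A B)"
    using le by eventually_elim (auto intro: has_ms_integral_square_integrable[OF I' J'(2)])
  have "has_ms_integral M (\<lambda>t \<omega>. Z t \<omega> - Z' t \<omega>) A B (\<lambda>\<omega>. I A B \<omega> - I' A B \<omega>)" if "A \<le> B" for A B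
  proof -
    have "ms_tendsto M (\<lambda>p \<omega>. riemann_sum Z p \<omega> - riemann_sum Z' p \<omega>) (\<lambda>\<omega>. I A B \<omega> - I' A B \<omega>) (riemann_filter A B)"
      using I[OF that] I'[OF that] unfolding has_ms_integral_riemann_sum
      by (intro ms_tendsto_diff riemann_filter_neq_bot eventually_square_integrable_riemann_sum J(2) J'(2))
    then show ?thesis unfolding has_ms_integral_riemann_sum riemann_sum_diff[abs_def] .
  qed
  moreover have "ms_tendsto M (\<lambda>(A, B) \<omega>. I A B \<omega> - I' A B \<omega>) (\<lambda>\<omega>. J \<omega> - J' \<omega>) (at_bot \<times>\<^sub>F at_top)"
    using ms_tendsto_diff[OF IJ sq IJ' sq'] by (simp add: split_def prod_filter_eq_bot)
  ultimately show ?thesis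
    unfolding has_ms_integral_line_def by (intro exI[of _ "\<lambda>A B \<omega>. I A B \<omega> - I' A B \<omega>"]) auto
qed

section \<open>Ergodic capacity\<close>

text \<open>The derivative 2\<alpha>z/(1+\<alpha>z^2) is at most sqrt \<alpha> in absolute value,
  because 2 sqrt \<alpha> |z| <= 1 + \<alpha>z^2. In this way mean-square continuity passes from the
  transfer function to the capacity integrand.\<close>

lemma ln_one_add_sq_Lipschitz:
  fixes u v :: real
  assumes \<alpha>: "\<alpha> > 0"
  shows "\<bar>ln (1 + \<alpha> * u\<^sup>2) - ln (1 + \<alpha> * v\<^sup>2)\<bar> \<le> sqrt \<alpha> * \<bar>u - v\<bar>"
proof -
  have pos: "1 + \<alpha> * z\<^sup>2 > 0" for z :: real using \<alpha> by (simp add: add_pos_nonneg)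
  have "norm (ln (1 + \<alpha> * u\<^sup>2) - ln (1 + \<alpha> * v\<^sup>2)) \<le> sqrt \<alpha> * norm (u - v)"
  proof (rule field_differentiable_bound[of UNIV _ "\<lambda>z. 2 * \<alpha> * z / (1 + \<alpha> * z\<^sup>2)"])
    fix z :: real
    show "((\<lambda>z. ln (1 + \<alpha> * z\<^sup>2)) has_field_derivative 2 * \<alpha> * z / (1 + \<alpha> * z\<^sup>2)) (at z within UNIV)"
      using pos[of z] by (auto intro!: derivative_eq_intros simp: power2_eq_square)
    have "2 * 1 * (sqrt \<alpha> * \<bar>z\<bar>) \<le> 1\<^sup>2 + (sqrt \<alpha> * \<bar>z\<bar>)\<^sup>2" by (rule sum_squares_bound)
    also have "\<dots> = 1 + \<alpha> * z\<^sup>2" using \<alpha> by (simp add: power_mult_distrib)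
    finally have "sqrt \<alpha> * (2 * (sqrt \<alpha> * \<bar>z\<bar>)) \<le> sqrt \<alpha> * (1 + \<alpha> * z\<^sup>2)"
      using \<alpha> by (intro mult_left_mono) auto
    moreover have "sqrt \<alpha> * (2 * (sqrt \<alpha> * \<bar>z\<bar>)) = 2 * (sqrt \<alpha> * sqrt \<alpha>) * \<bar>z\<bar>" by (simp only: mult_ac)
    moreover have "sqrt \<alpha> * sqrt \<alpha> = \<alpha>" using \<alpha> by simp
    ultimately have "2 * \<alpha> * \<bar>z\<bar> \<le> sqrt \<alpha> * (1 + \<alpha> * z\<^sup>2)" by (simp only:)
    then show "norm (2 * \<alpha> * z / (1 + \<alpha> * z\<^sup>2)) \<le> sqrt \<alpha>"
      using pos[of z] \<alpha> by (simp add: abs_mult pos_divide_le_eq)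
  qed auto
  then show ?thesis by simp
qed

context OU_channel
begin

definition \<kappa> :: "real \<Rightarrow> real \<Rightarrow> complex"
  where "\<kappa> f t = exp (- \<i> * complex_of_real (2 * pi * f * t))"

lemma fourier_integrand_eq: "fourier_integrand H f = (\<lambda>t \<omega>. \<kappa> f t * H t \<omega>)"
  by (simp add: fun_eq_iff fourier_integrand_def \<kappa>_def)

lemma \<kappa>_iexp: "\<kappa> f t = iexp (- (2 * pi * f * t))"
  by (simp add: \<kappa>_def)

lemma \<kappa>_inner: "\<kappa> f s \<bullet> \<kappa> f t = cos (2 * pi * f * (s - t))"
proof -
  have "\<kappa> f t = cis (- (2 * pi * f * t))" for t unfolding \<kappa>_iexp cis_conv_exp ..
  then show ?thesis by (simp add: inner_complex_def cos_diff right_diff_distrib)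
qed

lemma continuous_\<kappa>: "continuous_on UNIV (\<kappa> f)"
  unfolding \<kappa>_def[abs_def] by (intro continuous_intros)

lemma cmod_\<kappa>: "cmod (\<kappa> f t) = 1"
  unfolding \<kappa>_iexp by (rule norm_exp_i_times)

lemma \<kappa>_weighted: "OU_weighted M a b c X Y (\<kappa> f) 1"
  by unfold_locales (simp_all add: continuous_\<kappa> cmod_\<kappa>)

lemma \<kappa>_diff_weighted: "OU_weighted M a b c X Y (\<lambda>t. \<kappa> f t - \<kappa> f' t) 2"
proof unfold_locales
  show "continuous_on UNIV (\<lambda>t. \<kappa> f t - \<kappa> f' t)" by (intro continuous_intros continuous_\<kappa>)
  show "cmod (\<kappa> f t - \<kappa> f' t) \<le> 2" for t using norm_triangle_ineq4[of "\<kappa> f t" "\<kappa> f' t"] by (simp add: cmod_\<kappa>)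
qed

lemma sq_fourier_integrand: "square_integrable M (fourier_integrand H f t)"
  unfolding fourier_integrand_eq by (rule sq_H)

lemma h_times_h_integral: "integrable lborel (\<lambda>t. h t * h t)" "(\<integral>t. h t * h t \<partial>lborel) = 1 / (2 * b)"
proof -
  have "(\<lambda>t. h t * h t) = (\<lambda>t. exp (- (2 * b) * t) * indicator {0..} t)"
    by (simp add: fun_eq_iff h_def indicator_def exp_add[symmetric])
  then have "has_bochner_integral lborel (\<lambda>t. h t * h t) (1 / (2 * b))"
    using has_bochner_integral_exp_Ici[of "2 * b"] abc by simp
  then show "integrable lborel (\<lambda>t. h t * h t)" "(\<integral>t. h t * h t \<partial>lborel) = 1 / (2 * b)"
    by (simp_all add: has_bochner_integral_iff)
qed

text \<open>The plane is split along the diagonal. On s >= t the substitution s = t + u separates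
  the variables into h(t)^2 and e^(-(a+b)u) cos(wu); since h^2 has integral 1/(2b), this half
  contributes cQ. By symmetry the other half contributes the same.\<close>

lemma second_moment_integral:
  "(\<integral>t. (\<integral>s. \<rho> (\<kappa> f) s t \<partial>lborel) \<partial>lborel) = 2 * c * (a + b) / ((a + b)\<^sup>2 + (2 * pi * f)\<^sup>2)"
proof -
  define w where "w = 2 * pi * f"
  define Q where "Q = (a + b) / ((a + b)\<^sup>2 + w\<^sup>2)"
  define F where "F s t = \<rho> (\<kappa> f) s t" for s t
  have F: "F s t = 2 * b * c * cos (w * (s - t)) * exp (- a * \<bar>s - t\<bar>) * h s * h t" for s t
    by (simp add: F_def \<rho>_def \<kappa>_inner R_eq w_def mult_ac)
  have F_sym: "F s t = F t s" for s t unfolding F_def by (rule \<rho>_sym)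
  have Fm [measurable]: "(\<lambda>(s, t). F s t) \<in> borel_measurable (borel \<Otimes>\<^sub>M borel)" "(\<lambda>s. F s t) \<in> borel_measurable borel"
    for t unfolding F by measurable
  have F_le: "\<bar>F s t\<bar> \<le> 2 * b * c * h s * h t" for s t
  proof -
    have "\<bar>F s t\<bar> = 2 * \<bar>cos (w * (s - t))\<bar> * \<bar>R s t\<bar>" by (simp add: F_def \<rho>_def \<kappa>_inner w_def abs_mult)
    also have "\<dots> \<le> 2 * 1 * (b * c * h s * h t)" by (intro mult_mono R_le) auto
    finally show ?thesis by simp
  qed
  define U where "U s t = F s t * indicator {t..} s" for s t
  define V where "V s t = F s t * indicator {..<t} s" for s t
  have V_if: "V s t = (if s < t then F s t else 0)" for s t by (simp add: V_def)
  have int1: "integrable lborel (\<lambda>s. F s t * indicator A s)" if [measurable]: "A \<in> sets borel" for A t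
  proof (rule Bochner_Integration.integrable_bound[where f = "\<lambda>s. 2 * b * c * h t * h s"])
    show "integrable lborel (\<lambda>s. 2 * b * c * h t * h s)" by (intro integrable_mult_right h_integral)
    show "AE s in lborel. norm (F s t * indicator A s) \<le> norm (2 * b * c * h t * h s)"
      using F_le[of _ t] h_nonneg abc by (auto simp: indicator_def mult_ac)
  qed auto
  have UQ: "(\<integral>s. U s t \<partial>lborel) = 2 * b * c * Q * (h t * h t)" for t
  proof (cases "t \<ge> 0")
    case True
    have "(\<integral>s. U s t \<partial>lborel) = (\<integral>u. U (t + u) t \<partial>lborel)"
      using lborel_integral_real_affine[of 1 "\<lambda>s. U s t" t] by simp
    also have "\<dots> = (\<integral>u. 2 * b * c * (h t * h t) * (exp (- (a + b) * u) * cos (w * u) * indicator {0..} u) \<partial>lborel)"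
    proof (intro Bochner_Integration.integral_cong refl)
      fix u
      show "U (t + u) t = 2 * b * c * (h t * h t) * (exp (- (a + b) * u) * cos (w * u) * indicator {0..} u)"
      proof (cases "u \<ge> 0")
        case u: True
        have "exp (- a * u) * h (t + u) = exp (- (a + b) * u) * h t"
          using True u by (simp add: h_def exp_add[symmetric] algebra_simps)
        then have "exp (- a * u) * h (t + u) * (2 * b * c * cos (w * u) * h t) = exp (- (a + b) * u) * h t * (2 * b * c * cos (w * u) * h t)" by simp
        then show ?thesis using u by (simp add: U_def F mult_ac)
      qed (simp add: U_def)
    qed
    also have "\<dots> = 2 * b * c * (h t * h t) * (\<integral>u. exp (- (a + b) * u) * cos (w * u) * indicator {0..} u \<partial>lborel)"
      by (rule integral_mult_right_zero)
    also have "(\<integral>u. exp (- (a + b) * u) * cos (w * u) * indicator {0..} u \<partial>lborel) = Q"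
      unfolding Q_def using abc by (intro integral_exp_cos_Ici) auto
    finally show ?thesis by simp
  qed (simp add: U_def F h_def)
  have U: "(\<integral>t. (\<integral>s. U s t \<partial>lborel) \<partial>lborel) = c * Q"
    unfolding UQ using h_times_h_integral abc by simp
  have V: "(\<integral>t. (\<integral>s. V s t \<partial>lborel) \<partial>lborel) = c * Q"
  proof -
    have "integrable (lborel \<Otimes>\<^sub>M lborel) (\<lambda>(s, t). V s t)"
    proof (rule Bochner_Integration.integrable_bound[where f = "\<lambda>(s, t). 2 * b * c * (h s * h t)"])
      show "integrable (lborel \<Otimes>\<^sub>M lborel) (\<lambda>(s, t). 2 * b * c * (h s * h t))"
      proof (rule lborel_pair.Fubini_integrable)
        show "integrable lborel (\<lambda>s. \<integral>t. norm (case (s, t) of (s, t) \<Rightarrow> 2 * b * c * (h s * h t)) \<partial>lborel)"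
          using abc h_nonneg h_integral by (simp add: abs_mult)
        show "AE s in lborel. integrable lborel (\<lambda>t. case (s, t) of (s, t) \<Rightarrow> 2 * b * c * (h s * h t))"
          using h_integral by simp
      qed measurable
      show "(\<lambda>(s, t). V s t) \<in> borel_measurable (lborel \<Otimes>\<^sub>M lborel)"
        unfolding V_if F by measurable
      show "AE z in lborel \<Otimes>\<^sub>M lborel. norm (case z of (s, t) \<Rightarrow> V s t) \<le> norm (case z of (s, t) \<Rightarrow> 2 * b * c * (h s * h t))"
      proof (intro AE_I2)
        fix z :: "real \<times> real"
        have "\<bar>V (fst z) (snd z)\<bar> \<le> \<bar>F (fst z) (snd z)\<bar>" by (simp add: V_def indicator_def)
        also have "\<dots> \<le> 2 * b * c * h (fst z) * h (snd z)" by (rule F_le)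
        finally show "norm (case z of (s, t) \<Rightarrow> V s t) \<le> norm (case z of (s, t) \<Rightarrow> 2 * b * c * (h s * h t))"
          using abc h_nonneg by (simp add: split_def mult_ac)
      qed
    qed
    from lborel_pair.Fubini_integral[OF this]
    have "(\<integral>t. (\<integral>s. V s t \<partial>lborel) \<partial>lborel) = (\<integral>s. (\<integral>t. V s t \<partial>lborel) \<partial>lborel)" .
    \<comment> \<open>By symmetry of \<open>F\<close> the integrands agree except on the diagonal, a
      null set for each fixed \<open>s\<close>.\<close>
    also have "\<dots> = (\<integral>s. (\<integral>t. U t s \<partial>lborel) \<partial>lborel)"
    proof (rule Bochner_Integration.integral_cong[OF refl])
      fix s :: real
      show "(\<integral>t. V s t \<partial>lborel) = (\<integral>t. U t s \<partial>lborel)"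
      proof (rule integral_cong_AE)
        show "(\<lambda>t. V s t) \<in> borel_measurable lborel" unfolding V_if F by measurable
        show "(\<lambda>t. U t s) \<in> borel_measurable lborel" unfolding U_def F by measurable
        show "AE t in lborel. V s t = U t s"
          using AE_lborel_singleton[of s] by eventually_elim (auto simp: V_def U_def F_sym[of s] indicator_def)
      qed
    qed
    finally show ?thesis using U by simp
  qed
  have "(\<integral>s. \<rho> (\<kappa> f) s t \<partial>lborel) = (\<integral>s. U s t \<partial>lborel) + (\<integral>s. V s t \<partial>lborel)" for t
  proof -
    have "\<rho> (\<kappa> f) s t = U s t + V s t" for s by (simp add: U_def V_def F_def indicator_def)
    then show ?thesis unfolding U_def V_def by (simp add: int1)
  qed
  moreover have "integrable lborel (\<lambda>t. \<integral>s. U s t \<partial>lborel)"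
    unfolding UQ by (intro integrable_mult_right h_times_h_integral)
  moreover have "integrable lborel (\<lambda>t. \<integral>s. V s t \<partial>lborel)"
  proof (rule Bochner_Integration.integrable_bound[where f = "\<lambda>t. 2 * b * c * (1 / b) * h t"])
    show "integrable lborel (\<lambda>t. 2 * b * c * (1 / b) * h t)" by (intro integrable_mult_right h_integral)
    show "AE t in lborel. norm (\<integral>s. V s t \<partial>lborel) \<le> norm (2 * b * c * (1 / b) * h t)"
    proof (intro AE_I2)
      fix t
      have "norm (\<integral>s. V s t \<partial>lborel) \<le> (\<integral>s. norm (V s t) \<partial>lborel)" by (rule integral_norm_bound)
      also have "\<dots> \<le> (\<integral>s. 2 * b * c * h t * h s \<partial>lborel)"
      proof (rule integral_mono)
        show "integrable lborel (\<lambda>s. norm (V s t))" unfolding V_def by (intro integrable_norm int1) simp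
        show "integrable lborel (\<lambda>s. 2 * b * c * h t * h s)" by (intro integrable_mult_right h_integral)
        show "norm (V s t) \<le> 2 * b * c * h t * h s" for s
          using F_le[of s t] abc h_nonneg by (auto simp: V_def indicator_def mult_ac)
      qed
      also have "\<dots> = 2 * b * c * (1 / b) * h t" by (simp add: h_integral)
      finally show "norm (\<integral>s. V s t \<partial>lborel) \<le> norm (2 * b * c * (1 / b) * h t)" by simp
    qed
    show "(\<lambda>t. \<integral>s. V s t \<partial>lborel) \<in> borel_measurable lborel"
      unfolding V_if F by measurable
  qed
  ultimately show ?thesis by (simp add: U V Q_def w_def)
qed

lemma fourier_line_integral:
  shows "\<exists>J. has_ms_integral_line M (fourier_integrand H f) J"
    and "has_ms_integral_line M (fourier_integrand H f) J \<Longrightarrow> circular_gaussian M J"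
    and "has_ms_integral_line M (fourier_integrand H f) J \<Longrightarrow>
      expectation (\<lambda>\<omega>. (norm (J \<omega>))\<^sup>2) = 2 * c * (a + b) / ((a + b)\<^sup>2 + (2 * pi * f)\<^sup>2)"
proof -
  interpret W: OU_weighted M a b c X Y "\<kappa> f" 1 by (rule \<kappa>_weighted)
  have Z: "fourier_integrand H f = W.Z" by (simp add: fun_eq_iff fourier_integrand_eq W.Z_def)
  show "\<exists>J. has_ms_integral_line M (fourier_integrand H f) J"
    unfolding Z by (rule W.Z_ms_integral_line_exists)
  show "circular_gaussian M J" if "has_ms_integral_line M (fourier_integrand H f) J"
    using that unfolding Z by (rule W.circular_gaussian_ms_integral_line)
  show "expectation (\<lambda>\<omega>. (norm (J \<omega>))\<^sup>2) = 2 * c * (a + b) / ((a + b)\<^sup>2 + (2 * pi * f)\<^sup>2)"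
    if "has_ms_integral_line M (fourier_integrand H f) J"
    using W.ms_integral_line_norm_sq(2)[OF that[unfolded Z]] second_moment_integral[of f]
    by (simp add: W.\<Gamma>_def W.q_def)
qed

lemma transfer_function: "has_ms_integral_line M (fourier_integrand H f) (transfer_function M H f)"
  unfolding transfer_function_def ms_integral_line_def by (rule someI_ex[OF fourier_line_integral(1)])

lemma square_integrable_transfer_function: "square_integrable M (transfer_function M H f)"
  using fourier_line_integral(2)[OF transfer_function] by (simp add: circular_gaussian_def)

text \<open>The kernels differ by at most 2 \<pi> |f - f'| t. Against the envelope e^(-bt) the
  factor t costs half of the exponent and a constant 2/b, and the remaining exponential integrates
  to 2/b; together these give 8 \<pi>/b^2.\<close>

lemma transfer_function_Lipschitz:
  "\<exists>L\<ge>0. \<forall>f f'. expectation (\<lambda>\<omega>. (norm (transfer_function M H f \<omega> - transfer_function M H f' \<omega>))\<^sup>2) \<le> L * (f - f')\<^sup>2"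
proof (intro exI[of _ "2 * b * c * (8 * pi / b\<^sup>2)\<^sup>2"] conjI allI)
  show "0 \<le> 2 * b * c * (8 * pi / b\<^sup>2)\<^sup>2" using abc by simp
  fix f f'
  interpret W: OU_weighted M a b c X Y "\<lambda>t. \<kappa> f t - \<kappa> f' t" 2 by (rule \<kappa>_diff_weighted)
  have Z: "(\<lambda>t \<omega>. fourier_integrand H f t \<omega> - fourier_integrand H f' t \<omega>) = W.Z"
    by (simp add: fun_eq_iff fourier_integrand_eq W.Z_def left_diff_distrib)
  have "has_ms_integral_line M W.Z (\<lambda>\<omega>. transfer_function M H f \<omega> - transfer_function M H f' \<omega>)"
    unfolding Z[symmetric] by (intro has_ms_integral_line_diff transfer_function sq_fourier_integrand)
  from W.ms_integral_line_norm_sq(2)[OF this]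
  have "expectation (\<lambda>\<omega>. (norm (transfer_function M H f \<omega> - transfer_function M H f' \<omega>))\<^sup>2) = W.\<Gamma> (\<lambda>_. 1) (\<lambda>_. 1)" .
  also have "\<dots> \<le> 2 * b * c * W.G (\<lambda>_. 1) * W.G (\<lambda>_. 1)"
    using W.\<Gamma>_le[OF W.bdd_const W.bdd_const, of 1 1] by linarith
  also have "\<dots> = 2 * b * c * (W.G (\<lambda>_. 1))\<^sup>2" by (simp add: power2_eq_square)
  also have "\<dots> \<le> 2 * b * c * (8 * pi / b\<^sup>2 * \<bar>f - f'\<bar>)\<^sup>2"
  proof (intro mult_left_mono power_mono W.G_nonneg)
    have "W.G (\<lambda>_. 1) \<le> (\<integral>t. (2 * pi * \<bar>f - f'\<bar> * (2 / b)) * (exp (- (b / 2) * t) * indicator {0..} t) \<partial>lborel)"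
      unfolding W.G_def
    proof (rule integral_mono)
      show "integrable lborel (\<lambda>t. \<bar>1\<bar> * W.g t)" using W.g_integrable by simp
      show "integrable lborel (\<lambda>t. (2 * pi * \<bar>f - f'\<bar> * (2 / b)) * (exp (- (b / 2) * t) * indicator {0..} t))"
        using has_bochner_integral_exp_Ici[of "b / 2"] abc
        by (intro integrable_mult_right) (simp add: has_bochner_integral_iff)
      show "\<bar>1\<bar> * W.g t \<le> (2 * pi * \<bar>f - f'\<bar> * (2 / b)) * (exp (- (b / 2) * t) * indicator {0..} t)" for t
      proof (cases "t \<ge> 0")
        case True
        have "cmod (\<kappa> f t - \<kappa> f' t) \<le> \<bar>- (2 * pi * f * t) - - (2 * pi * f' * t)\<bar>"
          unfolding \<kappa>_iexp by (rule cmod_iexp_diff_le)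
        also have "- (2 * pi * f * t) - - (2 * pi * f' * t) = - (2 * pi * (f - f') * t)" by (simp add: algebra_simps)
        also have "\<bar>- (2 * pi * (f - f') * t)\<bar> = 2 * pi * \<bar>f - f'\<bar> * t" using True by (simp add: abs_mult)
        finally have "W.g t \<le> 2 * pi * \<bar>f - f'\<bar> * t * h t"
          unfolding W.g_def by (rule mult_right_mono[OF _ h_nonneg])
        also have "\<dots> = 2 * pi * \<bar>f - f'\<bar> * (t * exp (- b * t))" using True by (simp add: h_def)
        also have "\<dots> \<le> 2 * pi * \<bar>f - f'\<bar> * (2 / b * exp (- (b / 2) * t))"
        \<comment> \<open>From y <= e^y at y = bt/2: half of the decay is exchanged for the factor
          t.\<close>
        proof (intro mult_left_mono)
          have "b / 2 * t \<le> exp (b / 2 * t)" using exp_ge_add_one_self[of "b / 2 * t"] by linarith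
          then have "t \<le> 2 / b * exp (b / 2 * t)" using abc by (simp add: field_simps)
          then have "t * exp (- b * t) \<le> 2 / b * exp (b / 2 * t) * exp (- b * t)" by (intro mult_right_mono) auto
          also have "\<dots> = 2 / b * exp (- (b / 2) * t)" by (simp add: exp_add[symmetric])
          finally show "t * exp (- b * t) \<le> 2 / b * exp (- (b / 2) * t)" .
        qed auto
        finally show ?thesis using True by (simp add: mult_ac)
      qed (simp add: W.g_def h_def)
    qed
    also have "\<dots> = (2 * pi * \<bar>f - f'\<bar> * (2 / b)) * (1 / (b / 2))"
      using has_bochner_integral_exp_Ici[of "b / 2"] abc by (simp add: has_bochner_integral_iff)
    also have "\<dots> = 8 * pi / b\<^sup>2 * \<bar>f - f'\<bar>" by (simp add: power2_eq_square)
    finally show "W.G (\<lambda>_. 1) \<le> 8 * pi / b\<^sup>2 * \<bar>f - f'\<bar>" .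
  qed (use abc in auto)
  also have "\<dots> = 2 * b * c * (8 * pi / b\<^sup>2)\<^sup>2 * (f - f')\<^sup>2"
    by (simp only: power_mult_distrib power2_abs mult.assoc)
  finally show "expectation (\<lambda>\<omega>. (norm (transfer_function M H f \<omega> - transfer_function M H f' \<omega>))\<^sup>2)
      \<le> 2 * b * c * (8 * pi / b\<^sup>2)\<^sup>2 * (f - f')\<^sup>2" .
qed

section \<open>The capacity integrand and its integral over the band\<close>

lemma capacity_integrand_diff:
  assumes "\<alpha> > 0"
  shows "\<bar>capacity_integrand M \<alpha> H f \<omega> - capacity_integrand M \<alpha> H f' \<omega>\<bar>
     \<le> sqrt \<alpha> / ln 2 * norm (transfer_function M H f \<omega> - transfer_function M H f' \<omega>)"
proof -
  have "\<bar>ln (1 + \<alpha> * (cmod (transfer_function M H f \<omega>))\<^sup>2) - ln (1 + \<alpha> * (cmod (transfer_function M H f' \<omega>))\<^sup>2)\<bar>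
     \<le> sqrt \<alpha> * \<bar>cmod (transfer_function M H f \<omega>) - cmod (transfer_function M H f' \<omega>)\<bar>"
    by (rule ln_one_add_sq_Lipschitz[OF assms])
  also have "\<dots> \<le> sqrt \<alpha> * norm (transfer_function M H f \<omega> - transfer_function M H f' \<omega>)"
    using assms by (intro mult_left_mono norm_triangle_ineq3) auto
  finally have "\<bar>ln (1 + \<alpha> * (cmod (transfer_function M H f \<omega>))\<^sup>2) - ln (1 + \<alpha> * (cmod (transfer_function M H f' \<omega>))\<^sup>2)\<bar> / ln 2
     \<le> sqrt \<alpha> * norm (transfer_function M H f \<omega> - transfer_function M H f' \<omega>) / ln 2"
    by (intro divide_right_mono) auto
  then show ?thesis by (simp add: capacity_integrand_def log_def abs_divide flip: diff_divide_distrib)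
qed

text \<open>The Lipschitz bound against 0 dominates the logarithm by a multiple of the modulus of
  the transfer function, which is in L2.\<close>

lemma square_integrable_capacity_integrand:
  assumes \<alpha>: "\<alpha> > 0"
  shows "square_integrable M (capacity_integrand M \<alpha> H f)"
proof -
  note sq = square_integrable_transfer_function[of f]
  have [measurable]: "transfer_function M H f \<in> borel_measurable M" using sq by (rule square_integrable_measurable)
  show ?thesis
    unfolding square_integrable_def
  proof
    show "capacity_integrand M \<alpha> H f \<in> borel_measurable M" unfolding capacity_integrand_def[abs_def] by measurable
    then have [measurable]: "capacity_integrand M \<alpha> H f \<in> borel_measurable M" .
    show "integrable M (\<lambda>\<omega>. (norm (capacity_integrand M \<alpha> H f \<omega>))\<^sup>2)"
    proof (rule Bochner_Integration.integrable_bound)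
      show "integrable M (\<lambda>\<omega>. (sqrt \<alpha> / ln 2)\<^sup>2 * (norm (transfer_function M H f \<omega>))\<^sup>2)"
        by (intro integrable_mult_right square_integrable_integrable_norm sq)
      show "AE \<omega> in M. norm ((norm (capacity_integrand M \<alpha> H f \<omega>))\<^sup>2) \<le> norm ((sqrt \<alpha> / ln 2)\<^sup>2 * (norm (transfer_function M H f \<omega>))\<^sup>2)"
      proof (intro AE_I2)
        fix \<omega>
        have "\<bar>ln (1 + \<alpha> * (cmod (transfer_function M H f \<omega>))\<^sup>2)\<bar> \<le> sqrt \<alpha> * cmod (transfer_function M H f \<omega>)"
          using ln_one_add_sq_Lipschitz[OF \<alpha>, of "cmod (transfer_function M H f \<omega>)" 0] by simp
        then have "\<bar>ln (1 + \<alpha> * (cmod (transfer_function M H f \<omega>))\<^sup>2)\<bar> / ln 2 \<le> sqrt \<alpha> * cmod (transfer_function M H f \<omega>) / ln 2"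
          by (intro divide_right_mono) auto
        then have "\<bar>capacity_integrand M \<alpha> H f \<omega>\<bar> \<le> sqrt \<alpha> / ln 2 * norm (transfer_function M H f \<omega>)"
          by (simp add: capacity_integrand_def log_def abs_divide)
        then have "\<bar>capacity_integrand M \<alpha> H f \<omega>\<bar>\<^sup>2 \<le> (sqrt \<alpha> / ln 2 * norm (transfer_function M H f \<omega>))\<^sup>2"
          by (intro power_mono) auto
        then show "norm ((norm (capacity_integrand M \<alpha> H f \<omega>))\<^sup>2) \<le> norm ((sqrt \<alpha> / ln 2)\<^sup>2 * (norm (transfer_function M H f \<omega>))\<^sup>2)"
          by (simp only: power_mult_distrib real_norm_def power2_abs abs_power2 abs_mult abs_norm_cancel)
      qed
    qed measurable
  qed
qed

text \<open>The integrand is Lipschitz in mean square as a function of the frequency, without a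
  jump, so the existence criterion applies on every compact interval.\<close>

lemma capacity_ms_integral_exists:
  assumes \<alpha>: "\<alpha> > 0" and AB: "A \<le> B"
  shows "\<exists>I. square_integrable M I \<and> has_ms_integral M (capacity_integrand M \<alpha> H) A B I"
proof -
  obtain L where L: "L \<ge> 0"
    and LL: "\<And>f f'. expectation (\<lambda>\<omega>. (norm (transfer_function M H f \<omega> - transfer_function M H f' \<omega>))\<^sup>2) \<le> L * (f - f')\<^sup>2"
    using transfer_function_Lipschitz by blast
  define r where "r = (sqrt \<alpha> / ln 2)\<^sup>2 * L"
  have r: "r \<ge> 0" using L by (simp add: r_def)
  have E: "expectation (\<lambda>\<omega>. (norm (capacity_integrand M \<alpha> H f \<omega> - capacity_integrand M \<alpha> H f' \<omega>))\<^sup>2) \<le> r * (f - f')\<^sup>2" for f f'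
  proof -
    have "expectation (\<lambda>\<omega>. (norm (capacity_integrand M \<alpha> H f \<omega> - capacity_integrand M \<alpha> H f' \<omega>))\<^sup>2)
       \<le> expectation (\<lambda>\<omega>. (sqrt \<alpha> / ln 2)\<^sup>2 * (norm (transfer_function M H f \<omega> - transfer_function M H f' \<omega>))\<^sup>2)"
    proof (rule integral_mono)
      show "integrable M (\<lambda>\<omega>. (norm (capacity_integrand M \<alpha> H f \<omega> - capacity_integrand M \<alpha> H f' \<omega>))\<^sup>2)"
        by (intro square_integrable_integrable_norm square_integrable_diff square_integrable_capacity_integrand \<alpha>)
      show "integrable M (\<lambda>\<omega>. (sqrt \<alpha> / ln 2)\<^sup>2 * (norm (transfer_function M H f \<omega> - transfer_function M H f' \<omega>))\<^sup>2)"
        by (intro integrable_mult_right square_integrable_integrable_norm square_integrable_diff square_integrable_transfer_function)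
      show "(norm (capacity_integrand M \<alpha> H f \<omega> - capacity_integrand M \<alpha> H f' \<omega>))\<^sup>2
          \<le> (sqrt \<alpha> / ln 2)\<^sup>2 * (norm (transfer_function M H f \<omega> - transfer_function M H f' \<omega>))\<^sup>2" for \<omega>
        using power_mono[OF capacity_integrand_diff[OF \<alpha>, of f \<omega> f'], of 2] by (simp only: power_mult_distrib real_norm_def abs_ge_zero)
    qed
    also have "\<dots> = (sqrt \<alpha> / ln 2)\<^sup>2 * expectation (\<lambda>\<omega>. (norm (transfer_function M H f \<omega> - transfer_function M H f' \<omega>))\<^sup>2)"
      by (rule integral_mult_right_zero)
    also have "\<dots> \<le> (sqrt \<alpha> / ln 2)\<^sup>2 * (L * (f - f')\<^sup>2)" by (intro mult_left_mono LL) auto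
    finally show ?thesis by (simp add: r_def)
  qed
  show ?thesis
  proof (rule has_ms_integral_exists[OF AB square_integrable_capacity_integrand[OF \<alpha>]])
    show "expectation (\<lambda>\<omega>. (norm (capacity_integrand M \<alpha> H s \<omega> - capacity_integrand M \<alpha> H t \<omega>))\<^sup>2) \<le> r * (B - A)\<^sup>2"
      if "s \<in> {A..B}" "t \<in> {A..B}" for s t
    proof -
      have "(s - t)\<^sup>2 \<le> (B - A)\<^sup>2" using that by (intro power2_le_iff_abs_le[THEN iffD2]) auto
      then show ?thesis using r by (intro order_trans[OF E] mult_left_mono)
    qed
    fix e :: real assume e: "e > 0"
    \<comment> \<open>Chosen so that r \<delta>^2 \<le> e; the added 1 covers r = 0.\<close>
    define \<delta> where "\<delta> = sqrt (e / (r + 1))"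
    have \<delta>: "\<delta> > 0" using e r by (simp add: \<delta>_def)
    have "expectation (\<lambda>\<omega>. (norm (capacity_integrand M \<alpha> H s \<omega> - capacity_integrand M \<alpha> H t \<omega>))\<^sup>2) \<le> e"
      if "\<bar>s - t\<bar> < \<delta>" for s t
    proof -
      have "(s - t)\<^sup>2 \<le> \<delta>\<^sup>2" using that \<delta> by (intro power2_le_iff_abs_le[THEN iffD2]) auto
      also have "\<delta>\<^sup>2 = e / (r + 1)" using e r by (simp add: \<delta>_def)
      finally have "r * (s - t)\<^sup>2 \<le> r * (e / (r + 1))" using r by (intro mult_left_mono)
      also have "\<dots> \<le> (r + 1) * (e / (r + 1))" using r e by (intro mult_right_mono) auto
      also have "\<dots> = e" using r by simp
      finally show ?thesis using E[of s t] by linarith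
    qed
    then show "\<exists>\<delta>>0. \<forall>s\<in>{A..B}. \<forall>t\<in>{A..B}. \<bar>s - t\<bar> < \<delta> \<longrightarrow> (s < 0 \<longleftrightarrow> t < 0) \<longrightarrow>
      expectation (\<lambda>\<omega>. (norm (capacity_integrand M \<alpha> H s \<omega> - capacity_integrand M \<alpha> H t \<omega>))\<^sup>2) \<le> e"
      using \<delta> by blast
  qed
qed

text \<open>Inserting the second moment m of the transfer function, 1/(\<alpha>m) = ((a+b)^2 + 4
  \<pi>^2 f^2)/(2\<alpha>c(a+b)). Extracting the factor 4 \<pi>^2 leaves
  \<open>\<beta>\<^sub>1 * (\<beta>\<^sub>2 + f\<^sup>2)\<close>.\<close>

lemma expectation_capacity_integrand:
  assumes \<alpha>: "\<alpha> > 0"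
  defines "\<beta>\<^sub>1 \<equiv> 2 * pi\<^sup>2 / (\<alpha> * c * (a + b))" and "\<beta>\<^sub>2 \<equiv> (a + b)\<^sup>2 / (4 * pi\<^sup>2)"
  shows "expectation (capacity_integrand M \<alpha> H f) = (\<Sum>n. laguerre n 0 (\<beta>\<^sub>1 * (\<beta>\<^sub>2 + f\<^sup>2)) / (real n + 1)) / ln 2"
proof -
  define m where "m = 2 * c * (a + b) / ((a + b)\<^sup>2 + (2 * pi * f)\<^sup>2)"
  have D: "(a + b)\<^sup>2 + (2 * pi * f)\<^sup>2 > 0" using abc by (intro add_pos_nonneg) auto
  have m: "m > 0" unfolding m_def using abc D by (intro divide_pos_pos mult_pos_pos) auto
  have "1 / (\<alpha> * m) = ((a + b)\<^sup>2 + (2 * pi * f)\<^sup>2) / (2 * \<alpha> * c * (a + b))" by (simp add: m_def)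
  also have "\<dots> = \<beta>\<^sub>1 * (\<beta>\<^sub>2 + f\<^sup>2)"
  proof -
    have "\<beta>\<^sub>2 + f\<^sup>2 = ((a + b)\<^sup>2 + (2 * pi * f)\<^sup>2) / (4 * pi\<^sup>2)"
      by (simp add: \<beta>\<^sub>2_def add_divide_distrib power_mult_distrib)
    moreover have "N / (2 * K) = 2 * pi\<^sup>2 / K * (N / (4 * pi\<^sup>2))" for N K :: real by simp
    ultimately show ?thesis unfolding \<beta>\<^sub>1_def by (simp only: mult.assoc)
  qed
  finally have x: "1 / (\<alpha> * m) = \<beta>\<^sub>1 * (\<beta>\<^sub>2 + f\<^sup>2)" .
  have "expectation (\<lambda>\<omega>. ln (1 + \<alpha> * (norm (transfer_function M H f \<omega>))\<^sup>2)) = (\<Sum>n. laguerre n 0 (1 / (\<alpha> * m)) / (real n + 1))"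
    using fourier_line_integral(2,3)[OF transfer_function, of f] m
    by (intro circular_gaussian_log_expectation \<alpha>) (auto simp: m_def)
  then show ?thesis unfolding x capacity_integrand_def[abs_def] log_def by simp
qed

lemma ergodic_capacity_sums:
  assumes \<alpha>: "\<alpha> > 0" and W: "W > 0"
    and \<beta>: "\<beta>\<^sub>1 = 2 * pi\<^sup>2 / (\<alpha> * c * (a + b))" "\<beta>\<^sub>2 = (a + b)\<^sup>2 / (4 * pi\<^sup>2)"
  shows "(\<lambda>n. W / ln 2 * (1 / (real n + 1) *
        (\<Sum>k\<le>n. 1 / (2 * real k + 1) *
           laguerre k (1 / 2) (\<beta>\<^sub>1 * W\<^sup>2 / 4) * laguerre (n - k) (- 1 / 2) (\<beta>\<^sub>1 * \<beta>\<^sub>2))))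
      sums ergodic_capacity M \<alpha> W H"
proof -
  define x where "x f = \<beta>\<^sub>1 * (\<beta>\<^sub>2 + f\<^sup>2)" for f
  define S where "S f = (\<Sum>n. laguerre n 0 (x f) / (real n + 1))" for f
  define c' where "c' n = W * (\<Sum>k\<le>n. 1 / (2 * real k + 1) *
           laguerre k (1 / 2) (\<beta>\<^sub>1 * W\<^sup>2 / 4) * laguerre (n - k) (- 1 / 2) (\<beta>\<^sub>1 * \<beta>\<^sub>2))" for n
  have b1: "\<beta>\<^sub>1 > 0" and b2: "\<beta>\<^sub>2 > 0" unfolding \<beta> using \<alpha> abc by (auto intro!: divide_pos_pos mult_pos_pos)
  have x0: "x 0 > 0" using b1 b2 by (simp add: x_def)
  \<comment> \<open>Over the band the argument stays in a compact interval whose left end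
    \<open>x 0\<close> is the product \<open>\<beta>\<^sub>1 * \<beta>\<^sub>2\<close> > 0. The
    uniform bound for the partial sums holds exactly on such intervals.\<close>
  have xle: "x f \<in> {x 0..x (W / 2)}" if "f \<in> {- W / 2..W / 2}" for f
  proof -
    have "f\<^sup>2 \<le> (W / 2)\<^sup>2" using that W by (intro power2_le_iff_abs_le[THEN iffD2]) auto
    then show ?thesis using b1 by (simp add: x_def)
  qed
  obtain B where B: "\<And>y N. y \<in> {x 0..x (W / 2)} \<Longrightarrow> \<bar>\<Sum>n<N. laguerre n 0 y / (real n + 1)\<bar> \<le> B"
    using sum_laguerre_over_Suc_bounded[OF x0, of "x (W / 2)"] by blast
  have hi: "((\<lambda>f. \<Sum>n<N. laguerre n 0 (x f) / (real n + 1)) has_integral (\<Sum>n<N. c' n / (real n + 1))) {- W / 2..W / 2}" for N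
    unfolding x_def c'_def by (intro has_integral_sum has_integral_divide has_integral_laguerre_affine_square W) auto
  \<comment> \<open>Dominated convergence is applied to the partial sums of the series, with a
    constant as majorant.\<close>
  have "S integrable_on {- W / 2..W / 2} \<and>
      (\<lambda>N. integral {- W / 2..W / 2} (\<lambda>f. \<Sum>n<N. laguerre n 0 (x f) / (real n + 1))) \<longlonglongrightarrow> integral {- W / 2..W / 2} S"
  proof (intro conjI; rule dominated_convergence[where h = "\<lambda>_. B"])
    fix f assume f: "f \<in> {- W / 2..W / 2}"
    have "x f > 0" using xle[OF f] x0 by auto
    then show "(\<lambda>N. \<Sum>n<N. laguerre n 0 (x f) / (real n + 1)) \<longlonglongrightarrow> S f"
      unfolding S_def by (intro summable_LIMSEQ summable_laguerre_over_Suc)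
    then show "(\<lambda>N. \<Sum>n<N. laguerre n 0 (x f) / (real n + 1)) \<longlonglongrightarrow> S f" .
    show "norm (\<Sum>n<N. laguerre n 0 (x f) / (real n + 1)) \<le> B" for N using B[OF xle[OF f]] by simp
    then show "norm (\<Sum>n<N. laguerre n 0 (x f) / (real n + 1)) \<le> B" for N .
  qed (use hi in \<open>auto simp: has_integral_integrable\<close>)
  then have Si: "S integrable_on {- W / 2..W / 2}" and lim: "(\<lambda>N. \<Sum>n<N. c' n / (real n + 1)) \<longlonglongrightarrow> integral {- W / 2..W / 2} S"
    using integral_unique[OF hi] by auto
  define I where "I = ms_integral M (capacity_integrand M \<alpha> H) (- W / 2) (W / 2)"
  have "\<exists>I. has_ms_integral M (capacity_integrand M \<alpha> H) (- W / 2) (W / 2) I"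
    using capacity_ms_integral_exists[OF \<alpha>, of "- W / 2" "W / 2"] W by auto
  then have I: "has_ms_integral M (capacity_integrand M \<alpha> H) (- W / 2) (W / 2) I"
    unfolding I_def ms_integral_def by (rule someI_ex)
  \<comment> \<open>Pairing with the constant 1 exchanges the expectation with the mean-square
    integral over the band.\<close>
  have "expectation (\<lambda>\<omega>. I \<omega> \<bullet> 1) = integral {- W / 2..W / 2} S / ln 2"
  proof (rule has_ms_integral_inner[OF I square_integrable_capacity_integrand[OF \<alpha>]])
    show "square_integrable M (\<lambda>_. 1 :: real)" by (simp add: square_integrable_def)
    have "expectation (\<lambda>\<omega>. capacity_integrand M \<alpha> H f \<omega> \<bullet> 1) = S f / ln 2" for f
      unfolding S_def x_def \<beta> using expectation_capacity_integrand[OF \<alpha>, of f] by simp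
    then show "((\<lambda>f. expectation (\<lambda>\<omega>. capacity_integrand M \<alpha> H f \<omega> \<bullet> 1)) has_integral integral {- W / 2..W / 2} S / ln 2) {- W / 2..W / 2}"
      using has_integral_divide[OF integrable_integral[OF Si], of "ln 2"] by simp
  qed
  then have "ergodic_capacity M \<alpha> W H = integral {- W / 2..W / 2} S / ln 2"
    by (simp add: ergodic_capacity_def I_def)
  moreover have "(\<lambda>n. c' n / (real n + 1) / ln 2) sums (integral {- W / 2..W / 2} S / ln 2)"
    using lim unfolding sums_def[symmetric] by (rule sums_divide)
  ultimately show ?thesis by (simp add: c'_def mult.commute)
qed

end

text \<open>The first two conjuncts assert that the mean-square integrals exist. They ensure that
  the choices by \<open>SOME\<close> in \<open>transfer_function\<close> and
  \<open>ms_integral\<close> select actual integrals, so that \<open>ergodic_capacity\<close> has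
  its intended meaning.\<close>

theorem mainTheorem3:
  fixes M :: "'w measure" and H :: "real \<Rightarrow> 'w \<Rightarrow> complex"
    and a b c \<alpha> W \<beta>\<^sub>1 \<beta>\<^sub>2 :: real
  assumes "prob_space M"
    and "a > 0" and "b > 0" and "c > 0" and "\<alpha> > 0" and "W > 0"
    and "attenuated_OU_channel M a b c H"
    and "\<beta>\<^sub>1 = 2 * pi\<^sup>2 / (\<alpha> * c * (a + b))"
    and "\<beta>\<^sub>2 = (a + b)\<^sup>2 / (4 * pi\<^sup>2)"
  shows "(\<forall>f. \<exists>J. has_ms_integral_line M (fourier_integrand H f) J) \<and>
    (\<exists>I. has_ms_integral M (capacity_integrand M \<alpha> H) (- W / 2) (W / 2) I) \<and>
    (\<lambda>n. W / ln 2 * (1 / (real n + 1) *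
        (\<Sum>k\<le>n. 1 / (2 * real k + 1) *
           laguerre k (1 / 2) (\<beta>\<^sub>1 * W\<^sup>2 / 4) * laguerre (n - k) (- 1 / 2) (\<beta>\<^sub>1 * \<beta>\<^sub>2))))
      sums ergodic_capacity M \<alpha> W H"
proof -
  interpret prob_space M by fact
  obtain X Y where XY: "attenuated_OU_process M a b c X" "attenuated_OU_process M a b c Y"
    "indep_var (PiM UNIV (\<lambda>_. borel)) (\<lambda>\<omega> t. X t \<omega>) (PiM UNIV (\<lambda>_. borel)) (\<lambda>\<omega> t. Y t \<omega>)"
    and H: "\<And>t \<omega>. H t \<omega> = complex_of_real (X t \<omega>) + \<i> * complex_of_real (Y t \<omega>)"
    using assms(7) unfolding attenuated_OU_channel_def by blast
  interpret C: OU_channel M a b c X Y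
    by unfold_locales (use assms(2-4) XY in auto)
  have H_eq: "H = C.H" by (simp add: fun_eq_iff H C.H_def)
  show ?thesis
    unfolding H_eq
    using C.fourier_line_integral(1) C.capacity_ms_integral_exists[OF assms(5), of "- W / 2" "W / 2"]
      C.ergodic_capacity_sums[OF assms(5,6,8,9)] assms(6) by auto
qed

end
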